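(* (1) Let $\Gamma$ be a finitely generated group that is decomposable as a direct product of two infinite groups. Then the ergodic isoperimetric constant of $\Gamma$ is trivial: $h_e(\Gamma)=0$. (2) Let $R$ be a finitely generated ergodic equivalence relation of type $\mathrm{II}_1$ that is decomposable as a direct product of two equivalence relations with infinite classes. Then the uniform isoperimetric constant of $R$ is trivial: $h(R)=0$.
   Context: Let $(X,\mu)$ be a standard non-atomic probability space. A measured equivalence relation $R$ on $(X,\mu)$ is an equivalence relation on $X$ with countable classes, Borel as a subset of $X\times X$, such that saturations of $\mu$-null sets are $\mu$-null. It is ergodic if every saturated measurable set has measure $0$ or $1$. A partial automorphism of $R$ is a bimeasurable bijection between measurable subsets of $X$ whose graph lies in $R$; $[R]$ is the group of those with domain and image $X$. $R$ is of type $\mathrm{II}_1$ if $\mu$ is invariant under every partial automorphism of $R$. $R$ is decomposable as a direct product of $R_1$ and $R_2$ if it is isomorphic to the relation $R_1\times R_2$ on $(X_1\times X_2,\mu_1\times\mu_2)$, where $R_i$ is a type $\mathrm{II}_1$ relation on $(X_i,\mu_i)$ and $(x_1,x_2)\sim(y_1,y_2)$ iff $(x_i,y_i)\in R_i$ for $i=1,2$. Put $R^x=\{(x,y)\in R\}$ and $\mathfrak h(E)=\int_X|E\cap R^x|\,d\mu(x)$ for measurable $E\subset R$. A graphing of $R$ is a countable family $\Phi=\{\varphi_i\}$ of partial automorphisms of $R$ such that for almost every $(x,y)\in R$ one has $y=\psi_n\cdots\psi_1(x)$ for some $\psi_1,\dots,\psi_n\in\Phi\cup\Phi^{-1}$;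 equivalently, a measurable subset $K\subset R$ generating $R$ up to null sets. It is finite if it can be partitioned into finitely many partial automorphisms; $R$ is finitely generated if it has a finite graphing. For a finite graphing $K\subset R$, the Cayley graph $\Sigma=\Sigma_K=\coprod_{x\in X}\Sigma^x$ is the measurable field of graphs where $\Sigma^x$ has vertex set $R^x$ and edges the pairs $((x,y),(x,z))\in R^x\times R^x$ with $(y,z)\in K$. Let $\Sigma^{(1)}$ be its set of edges and $\nu^{(1)}(E)=\int_X|E\cap\Sigma^x|\,d\mu(x)$ for measurable $E\subset\Sigma^{(1)}$. A symmetric vertex of $\Sigma$ is the graph $\{(x,\varphi(x)):x\in X\}\subset R$ of an element $\varphi\in[R]$; two are disjoint if their intersection is $\mathfrak h$-null. For a finite set $A$ of symmetric vertices, $\partial_K A\subset\Sigma^{(1)}$ is the set of edges with one vertex in (the union of) $A$ and the other outside. Then $h_K(R)=\inf_A\nu^{(1)}(\partial_KA)/|A|$ over non-empty finite sets $A$ of pairwise disjoint symmetric vertices, and $h(R)=\inf_K h_K(R)$ over all finite graphings $K$ of $R$ (the uniform isoperimetric constant). For a finitely generated group $\Gamma$, $h_e(\Gamma)=\inf_\alpha h(R_\alpha)$ over all ergodic essentially free measure-preserving actions $\alpha$ of $\Gamma$ on a standard non-atomic probability space, where $R_\alpha$ is the partition into orbits of $\alpha$. *)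

theory Defs
  imports "HOL-Probability.Probability" "HOL-Algebra.Algebra"
begin

section \<open>Standard non-atomic probability spaces\<close>

definition standard_borel :: "'a measure \<Rightarrow> bool" where
  "standard_borel M \<longleftrightarrow>
     (\<exists>T. completely_metrizable_space T \<and> second_countable T \<and> topspace T = space M \<and>
          sets M = sigma_sets (topspace T) {U. openin T U})"

definition non_atomic :: "'a measure \<Rightarrow> bool" where
  "non_atomic M \<longleftrightarrow>
     (\<forall>A\<in>sets M. emeasure M A > 0 \<longrightarrow>
        (\<exists>B\<in>sets M. B \<subseteq> A \<and> 0 < emeasure M B \<and> emeasure M B < emeasure M A))"

definition standard_nonatomic_prob :: "'a measure \<Rightarrow> bool" where
  "standard_nonatomic_prob M \<longleftrightarrow> standard_borel M \<and> prob_space M \<and> non_atomic M"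


section \<open>Measured equivalence relations\<close>

definition measured_equiv_rel :: "'a measure \<Rightarrow> ('a \<times> 'a) set \<Rightarrow> bool" where
  "measured_equiv_rel M R \<longleftrightarrow>
     equiv (space M) R \<and> R \<in> sets (M \<Otimes>\<^sub>M M) \<and>
     (\<forall>x\<in>space M. countable (R `` {x})) \<and>
     (\<forall>N\<in>null_sets M. R `` N \<in> null_sets M)"

definition ergodic_rel :: "'a measure \<Rightarrow> ('a \<times> 'a) set \<Rightarrow> bool" where
  "ergodic_rel M R \<longleftrightarrow>
     (\<forall>A\<in>sets M. R `` A = A \<longrightarrow> emeasure M A = 0 \<or> emeasure M A = 1)"

definition bimeasurable_bij ::
  "'a measure \<Rightarrow> 'a set \<Rightarrow> 'b measure \<Rightarrow> 'b set \<Rightarrow> ('a \<Rightarrow> 'b) \<Rightarrow> bool" where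
  "bimeasurable_bij M A N B f \<longleftrightarrow>
     A \<in> sets M \<and> B \<in> sets N \<and> bij_betw f A B \<and>
     f \<in> measurable (restrict_space M A) (restrict_space N B) \<and>
     the_inv_into A f \<in> measurable (restrict_space N B) (restrict_space M A)"

definition graph_on :: "'a set \<Rightarrow> ('a \<Rightarrow> 'b) \<Rightarrow> ('a \<times> 'b) set" where
  "graph_on A f = {(x, f x) | x. x \<in> A}"

definition partial_automorphism ::
  "'a measure \<Rightarrow> ('a \<times> 'a) set \<Rightarrow> 'a set \<Rightarrow> 'a set \<Rightarrow> ('a \<Rightarrow> 'a) \<Rightarrow> bool" where
  "partial_automorphism M R A B \<phi> \<longleftrightarrow> bimeasurable_bij M A M B \<phi> \<and> graph_on A \<phi> \<subseteq> R"

definition full_group :: "'a measure \<Rightarrow> ('a \<times> 'a) set \<Rightarrow> ('a \<Rightarrow> 'a) set" where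
  "full_group M R = {\<phi>. partial_automorphism M R (space M) (space M) \<phi>}"

definition type_II1 :: "'a measure \<Rightarrow> ('a \<times> 'a) set \<Rightarrow> bool" where
  "type_II1 M R \<longleftrightarrow>
     (\<forall>A B \<phi>. partial_automorphism M R A B \<phi> \<longrightarrow>
        (\<forall>C\<in>sets M. C \<subseteq> A \<longrightarrow> emeasure M (\<phi> ` C) = emeasure M C))"

definition product_rel ::
  "('a \<times> 'a) set \<Rightarrow> ('b \<times> 'b) set \<Rightarrow> (('a \<times> 'b) \<times> ('a \<times> 'b)) set" where
  "product_rel R1 R2 = {((x1, x2), (y1, y2)) | x1 x2 y1 y2. (x1, y1) \<in> R1 \<and> (x2, y2) \<in> R2}"

text \<open>Isomorphism in the measured category: a measure-preserving bijection between conull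
  measurable sets that carries one relation to the other.\<close>

definition isomorphic_rel ::
  "'a measure \<Rightarrow> ('a \<times> 'a) set \<Rightarrow> 'b measure \<Rightarrow> ('b \<times> 'b) set \<Rightarrow> bool" where
  "isomorphic_rel M R N S \<longleftrightarrow>
     (\<exists>A B f. bimeasurable_bij M A N B f \<and>
        space M - A \<in> null_sets M \<and> space N - B \<in> null_sets N \<and>
        (\<forall>C\<in>sets M. C \<subseteq> A \<longrightarrow> emeasure N (f ` C) = emeasure M C) \<and>
        (\<forall>x\<in>A. \<forall>y\<in>A. (x, y) \<in> R \<longleftrightarrow> (f x, f y) \<in> S))"

text \<open>The two factors are explicit arguments because their underlying types cannot be
  existentially quantified.\<close>

definition decomposes_as_product ::
  "'a measure \<Rightarrow> ('a \<times> 'a) set \<Rightarrow> 'b measure \<Rightarrow> ('b \<times> 'b) set \<Rightarrow>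
   'c measure \<Rightarrow> ('c \<times> 'c) set \<Rightarrow> bool" where
  "decomposes_as_product M R M1 R1 M2 R2 \<longleftrightarrow>
     standard_nonatomic_prob M1 \<and> measured_equiv_rel M1 R1 \<and> type_II1 M1 R1 \<and>
     standard_nonatomic_prob M2 \<and> measured_equiv_rel M2 R2 \<and> type_II1 M2 R2 \<and>
     isomorphic_rel M R (M1 \<Otimes>\<^sub>M M2) (product_rel R1 R2)"

definition infinite_classes :: "'a measure \<Rightarrow> ('a \<times> 'a) set \<Rightarrow> bool" where
  "infinite_classes M R \<longleftrightarrow> (AE x in M. infinite (R `` {x}))"


section \<open>Graphings\<close>

definition rel_fibre :: "('a \<times> 'a) set \<Rightarrow> 'a \<Rightarrow> ('a \<times> 'a) set" where
  "rel_fibre R x = {(x, y) | y. (x, y) \<in> R}"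

definition rel_measure :: "'a measure \<Rightarrow> ('a \<times> 'a) set \<Rightarrow> ('a \<times> 'a) set \<Rightarrow> ennreal" where
  "rel_measure M R E = (\<integral>\<^sup>+ x. emeasure (count_space UNIV) (E \<inter> rel_fibre R x) \<partial>M)"

text \<open>A subset of \<open>R\<close> is null for \<open>rel_measure M R\<close> iff almost all of its fibres are empty; this
  is how ``almost every \<open>(x, y) \<in> R\<close>'' is rendered below. Membership in
  \<open>(K \<union> K\<inverse>)\<^sup>*\<close> says that \<open>y\<close> is reached from \<open>x\<close> by a finite word.\<close>

definition graphing :: "'a measure \<Rightarrow> ('a \<times> 'a) set \<Rightarrow> ('a \<times> 'a) set \<Rightarrow> bool" where
  "graphing M R K \<longleftrightarrow>
     K \<in> sets (M \<Otimes>\<^sub>M M) \<and> K \<subseteq> R \<and>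
     (AE x in M. \<forall>y. (x, y) \<in> R \<longrightarrow> (x, y) \<in> (K \<union> K\<inverse>)\<^sup>*)"

definition finite_graphing :: "'a measure \<Rightarrow> ('a \<times> 'a) set \<Rightarrow> ('a \<times> 'a) set \<Rightarrow> bool" where
  "finite_graphing M R K \<longleftrightarrow>
     graphing M R K \<and>
     (\<exists>P. finite P \<and> partition_on K P \<and>
          (\<forall>p\<in>P. \<exists>A B \<phi>. partial_automorphism M R A B \<phi> \<and> p = graph_on A \<phi>))"

definition finitely_generated_rel :: "'a measure \<Rightarrow> ('a \<times> 'a) set \<Rightarrow> bool" where
  "finitely_generated_rel M R \<longleftrightarrow> (\<exists>K. finite_graphing M R K)"


section \<open>The uniform isoperimetric constant\<close>

text \<open>Edges of the Cayley graph are ordered pairs of vertices, and vertices are elements of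
  \<open>R\<close>.\<close>

definition cayley_fibre_edges ::
  "('a \<times> 'a) set \<Rightarrow> ('a \<times> 'a) set \<Rightarrow> 'a \<Rightarrow> (('a \<times> 'a) \<times> ('a \<times> 'a)) set" where
  "cayley_fibre_edges R K x =
     {((x, y), (x, z)) | y z. (x, y) \<in> rel_fibre R x \<and> (x, z) \<in> rel_fibre R x \<and> (y, z) \<in> K}"

definition cayley_edges ::
  "'a measure \<Rightarrow> ('a \<times> 'a) set \<Rightarrow> ('a \<times> 'a) set \<Rightarrow> (('a \<times> 'a) \<times> ('a \<times> 'a)) set" where
  "cayley_edges M R K = (\<Union>x\<in>space M. cayley_fibre_edges R K x)"

definition edge_measure ::
  "'a measure \<Rightarrow> ('a \<times> 'a) set \<Rightarrow> ('a \<times> 'a) set \<Rightarrow>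
   (('a \<times> 'a) \<times> ('a \<times> 'a)) set \<Rightarrow> ennreal" where
  "edge_measure M R K E =
     (\<integral>\<^sup>+ x. emeasure (count_space UNIV) (E \<inter> cayley_fibre_edges R K x) \<partial>M)"

definition symmetric_vertices :: "'a measure \<Rightarrow> ('a \<times> 'a) set \<Rightarrow> ('a \<times> 'a) set set" where
  "symmetric_vertices M R = {graph_on (space M) \<phi> | \<phi>. \<phi> \<in> full_group M R}"

definition edge_boundary ::
  "'a measure \<Rightarrow> ('a \<times> 'a) set \<Rightarrow> ('a \<times> 'a) set \<Rightarrow> ('a \<times> 'a) set set \<Rightarrow>
   (('a \<times> 'a) \<times> ('a \<times> 'a)) set" where
  "edge_boundary M R K A = {(u, v) \<in> cayley_edges M R K. (u \<in> \<Union>A) \<noteq> (v \<in> \<Union>A)}"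

definition admissible_family :: "'a measure \<Rightarrow> ('a \<times> 'a) set \<Rightarrow> ('a \<times> 'a) set set \<Rightarrow> bool" where
  "admissible_family M R A \<longleftrightarrow>
     A \<noteq> {} \<and> finite A \<and> A \<subseteq> symmetric_vertices M R \<and>
     pairwise (\<lambda>a b. rel_measure M R (a \<inter> b) = 0) A"

definition isoperimetric_constant_of ::
  "'a measure \<Rightarrow> ('a \<times> 'a) set \<Rightarrow> ('a \<times> 'a) set \<Rightarrow> ennreal" where
  "isoperimetric_constant_of M R K =
     (INF A\<in>{A. admissible_family M R A}.
        edge_measure M R K (edge_boundary M R K A) / of_nat (card A))"

definition uniform_isoperimetric_constant :: "'a measure \<Rightarrow> ('a \<times> 'a) set \<Rightarrow> ennreal" where
  "uniform_isoperimetric_constant M R =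
     (INF K\<in>{K. finite_graphing M R K}. isoperimetric_constant_of M R K)"


section \<open>The ergodic isoperimetric constant of a group\<close>

definition finitely_generated_group :: "('g, 'r) monoid_scheme \<Rightarrow> bool" where
  "finitely_generated_group G \<longleftrightarrow>
     (\<exists>S. finite S \<and> S \<subseteq> carrier G \<and> generate G S = carrier G)"

definition orbit_rel ::
  "('g, 'r) monoid_scheme \<Rightarrow> 'a measure \<Rightarrow> ('g \<Rightarrow> 'a \<Rightarrow> 'a) \<Rightarrow> ('a \<times> 'a) set" where
  "orbit_rel G M \<alpha> = {(x, y). x \<in> space M \<and> y \<in> orbit G \<alpha> x}"

text \<open>A measurable set is invariant under the action iff it is saturated for the orbit relation,
  so ergodicity of the action is ergodicity of \<open>orbit_rel G M \<alpha>\<close>.\<close>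

definition ergodic_free_pmp_action ::
  "('g, 'r) monoid_scheme \<Rightarrow> 'a measure \<Rightarrow> ('g \<Rightarrow> 'a \<Rightarrow> 'a) \<Rightarrow> bool" where
  "ergodic_free_pmp_action G M \<alpha> \<longleftrightarrow>
     group_action G (space M) \<alpha> \<and>
     (\<forall>g\<in>carrier G. \<alpha> g \<in> measurable M M \<and> distr M M (\<alpha> g) = M) \<and>
     (AE x in M. stabilizer G \<alpha> x = {\<one>\<^bsub>G\<^esub>}) \<and>
     ergodic_rel M (orbit_rel G M \<alpha>)"

text \<open>The infimum over all standard non-atomic probability spaces is taken over those whose
  underlying set is a set of reals. The \<open>\<sigma>\<close>-algebra is arbitrary standard Borel and need not
  be induced by the topology of the reals. A standard Borel space has at most the cardinality of
  the continuum, so every action occurs in this range up to conjugation.\<close>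

definition ergodic_isoperimetric_constant :: "('g, 'r) monoid_scheme \<Rightarrow> ennreal" where
  "ergodic_isoperimetric_constant G =
     (INF (M, \<alpha>)\<in>{(M :: real measure, \<alpha>).
          standard_nonatomic_prob M \<and> ergodic_free_pmp_action G M \<alpha>}.
        uniform_isoperimetric_constant M (orbit_rel G M \<alpha>))"

end

theory Submission
  imports Defs
begin

text \<open>
  Suppose that \<open>F \<subseteq> R\<close> is an equivalence relation with finite classes which is the union of
  finitely many disjoint symmetric vertices \<open>A\<close>. The edges of the Cayley graph coming from \<open>F\<close>
  never cross the boundary of \<open>A\<close>, so if \<open>F\<close> together with partial automorphisms of total
  measure \<open>\<epsilon>\<close> generates \<open>R\<close>, then \<open>h(R) \<le> 2\<epsilon>\<close>: the cost of \<open>F\<close> itself is irrelevant.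

  In \<open>R\<^sub>1 \<times> R\<^sub>2\<close> take \<open>F = F\<^sub>1 \<times> id\<close>, where almost all classes of \<open>F\<^sub>1 \<subseteq> R\<^sub>1\<close> have \<open>n\<close> elements and
  a measurable set \<open>B\<close> of measure \<open>1/n\<close> meets each of them in one point. Since \<open>F\<^sub>1\<close> moves the first
  coordinate into \<open>B\<close>, a partial automorphism \<open>id \<times> \<psi>\<close> only has to be added on \<open>B \<times> X\<^sub>2\<close>, at cost at
  most \<open>1/n\<close>. In particular this yields \<open>id \<times> F\<^sub>2\<close> for a relation \<open>F\<^sub>2\<close> of the same kind on \<open>X\<^sub>2\<close>, with base
  \<open>B'\<close>, and then \<open>\<phi> \<times> id\<close> only has to be added on \<open>X\<^sub>1 \<times> B'\<close>. A finite graphing of \<open>R\<close> is covered up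
  to measure \<open>\<epsilon>\<close> by finitely many products \<open>\<phi> \<times> \<psi>\<close>, and the rest of it can be added as it is.

  For groups, the product of the Bernoulli shifts of \<open>G\<close> and \<open>H\<close> is an action to which this applies.
\<close>

section \<open>Partial isomorphisms as relations\<close>

text \<open>The infimum defining h runs over all graphings, so the given one only has to certify
  that the new one generates; it is never made efficient. What shapes the argument is the order of
  the choices. The number \<open>m\<close> of maps taken from each factor depends on \<epsilon> and
  is fixed first. The base in the second factor must carry \<open>m\<close> maps, and the base in
  the first must carry \<open>m\<close> maps together with the \<open>n'\<close> maps of the second
  frame. A base can be made small only once the number of maps on it is known, so the second frame
  is built before the first, although the lift of the first is the one whose cost is irrelevant.

  Frames come from repeated halving of the space. Halving succeeds because ergodicity and the
  absence of atoms leave no set of positive measure that meets almost every class in at most one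
  point.

  The isomorphism with the product exists off null sets only, while a path joining two points visits
  several other points of their class. Null sets are therefore enlarged to saturated null sets
  before they are discarded.\<close>

text \<open>A partial isomorphism is represented by its graph, so that restriction, composition and
  inversion are operations on relations.\<close>

definition pbij :: "'a measure \<Rightarrow> 'b measure \<Rightarrow> ('a \<times> 'b) set \<Rightarrow> bool" where
  "pbij M N P \<longleftrightarrow> P \<subseteq> space M \<times> space N \<and> single_valued P \<and> single_valued (P\<inverse>) \<and>
     (\<forall>C\<in>sets M. P `` C \<in> sets N) \<and> (\<forall>C\<in>sets N. P\<inverse> `` C \<in> sets M)"

lemma pbijD:
  assumes "pbij M N P"
  shows "P \<subseteq> space M \<times> space N"
    "\<And>x y z. (x, y) \<in> P \<Longrightarrow> (x, z) \<in> P \<Longrightarrow> y = z"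
    "\<And>x y z. (x, z) \<in> P \<Longrightarrow> (y, z) \<in> P \<Longrightarrow> x = y"
    "\<And>C. C \<in> sets M \<Longrightarrow> P `` C \<in> sets N"
    "\<And>C. C \<in> sets N \<Longrightarrow> P\<inverse> `` C \<in> sets M"
    "\<And>x y. (x, y) \<in> P \<Longrightarrow> x \<in> space M"
    "\<And>x y. (x, y) \<in> P \<Longrightarrow> y \<in> space N"
  using assms unfolding pbij_def single_valued_def by auto

lemma pbijI:
  assumes "P \<subseteq> space M \<times> space N"
    "\<And>x y z. (x, y) \<in> P \<Longrightarrow> (x, z) \<in> P \<Longrightarrow> y = z"
    "\<And>x y z. (x, z) \<in> P \<Longrightarrow> (y, z) \<in> P \<Longrightarrow> x = y"
    "\<And>C. C \<in> sets M \<Longrightarrow> P `` C \<in> sets N"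
    "\<And>C. C \<in> sets N \<Longrightarrow> P\<inverse> `` C \<in> sets M"
  shows "pbij M N P"
  using assms unfolding pbij_def single_valued_def by (auto; blast)

lemma pbij_converse: "pbij M N P \<Longrightarrow> pbij N M (P\<inverse>)"
  unfolding pbij_def by auto

lemma pbij_comp:
  assumes P: "pbij M N P" and Q: "pbij N L Q"
  shows "pbij M L (P O Q)"
proof (rule pbijI)
  show "(P O Q) `` C \<in> sets L" if "C \<in> sets M" for C
    using that
    by (simp add: relcomp_Image pbijD(4)[OF P] pbijD(4)[OF Q])
  show "(P O Q)\<inverse> `` C \<in> sets M" if "C \<in> sets L" for C
    using that
    by (simp add: relcomp_Image converse_relcomp pbijD(5)[OF P] pbijD(5)[OF Q])
  show "P O Q \<subseteq> space M \<times> space L" using pbijD(1)[OF P] pbijD(1)[OF Q] by auto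
  show "\<And>x y z. (x, y) \<in> P O Q \<Longrightarrow> (x, z) \<in> P O Q \<Longrightarrow> y = z"
    using pbijD(2)[OF P] pbijD(2)[OF Q] by (metis relcompE Pair_inject)
  show "\<And>x y z. (x, z) \<in> P O Q \<Longrightarrow> (y, z) \<in> P O Q \<Longrightarrow> x = y"
    using pbijD(3)[OF P] pbijD(3)[OF Q] by (metis relcompE Pair_inject)
qed

lemma pbij_restrict:
  assumes P: "pbij M N P" and A: "A \<in> sets M" and B: "B \<in> sets N"
  shows "pbij M N (P \<inter> A \<times> B)"
proof (rule pbijI)
  have "(P \<inter> A \<times> B) `` C = P `` (C \<inter> A) \<inter> B" for C by auto
  then show "(P \<inter> A \<times> B) `` C \<in> sets N" if "C \<in> sets M" for C
    using that A B pbijD(4)[OF P] by auto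
  have "(P \<inter> A \<times> B)\<inverse> `` C = P\<inverse> `` (C \<inter> B) \<inter> A" for C by auto
  then show "(P \<inter> A \<times> B)\<inverse> `` C \<in> sets M" if "C \<in> sets N" for C
    using that A B pbijD(5)[OF P] by auto
qed (use pbijD(1)[OF P] in \<open>auto dest: pbijD(2)[OF P] pbijD(3)[OF P]\<close>)

lemma pbij_Id_on: "A \<in> sets M \<Longrightarrow> pbij M M (Id_on A)"
proof (rule pbijI)
  fix C assume A: "A \<in> sets M"
  have "Id_on A `` C = A \<inter> C" by auto
  then show "C \<in> sets M \<Longrightarrow> Id_on A `` C \<in> sets M" "C \<in> sets M \<Longrightarrow> (Id_on A)\<inverse> `` C \<in> sets M"
    using A by auto
qed (auto dest: sets.sets_into_space)

lemma pbij_UN: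
  assumes "countable I" and P: "\<And>i. i \<in> I \<Longrightarrow> pbij M N (P i)"
    and sv: "\<And>i j x y z. i \<in> I \<Longrightarrow> j \<in> I \<Longrightarrow> (x, y) \<in> P i \<Longrightarrow> (x, z) \<in> P j \<Longrightarrow> y = z"
    and sv': "\<And>i j x y z. i \<in> I \<Longrightarrow> j \<in> I \<Longrightarrow> (x, z) \<in> P i \<Longrightarrow> (y, z) \<in> P j \<Longrightarrow> x = y"
  shows "pbij M N (\<Union>i\<in>I. P i)"
proof (rule pbijI)
  have "(\<Union>i\<in>I. P i) `` C = (\<Union>i\<in>I. P i `` C)" for C by auto
  then show "(\<Union>i\<in>I. P i) `` C \<in> sets N" if "C \<in> sets M" for C
    using that assms(1) pbijD(4)[OF P] by auto
  have "(\<Union>i\<in>I. P i)\<inverse> `` C = (\<Union>i\<in>I. (P i)\<inverse> `` C)" for C by auto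
  then show "(\<Union>i\<in>I. P i)\<inverse> `` C \<in> sets M" if "C \<in> sets N" for C
    using that assms(1) pbijD(5)[OF P] by auto
next
  show "(\<Union>i\<in>I. P i) \<subseteq> space M \<times> space N" using pbijD(1)[OF P] by blast
qed (auto dest: sv sv')

lemma pbij_Domain: "pbij M N P \<Longrightarrow> Domain P \<in> sets M"
proof -
  assume P: "pbij M N P"
  have "Domain P = P\<inverse> `` space N" using pbijD(1)[OF P] by auto
  then show ?thesis using pbijD(5)[OF P] by simp
qed

lemma pbij_Range: "pbij M N P \<Longrightarrow> Range P \<in> sets N"
  using pbij_Domain[OF pbij_converse] by auto

text \<open>Images of rectangles are rectangles, and the general case follows by induction over the
  product sigma-algebra. The complement step relies on injectivity of both factors: the image of a
  complement is the complement of the image within the rectangle of the two ranges.\<close>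

lemma pbij_prod:
  assumes P: "pbij M M P" and Q: "pbij N N Q"
  shows "pbij (M \<Otimes>\<^sub>M N) (M \<Otimes>\<^sub>M N) (product_rel P Q)"
proof -
  have im: "product_rel P Q `` C \<in> sets (M \<Otimes>\<^sub>M N)"
    if C: "C \<in> sets (M \<Otimes>\<^sub>M N)" and P: "pbij M M P" and Q: "pbij N N Q" for P Q C
    using C unfolding sets_pair_measure
  proof (induction rule: sigma_sets.induct)
    case (Basic a)
    then obtain A B where a: "a = A \<times> B" "A \<in> sets M" "B \<in> sets N" by auto
    have "product_rel P Q `` a = P `` A \<times> Q `` B" unfolding product_rel_def a by force
    then have "product_rel P Q `` a \<in> sets (M \<Otimes>\<^sub>M N)"
      using pbijD(4)[OF P] pbijD(4)[OF Q] a by simp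
    then show ?case unfolding sets_pair_measure .
  next
    case Empty
    then show ?case by (simp add: sigma_sets.Empty)
  next
    case (Compl a)
    have "product_rel P Q `` (space M \<times> space N - a) =
        (Range P \<times> Range Q) - product_rel P Q `` a" (is "?L = ?R")
    proof (intro Set.set_eqI iffI)
      fix v assume "v \<in> product_rel P Q `` (space M \<times> space N - a)"
      then obtain a1 b1 c d where v: "v = (c, d)" "(a1, c) \<in> P" "(b1, d) \<in> Q" "(a1, b1) \<notin> a"
        unfolding product_rel_def by auto
      have "v \<notin> product_rel P Q `` a"
      proof
        assume "v \<in> product_rel P Q `` a"
        then obtain a2 b2 where ab: "(a2, b2) \<in> a" "(a2, c) \<in> P" "(b2, d) \<in> Q"
          unfolding product_rel_def v(1) by blast
        then have "a2 = a1" "b2 = b1" using pbijD(3)[OF P] pbijD(3)[OF Q] v(2,3) by blast+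
        then show False using ab(1) v(4) by simp
      qed
      then show "v \<in> (Range P \<times> Range Q) - product_rel P Q `` a" using v by auto
    next
      fix v assume v: "v \<in> (Range P \<times> Range Q) - product_rel P Q `` a"
      then obtain a1 b1 c d where v': "v = (c, d)" "(a1, c) \<in> P" "(b1, d) \<in> Q" by auto
      then have "((a1, b1), v) \<in> product_rel P Q" unfolding product_rel_def by auto
      moreover have "(a1, b1) \<in> space M \<times> space N - a"
        using v v' pbijD(6)[OF P v'(2)] pbijD(6)[OF Q v'(3)] \<open>((a1, b1), v) \<in> product_rel P Q\<close> by auto
      ultimately show "v \<in> product_rel P Q `` (space M \<times> space N - a)" by blast
    qed
    moreover have "product_rel P Q `` a \<in> sets (M \<Otimes>\<^sub>M N)"
      using Compl unfolding sets_pair_measure by simp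
    ultimately have "product_rel P Q `` (space M \<times> space N - a) \<in> sets (M \<Otimes>\<^sub>M N)"
      using pbij_Range[OF P] pbij_Range[OF Q] by simp
    then show ?case unfolding sets_pair_measure .
  next
    case (Union a)
    have "product_rel P Q `` (\<Union>i. a i) = (\<Union>i. product_rel P Q `` a i)" by auto
    then show ?case using Union by (simp add: sigma_sets.Union)
  qed
  have conv: "(product_rel P Q)\<inverse> = product_rel (P\<inverse>) (Q\<inverse>)" unfolding product_rel_def by auto
  show ?thesis
  proof (rule pbijI)
    show "product_rel P Q \<subseteq> space (M \<Otimes>\<^sub>M N) \<times> space (M \<Otimes>\<^sub>M N)"
      using pbijD(1)[OF P] pbijD(1)[OF Q] unfolding product_rel_def space_pair_measure by auto
    show "\<And>C. C \<in> sets (M \<Otimes>\<^sub>M N) \<Longrightarrow> product_rel P Q `` C \<in> sets (M \<Otimes>\<^sub>M N)"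
      using im P Q by blast
    show "\<And>C. C \<in> sets (M \<Otimes>\<^sub>M N) \<Longrightarrow> (product_rel P Q)\<inverse> `` C \<in> sets (M \<Otimes>\<^sub>M N)"
      unfolding conv using im pbij_converse[OF P] pbij_converse[OF Q] by blast
  qed (auto simp: product_rel_def dest: pbijD(2)[OF P] pbijD(2)[OF Q] pbijD(3)[OF P] pbijD(3)[OF Q])
qed

lemma pbij_section1:
  assumes y: "y \<in> space N" "{y} \<in> sets N"
  shows "pbij M (M \<Otimes>\<^sub>M N) {(x, (x, y)) | x. x \<in> space M}"
proof (rule pbijI)
  show "{(x, (x, y)) | x. x \<in> space M} `` C \<in> sets (M \<Otimes>\<^sub>M N)" if "C \<in> sets M" for C
  proof -
    have "{(x, (x, y)) | x. x \<in> space M} `` C = C \<times> {y}"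
      using sets.sets_into_space[OF that] by auto
    then show ?thesis using y that by simp
  qed
  show "{(x, (x, y)) | x. x \<in> space M}\<inverse> `` C \<in> sets M" if "C \<in> sets (M \<Otimes>\<^sub>M N)" for C
  proof -
    have "{(x, (x, y)) | x. x \<in> space M}\<inverse> `` C = (\<lambda>x. (x, y)) -` C"
      using sets.sets_into_space[OF that] by (auto simp: space_pair_measure)
    then show ?thesis using sets_Pair2[OF that] by simp
  qed
qed (use y in \<open>auto simp: space_pair_measure\<close>)

lemma pbij_section2:
  assumes y: "y \<in> space M" "{y} \<in> sets M"
  shows "pbij N (M \<Otimes>\<^sub>M N) {(x, (y, x)) | x. x \<in> space N}"
proof (rule pbijI)
  show "{(x, (y, x)) | x. x \<in> space N} `` C \<in> sets (M \<Otimes>\<^sub>M N)" if "C \<in> sets N" for C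
  proof -
    have "{(x, (y, x)) | x. x \<in> space N} `` C = {y} \<times> C"
      using sets.sets_into_space[OF that] by auto
    then show ?thesis using y that by simp
  qed
  show "{(x, (y, x)) | x. x \<in> space N}\<inverse> `` C \<in> sets N" if "C \<in> sets (M \<Otimes>\<^sub>M N)" for C
  proof -
    have "{(x, (y, x)) | x. x \<in> space N}\<inverse> `` C = Pair y -` C"
      using sets.sets_into_space[OF that] by (auto simp: space_pair_measure)
    then show ?thesis using sets_Pair1[OF that] by simp
  qed
qed (use y in \<open>auto simp: space_pair_measure\<close>)

lemma bimeasurable_bij_imp_pbij:
  assumes f: "bimeasurable_bij M A N B f"
  shows "pbij M N (graph_on A f)"
proof -
  have A: "A \<in> sets M" and B: "B \<in> sets N" and bij: "bij_betw f A B"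
    and m1: "f \<in> measurable (restrict_space M A) (restrict_space N B)"
    and m2: "the_inv_into A f \<in> measurable (restrict_space N B) (restrict_space M A)"
    using f unfolding bimeasurable_bij_def by auto
  have As: "A \<subseteq> space M" and Bs: "B \<subseteq> space N"
    using sets.sets_into_space A B by auto
  have fAB: "f ` A = B" and inj: "inj_on f A" using bij by (auto simp: bij_betw_def)
  show ?thesis
  proof (rule pbijI)
    show "graph_on A f \<subseteq> space M \<times> space N" using As Bs fAB by (auto simp: graph_on_def)
    show "\<And>x y z. (x, y) \<in> graph_on A f \<Longrightarrow> (x, z) \<in> graph_on A f \<Longrightarrow> y = z"
      by (auto simp: graph_on_def)
    show "\<And>x y z. (x, z) \<in> graph_on A f \<Longrightarrow> (y, z) \<in> graph_on A f \<Longrightarrow> x = y"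
      using inj by (auto simp: graph_on_def inj_on_def)
    show "graph_on A f `` C \<in> sets N" if C: "C \<in> sets M" for C
    proof -
      have "A \<inter> C \<in> sets (restrict_space M A)" using C by (auto simp: sets_restrict_space)
      then have "the_inv_into A f -` (A \<inter> C) \<inter> space (restrict_space N B) \<in> sets (restrict_space N B)"
        using m2 by (rule measurable_sets[rotated])
      moreover have "the_inv_into A f -` (A \<inter> C) \<inter> space (restrict_space N B) = graph_on A f `` C"
        using Bs fAB inj by (auto simp: space_restrict_space graph_on_def the_inv_into_f_f)
      ultimately show ?thesis using B by (auto simp: sets_restrict_space)
    qed
    show "(graph_on A f)\<inverse> `` C \<in> sets M" if C: "C \<in> sets N" for C
    proof -
      have "B \<inter> C \<in> sets (restrict_space N B)" using C by (auto simp: sets_restrict_space)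
      then have "f -` (B \<inter> C) \<inter> space (restrict_space M A) \<in> sets (restrict_space M A)"
        using m1 by (rule measurable_sets[rotated])
      moreover have "f -` (B \<inter> C) \<inter> space (restrict_space M A) = (graph_on A f)\<inverse> `` C"
        using As fAB inj by (auto simp: space_restrict_space graph_on_def)
      ultimately show ?thesis using A by (auto simp: sets_restrict_space)
    qed
  qed
qed

lemma pbij_imp_bimeasurable_bij:
  assumes P: "pbij M N P"
  obtains f where "bimeasurable_bij M (Domain P) N (Range P) f" "P = graph_on (Domain P) f"
proof
  define f where "f x = (THE y. (x, y) \<in> P)" for x
  have f: "f x = y" if "(x, y) \<in> P" for x y
    unfolding f_def using that pbijD(2)[OF P] by blast
  show gr: "P = graph_on (Domain P) f"
    unfolding graph_on_def using f by (auto; metis)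
  have A: "Domain P \<in> sets M" and B: "Range P \<in> sets N"
    using pbij_Domain[OF P] pbij_Range[OF P] .
  have As: "Domain P \<subseteq> space M" and Bs: "Range P \<subseteq> space N"
    using sets.sets_into_space A B by auto
  have inj: "inj_on f (Domain P)"
    using f pbijD(3)[OF P] by (auto simp: inj_on_def)
  have fD: "(x, f x) \<in> P" if "x \<in> Domain P" for x
    using that f by (metis DomainE)
  have inv_img: "P\<inverse> `` D = {x \<in> Domain P. f x \<in> D}" for D
    using fD f by (auto; metis)
  have img: "f ` Domain P = Range P"
  proof
    show "f ` Domain P \<subseteq> Range P" using fD by auto
    show "Range P \<subseteq> f ` Domain P" using f by (metis DomainI RangeE image_eqI subsetI)
  qed
  have inv: "the_inv_into (Domain P) f y = x" if "(x, y) \<in> P" for x y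
    using that f inj the_inv_into_f_f by (metis DomainI)
  show "bimeasurable_bij M (Domain P) N (Range P) f"
    unfolding bimeasurable_bij_def
  proof (intro conjI A B measurableI)
    show "bij_betw f (Domain P) (Range P)" using inj img by (simp add: bij_betw_def)
    show "\<And>x. x \<in> space (restrict_space M (Domain P)) \<Longrightarrow> f x \<in> space (restrict_space N (Range P))"
      using Bs f by (auto simp: space_restrict_space)
    show "\<And>x. x \<in> space (restrict_space N (Range P)) \<Longrightarrow>
        the_inv_into (Domain P) f x \<in> space (restrict_space M (Domain P))"
      using As inv by (auto simp: space_restrict_space)
    show "f -` C \<inter> space (restrict_space M (Domain P)) \<in> sets (restrict_space M (Domain P))"
      if C: "C \<in> sets (restrict_space N (Range P))" for C
    proof -
      obtain D where D: "D \<in> sets N" "C = Range P \<inter> D"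
        using C by (auto simp: sets_restrict_space)
      have "f x \<in> Range P" if "x \<in> Domain P" for x using fD[OF that] by (rule RangeI)
      then have "f -` C \<inter> space (restrict_space M (Domain P)) = Domain P \<inter> P\<inverse> `` D"
        using As D(2) unfolding inv_img space_restrict_space by blast
      then show ?thesis using pbijD(5)[OF P D(1)] by (auto simp: sets_restrict_space)
    qed
    show "the_inv_into (Domain P) f -` C \<inter> space (restrict_space N (Range P)) \<in> sets (restrict_space N (Range P))"
      if C: "C \<in> sets (restrict_space M (Domain P))" for C
    proof -
      obtain D where D: "D \<in> sets M" "C = Domain P \<inter> D"
        using C by (auto simp: sets_restrict_space)
      have "y \<in> P `` D \<longleftrightarrow> the_inv_into (Domain P) f y \<in> C" if y: "y \<in> Range P" for y
      proof -
        obtain x where x: "(x, y) \<in> P" using y by auto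
        then have eq: "the_inv_into (Domain P) f y = x" by (rule inv)
        have "y \<in> P `` D \<longleftrightarrow> x \<in> D"
        proof
          assume "y \<in> P `` D"
          then obtain x' where "x' \<in> D" "(x', y) \<in> P" by (rule ImageE)
          then show "x \<in> D" using pbijD(3)[OF P _ x] by simp
        qed (use x in blast)
        then show ?thesis unfolding eq D(2) using x by blast
      qed
      then have "the_inv_into (Domain P) f -` C \<inter> space (restrict_space N (Range P)) = Range P \<inter> P `` D"
        using Bs unfolding space_restrict_space by blast
      then show ?thesis using pbijD(4)[OF P D(1)] by (auto simp: sets_restrict_space)
    qed
  qed
qed

section \<open>Countably separated measurable spaces\<close>

text \<open>This is what standardness contributes to the argument: it makes graphs, coincidence sets
  and single points measurable, and it lets a countable matching procedure tell any two points
  apart.\<close>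

definition separated :: "'a measure \<Rightarrow> bool" where
  "separated M \<longleftrightarrow> (\<exists>\<U>. countable \<U> \<and> \<U> \<subseteq> sets M \<and>
     (\<forall>x\<in>space M. \<forall>y\<in>space M. x \<noteq> y \<longrightarrow> (\<exists>U\<in>\<U>. x \<in> U \<and> y \<notin> U)))"

lemma standard_borel_separated:
  assumes "standard_borel M"
  shows "separated M"
proof -
  obtain T where T: "completely_metrizable_space T" "second_countable T" "topspace T = space M"
    "sets M = sigma_sets (topspace T) {U. openin T U}"
    using assms unfolding standard_borel_def by auto
  obtain \<B> where \<B>: "countable \<B>" "\<forall>V\<in>\<B>. openin T V"
    "\<forall>U x. openin T U \<and> x \<in> U \<longrightarrow> (\<exists>V\<in>\<B>. x \<in> V \<and> V \<subseteq> U)"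
    using T(2) unfolding second_countable_def by auto
  have H: "Hausdorff_space T"
    using T(1) by (simp add: completely_metrizable_imp_metrizable_space metrizable_imp_Hausdorff_space)
  show ?thesis unfolding separated_def
  proof (intro exI[of _ \<B>] conjI ballI impI)
    show "\<B> \<subseteq> sets M" unfolding T(4) using \<B>(2) by auto
    fix x y assume "x \<in> space M" "y \<in> space M" "x \<noteq> y"
    then obtain U V where "openin T U" "openin T V" "x \<in> U" "y \<in> V" "disjnt U V"
      using H T(3) unfolding Hausdorff_space_def by metis
    then show "\<exists>U\<in>\<B>. x \<in> U \<and> y \<notin> U"
      using \<B>(3) by (metis disjnt_iff subsetD)
  qed (fact \<B>(1))
qed

text \<open>A point of the rectangle spanned by domain and range is off the graph exactly when some
  \<open>U\<close> of the separating family contains the true image but not the second coordinate.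
  What is removed is thus a countable union of measurable rectangles.\<close>

lemma pbij_in_sets:
  assumes "separated N" and P: "pbij M N P"
  shows "P \<in> sets (M \<Otimes>\<^sub>M N)"
proof -
  obtain \<U> where \<U>: "countable \<U>" "\<U> \<subseteq> sets N"
    "\<forall>x\<in>space N. \<forall>y\<in>space N. x \<noteq> y \<longrightarrow> (\<exists>U\<in>\<U>. x \<in> U \<and> y \<notin> U)"
    using assms(1) unfolding separated_def by meson
  have "P = Domain P \<times> Range P - (\<Union>U\<in>\<U>. P\<inverse> `` U \<times> (space N - U))" (is "_ = ?R")
  proof (intro Set.set_eqI iffI)
    fix p assume "p \<in> P"
    then show "p \<in> ?R" by (cases p) (auto dest: pbijD(2)[OF P])
  next
    fix p assume p: "p \<in> ?R"
    obtain x y where xy: "p = (x, y)" by fastforce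
    obtain z where z: "(x, z) \<in> P" using p xy by auto
    have "z = y"
    proof (rule ccontr)
      assume "z \<noteq> y"
      moreover have "z \<in> space N" "y \<in> space N" using z p xy pbijD(7)[OF P] by auto
      ultimately obtain U where "U \<in> \<U>" "z \<in> U" "y \<notin> U" using \<U>(3) by blast
      then show False using p xy z \<open>y \<in> space N\<close> by auto
    qed
    then show "p \<in> P" using z xy by simp
  qed
  also have "\<dots> \<in> sets (M \<Otimes>\<^sub>M N)"
    using \<U>(1,2) pbijD(5)[OF P] pbij_Domain[OF P] pbij_Range[OF P]
    by (intro sets.Diff sets.countable_UN'' pair_measureI) auto
  finally show ?thesis .
qed

text \<open>Two values differ exactly when a member of the separating family splits them.
  Measurability of the coincidence set is what makes the difference of two graphs a partial
  isomorphism again.\<close>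

lemma pbij_agree:
  assumes "separated N" and P: "pbij M N P" and Q: "pbij M N Q"
  shows "Domain (P \<inter> Q) \<in> sets M"
proof -
  obtain \<U> where \<U>: "countable \<U>" "\<U> \<subseteq> sets N"
    "\<forall>x\<in>space N. \<forall>y\<in>space N. x \<noteq> y \<longrightarrow> (\<exists>U\<in>\<U>. x \<in> U \<and> y \<notin> U)"
    using assms(1) unfolding separated_def by meson
  have "Domain (P \<inter> Q) = Domain P \<inter> Domain Q - (\<Union>U\<in>\<U>. P\<inverse> `` U \<inter> Q\<inverse> `` (space N - U))" (is "_ = ?R")
  proof (intro Set.set_eqI iffI)
    fix x assume "x \<in> Domain (P \<inter> Q)"
    then show "x \<in> ?R" using pbijD(2)[OF P] pbijD(2)[OF Q] by blast
  next
    fix x assume x: "x \<in> ?R"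
    obtain y z where yz: "(x, y) \<in> P" "(x, z) \<in> Q" using x by auto
    have sp: "z \<in> space N" "y \<in> space N" using yz pbijD(7)[OF P] pbijD(7)[OF Q] by auto
    have "y = z"
    proof (rule ccontr)
      assume "y \<noteq> z"
      then obtain U where "U \<in> \<U>" "y \<in> U" "z \<notin> U" using \<U>(3) sp by blast
      then show False using x yz sp by auto
    qed
    then show "x \<in> Domain (P \<inter> Q)" using yz by auto
  qed
  also have "\<dots> \<in> sets M"
    using \<U>(1,2) pbijD(5)[OF P] pbijD(5)[OF Q] pbij_Domain[OF P] pbij_Domain[OF Q]
    by (intro sets.Diff sets.countable_UN'' sets.Int) auto
  finally show ?thesis .
qed

lemma pbij_Diff:
  assumes "separated N" and P: "pbij M N P" and Q: "pbij M N Q"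
  shows "pbij M N (P - Q)"
proof -
  have "P - Q = P \<inter> (space M - Domain (P \<inter> Q)) \<times> space N"
    using pbijD[OF P] by auto
  then show ?thesis
    using pbij_restrict[OF P, of "space M - Domain (P \<inter> Q)" "space N"] pbij_agree[OF assms] by auto
qed

lemma separated_singleton:
  assumes "separated M" "x \<in> space M"
  shows "{x} \<in> sets M"
proof -
  obtain \<U> where \<U>: "countable \<U>" "\<U> \<subseteq> sets M"
    "\<forall>x\<in>space M. \<forall>y\<in>space M. x \<noteq> y \<longrightarrow> (\<exists>U\<in>\<U>. x \<in> U \<and> y \<notin> U)"
    using assms(1) unfolding separated_def by meson
  have "{x} = space M - (\<Union>U\<in>{U\<in>\<U>. x \<notin> U}. U)"
    using \<U>(2,3) assms(2) by auto
  also have "\<dots> \<in> sets M"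
    using \<U>(1,2) by (intro sets.Diff sets.countable_UN'') auto
  finally show ?thesis .
qed

section \<open>Frames and the isoperimetric criterion\<close>

lemma partial_automorphism_imp_pbij:
  "partial_automorphism M R A B f \<Longrightarrow> pbij M M (graph_on A f)"
  unfolding partial_automorphism_def by (auto intro: bimeasurable_bij_imp_pbij)

lemma pbij_imp_partial_automorphism:
  assumes P: "pbij M M P" and "P \<subseteq> R"
  obtains f where "partial_automorphism M R (Domain P) (Range P) f" "P = graph_on (Domain P) f"
  using pbij_imp_bimeasurable_bij[OF P] assms(2) unfolding partial_automorphism_def by metis

lemma type_II1_image:
  assumes II: "type_II1 M R" and P: "pbij M M P" "P \<subseteq> R" and C: "C \<in> sets M" "C \<subseteq> Domain P"
  shows "emeasure M (P `` C) = emeasure M C"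
proof -
  obtain f where f: "partial_automorphism M R (Domain P) (Range P) f" "P = graph_on (Domain P) f"
    by (rule pbij_imp_partial_automorphism[OF P])
  have "P `` C = f ` C"
    using C(2) by (subst f(2)) (fastforce simp: graph_on_def Image_def)
  then show ?thesis using II f(1) C unfolding type_II1_def by metis
qed

lemma type_II1_image_le:
  assumes II: "type_II1 M R" and P: "pbij M M P" "P \<subseteq> R" and C: "C \<in> sets M"
  shows "emeasure M (P `` C) \<le> emeasure M C"
proof -
  have "P `` C = P `` (C \<inter> Domain P)" by auto
  then have "emeasure M (P `` C) = emeasure M (C \<inter> Domain P)"
    using type_II1_image[OF II P, of "C \<inter> Domain P"] C pbij_Domain[OF P(1)] by auto
  also have "\<dots> \<le> emeasure M C" using C by (auto intro: emeasure_mono)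
  finally show ?thesis .
qed

lemma type_II1_Range:
  assumes "type_II1 M R" "pbij M M P" "P \<subseteq> R"
  shows "emeasure M (Range P) = emeasure M (Domain P)"
proof -
  have "Range P = P `` Domain P" by auto
  then show ?thesis using type_II1_image[OF assms pbij_Domain[OF assms(2)]] by auto
qed

lemma pbij_Diff_Union:
  assumes sep: "separated N" and q: "pbij M N q" and "finite Q" "\<And>s. s \<in> Q \<Longrightarrow> pbij M N s"
  shows "pbij M N (q - \<Union>Q)"
  using assms(3,4)
proof (induction Q rule: finite_induct)
  case (insert s Q)
  have "q - \<Union>(insert s Q) = (q - \<Union>Q) - s" by auto
  moreover have "pbij M N (q - \<Union>Q)" "pbij M N s" using insert.IH insert.prems by auto
  ultimately show ?case using pbij_Diff[OF sep] by metis
qed (use q in simp)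

text \<open>A finite graphing must be partitioned by its pieces, whereas the maps constructed later
  overlap. Each new map loses what is already covered; an empty remainder is dropped because a
  partition has no empty block.\<close>

lemma pbij_finite_partition:
  assumes sep: "separated M" and "finite Q" "\<And>q. q \<in> Q \<Longrightarrow> pbij M M q"
  shows "\<exists>P. finite P \<and> partition_on (\<Union>Q) P \<and> (\<forall>p\<in>P. pbij M M p \<and> p \<subseteq> \<Union>Q)"
  using assms(2,3)
proof (induction Q rule: finite_induct)
  case empty
  then show ?case by (intro exI[of _ "{}"]) (auto simp: partition_on_def)
next
  case (insert q Q)
  then obtain P where P: "finite P" "partition_on (\<Union>Q) P" "\<forall>p\<in>P. pbij M M p \<and> p \<subseteq> \<Union>Q"
    by auto
  have q': "pbij M M (q - \<Union>Q)" using pbij_Diff_Union[OF sep _ insert.hyps(1)] insert.prems by simp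
  show ?case
  proof (cases "q - \<Union>Q = {}")
    case True
    then have "\<Union>(insert q Q) = \<Union>Q" by auto
    then show ?thesis using P by metis
  next
    case False
    have "partition_on (\<Union>(insert q Q)) (insert (q - \<Union>Q) P)"
    proof (rule partition_onI)
      have U: "\<Union>P = \<Union>Q" and d: "\<And>p p'. p \<in> P \<Longrightarrow> p' \<in> P \<Longrightarrow> p \<noteq> p' \<Longrightarrow> disjnt p p'" and ne: "{} \<notin> P"
        using P(2) unfolding partition_on_def by (auto simp: disjoint_def disjnt_def)
      show "\<Union>(insert (q - \<Union>Q) P) = \<Union>(insert q Q)" using U by auto
      have "disjnt (q - \<Union>Q) p" if "p \<in> P" for p
        using that U by (auto simp: disjnt_def)
      then show "disjnt p p'" if "p \<in> insert (q - \<Union>Q) P" "p' \<in> insert (q - \<Union>Q) P" "p \<noteq> p'" for p p'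
        using that d by (auto simp: disjnt_sym)
      show "{} \<notin> insert (q - \<Union>Q) P" using False ne by auto
    qed
    then show ?thesis using P q' by (intro exI[of _ "insert (q - \<Union>Q) P"]) auto
  qed
qed

lemma finite_graphing_pbij:
  assumes "finite_graphing M R K"
  obtains Q where "finite Q" "K = \<Union>Q" "\<And>q. q \<in> Q \<Longrightarrow> pbij M M q \<and> q \<subseteq> R"
proof -
  obtain Q where "finite Q" "partition_on K Q"
    "\<forall>p\<in>Q. \<exists>A B \<phi>. partial_automorphism M R A B \<phi> \<and> p = graph_on A \<phi>"
    using assms unfolding finite_graphing_def by (elim exE conjE)
  note Q = this
  show ?thesis
  proof (rule that[OF Q(1)])
    show "K = \<Union>Q" using Q(2) by (simp add: partition_on_def)
    fix q assume "q \<in> Q"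
    then obtain A B f where f: "partial_automorphism M R A B f" "q = graph_on A f" using Q(3) by blast
    then show "pbij M M q \<and> q \<subseteq> R"
      using partial_automorphism_imp_pbij[OF f(1)] unfolding partial_automorphism_def by simp
  qed
qed

lemma finite_graphingI:
  assumes sep: "separated M" and Q: "finite Q" "\<And>q. q \<in> Q \<Longrightarrow> pbij M M q \<and> q \<subseteq> R"
    and gen: "AE x in M. \<forall>y. (x, y) \<in> R \<longrightarrow> (x, y) \<in> (\<Union>Q \<union> (\<Union>Q)\<inverse>)\<^sup>*"
  shows "finite_graphing M R (\<Union>Q)"
  unfolding finite_graphing_def graphing_def
proof (intro conjI gen)
  show "\<Union>Q \<in> sets (M \<Otimes>\<^sub>M M)" using Q pbij_in_sets[OF sep] by (intro sets.finite_Union) auto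
  show "\<Union>Q \<subseteq> R" using Q by auto
  obtain P where P: "finite P" "partition_on (\<Union>Q) P" "\<forall>p\<in>P. pbij M M p \<and> p \<subseteq> \<Union>Q"
    using pbij_finite_partition[OF sep Q(1) conjunct1[OF Q(2)]] by metis
  show "\<exists>P. finite P \<and> partition_on (\<Union>Q) P \<and>
          (\<forall>p\<in>P. \<exists>A B \<phi>. partial_automorphism M R A B \<phi> \<and> p = graph_on A \<phi>)"
  proof (intro exI[of _ P] conjI ballI P(1,2))
    fix p assume "p \<in> P"
    then have "pbij M M p" "p \<subseteq> R" using P(3) \<open>\<Union>Q \<subseteq> R\<close> by auto
    then obtain f where "partial_automorphism M R (Domain p) (Range p) f" "p = graph_on (Domain p) f"
      by (rule pbij_imp_partial_automorphism)
    then show "\<exists>A B \<phi>. partial_automorphism M R A B \<phi> \<and> p = graph_on A \<phi>" by (intro exI conjI)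
  qed
qed

lemma symmetric_verticesI:
  assumes a: "pbij M M a" "a \<subseteq> R" "Domain a = space M" "Range a = space M"
  shows "a \<in> symmetric_vertices M R"
proof -
  obtain f where "partial_automorphism M R (Domain a) (Range a) f" "a = graph_on (Domain a) f"
    by (rule pbij_imp_partial_automorphism[OF a(1,2)])
  then show ?thesis unfolding symmetric_vertices_def full_group_def a(3,4) by auto
qed

section \<open>Counting boundary edges\<close>

lemma emeasure_count_le_indicator:
  assumes "\<And>u v. u \<in> S \<Longrightarrow> v \<in> S \<Longrightarrow> u = v" "S \<noteq> {} \<Longrightarrow> x \<in> D"
  shows "emeasure (count_space UNIV) S \<le> indicator D x"
proof (cases "S = {}")
  case False
  then obtain u where "S = {u}" using assms(1) by auto
  then show ?thesis using assms(2) by auto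
qed simp

text \<open>A boundary edge comes from some \<open>q\<close> and has one end in some
  \<open>a\<close>. Once \<open>x\<close>, \<open>a\<close>, \<open>q\<close> and the choice of the
  end are fixed, the edge is unique, and it exists only if \<open>a\<close> sends \<open>x\<close>
  into the domain or the range of \<open>q\<close>. These sets of \<open>x\<close> have measure at
  most that of \<open>Domain q\<close>, because \<open>a\<close> preserves the measure and
  \<open>q\<close> has domain and range of equal measure; the two possible ends give the factor
  2.\<close>

lemma edge_measure_boundary_le:
  assumes II: "type_II1 M R" and A: "finite A"
    and a: "\<And>a. a \<in> A \<Longrightarrow> pbij M M a \<and> a \<subseteq> R \<and> Range a = space M"
    and eq: "equiv (space M) (\<Union>A)"
    and Q: "finite Q" "\<And>q. q \<in> Q \<Longrightarrow> pbij M M q \<and> q \<subseteq> R"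
    and eR: "equiv (space M) R"
  shows "edge_measure M R (\<Union>A \<union> \<Union>Q) (edge_boundary M R (\<Union>A \<union> \<Union>Q) A)
    \<le> of_nat (card A) * (2 * (\<Sum>q\<in>Q. emeasure M (Domain q)))"
proof -
  let ?K = "\<Union>A \<union> \<Union>Q"
  \<comment> \<open>\<open>E\<close> gathers the edges along \<open>q\<close> that start in
    \<open>a\<close>, \<open>E'\<close> those that end in \<open>a\<close>.\<close>
  define E where "E a q x = {((x, y), (x, z)) | y z. (x, y) \<in> a \<and> (y, z) \<in> q}"
    for a q :: "('a \<times> 'a) set" and x
  define E' where "E' a q x = {((x, y), (x, z)) | y z. (x, z) \<in> a \<and> (y, z) \<in> q}"
    for a q :: "('a \<times> 'a) set" and x
  have sub: "edge_boundary M R ?K A \<inter> cayley_fibre_edges R ?K x \<subseteq> (\<Union>a\<in>A. \<Union>q\<in>Q. E a q x \<union> E' a q x)"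
    for x
  proof
    fix e assume e: "e \<in> edge_boundary M R ?K A \<inter> cayley_fibre_edges R ?K x"
    then obtain y z where yz: "e = ((x, y), (x, z))" "(y, z) \<in> ?K"
      unfolding cayley_fibre_edges_def by auto
    have b: "((x, y) \<in> \<Union>A) \<noteq> ((x, z) \<in> \<Union>A)" using e yz(1) unfolding edge_boundary_def by simp
    have "(y, z) \<notin> \<Union>A"
    proof
      assume yz: "(y, z) \<in> \<Union>A"
      then have "(z, y) \<in> \<Union>A" using eq unfolding equiv_def by (meson symD)
      then show False using b yz eq unfolding equiv_def by (meson transD)
    qed
    then obtain q where "q \<in> Q" "(y, z) \<in> q" using yz(2) by auto
    then show "e \<in> (\<Union>a\<in>A. \<Union>q\<in>Q. E a q x \<union> E' a q x)" using b yz(1) unfolding E_def E'_def by blast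
  qed
  have le: "emeasure (count_space UNIV) (edge_boundary M R ?K A \<inter> cayley_fibre_edges R ?K x) \<le>
      (\<Sum>a\<in>A. \<Sum>q\<in>Q. indicator (a\<inverse> `` Domain q) x + indicator (a\<inverse> `` Range q) x)" for x
  proof -
    have "emeasure (count_space UNIV) (edge_boundary M R ?K A \<inter> cayley_fibre_edges R ?K x)
        \<le> emeasure (count_space UNIV) (\<Union>a\<in>A. \<Union>q\<in>Q. E a q x \<union> E' a q x)"
      using sub by (intro emeasure_mono) auto
    also have "\<dots> \<le> (\<Sum>a\<in>A. emeasure (count_space UNIV) (\<Union>q\<in>Q. E a q x \<union> E' a q x))"
      using A by (intro emeasure_subadditive_finite) auto
    also have "\<dots> \<le> (\<Sum>a\<in>A. \<Sum>q\<in>Q. emeasure (count_space UNIV) (E a q x \<union> E' a q x))"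
      using Q by (intro sum_mono emeasure_subadditive_finite) auto
    also have "\<dots> \<le> (\<Sum>a\<in>A. \<Sum>q\<in>Q. emeasure (count_space UNIV) (E a q x) + emeasure (count_space UNIV) (E' a q x))"
      by (intro sum_mono emeasure_subadditive) auto
    also have "\<dots> \<le> (\<Sum>a\<in>A. \<Sum>q\<in>Q. indicator (a\<inverse> `` Domain q) x + indicator (a\<inverse> `` Range q) x)"
    proof (intro sum_mono add_mono emeasure_count_le_indicator)
      fix a q u v assume aq: "a \<in> A" "q \<in> Q"
      note aD = pbijD(2,3)[OF conjunct1[OF a[OF aq(1)]]] and qD = pbijD(2,3)[OF conjunct1[OF Q(2)[OF aq(2)]]]
      show "u \<in> E a q x \<Longrightarrow> v \<in> E a q x \<Longrightarrow> u = v" unfolding E_def using aD(1) qD(1) by blast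
      show "u \<in> E' a q x \<Longrightarrow> v \<in> E' a q x \<Longrightarrow> u = v" unfolding E'_def using aD(1) qD(2) by blast
      show "E a q x \<noteq> {} \<Longrightarrow> x \<in> a\<inverse> `` Domain q" unfolding E_def by blast
      show "E' a q x \<noteq> {} \<Longrightarrow> x \<in> a\<inverse> `` Range q" unfolding E'_def by blast
    qed
    finally show ?thesis .
  qed
  have meas: "a\<inverse> `` Domain q \<in> sets M" "a\<inverse> `` Range q \<in> sets M" if "a \<in> A" "q \<in> Q" for a q
    using a[OF that(1)] Q(2)[OF that(2)] pbijD(5) pbij_Domain pbij_Range by metis+
  have val: "emeasure M (a\<inverse> `` D) \<le> emeasure M D" if "a \<in> A" "D \<in> sets M" for a D
  proof (rule type_II1_image_le[OF II _ _ that(2)])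
    show "pbij M M (a\<inverse>)" using a that(1) pbij_converse by blast
    show "a\<inverse> \<subseteq> R" using a[OF that(1)] eR unfolding equiv_def by (auto dest: symD)
  qed
  have "edge_measure M R ?K (edge_boundary M R ?K A) \<le>
      (\<integral>\<^sup>+x. (\<Sum>a\<in>A. \<Sum>q\<in>Q. indicator (a\<inverse> `` Domain q) x + indicator (a\<inverse> `` Range q) x) \<partial>M)"
    unfolding edge_measure_def by (intro nn_integral_mono le)
  also have "\<dots> = (\<Sum>a\<in>A. \<Sum>q\<in>Q. emeasure M (a\<inverse> `` Domain q) + emeasure M (a\<inverse> `` Range q))"
    using meas by (simp add: nn_integral_sum nn_integral_add)
  also have "\<dots> \<le> (\<Sum>a\<in>A. \<Sum>q\<in>Q. emeasure M (Domain q) + emeasure M (Domain q))"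
  proof (intro sum_mono add_mono)
    fix a q assume aq: "a \<in> A" "q \<in> Q"
    then have q: "pbij M M q" "q \<subseteq> R" using Q(2) by auto
    show "emeasure M (a\<inverse> `` Domain q) \<le> emeasure M (Domain q)"
      using val aq pbij_Domain[OF q(1)] by blast
    show "emeasure M (a\<inverse> `` Range q) \<le> emeasure M (Domain q)"
      using val[OF aq(1) pbij_Range[OF q(1)]] type_II1_Range[OF II q] by simp
  qed
  also have "\<dots> = of_nat (card A) * (2 * (\<Sum>q\<in>Q. emeasure M (Domain q)))"
    by (simp add: sum.distrib mult_2)
  finally show ?thesis .
qed

text \<open>The \<open>n\<close> images of the base \<open>B\<close> partition the space up to a null set. The relation \<open>F\<close> of the
  introduction is the union of the relations \<open>frame_shift M n \<Phi> j\<close>, which permute these images cyclically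
  and are the identity on the null set.\<close>

definition frame :: "'a measure \<Rightarrow> ('a \<times> 'a) set \<Rightarrow> nat \<Rightarrow> (nat \<Rightarrow> ('a \<times> 'a) set) \<Rightarrow> 'a set \<Rightarrow> bool" where
  "frame M R n \<Phi> B \<longleftrightarrow> n > 0 \<and>
     (\<forall>i<n. pbij M M (\<Phi> i) \<and> \<Phi> i \<subseteq> R \<and> Domain (\<Phi> i) = B) \<and>
     (\<forall>i<n. \<forall>j<n. i \<noteq> j \<longrightarrow> Range (\<Phi> i) \<inter> Range (\<Phi> j) = {}) \<and>
     space M - (\<Union>i<n. Range (\<Phi> i)) \<in> null_sets M"

definition frame_rel :: "nat \<Rightarrow> (nat \<Rightarrow> ('a \<times> 'a) set) \<Rightarrow> ('a \<times> 'a) set" where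
  "frame_rel n \<Phi> = (\<Union>i<n. \<Union>j<n. (\<Phi> i)\<inverse> O \<Phi> j)"

definition frame_shift :: "'a measure \<Rightarrow> nat \<Rightarrow> (nat \<Rightarrow> ('a \<times> 'a) set) \<Rightarrow> nat \<Rightarrow> ('a \<times> 'a) set" where
  "frame_shift M n \<Phi> j =
     Id_on (space M - (\<Union>i<n. Range (\<Phi> i))) \<union> (\<Union>i<n. (\<Phi> i)\<inverse> O \<Phi> ((i + j) mod n))"

lemma add_mod_cancel:
  assumes "i < n" "i' < n" "(i + j) mod n = (i' + j) mod n"
  shows "i = (i'::nat)"
proof -
  have "i = i'" if "i \<le> i'" "i' < n" "(i' + j) mod n = (i + j) mod n" for i i'
  proof -
    have "n dvd (i' + j) - (i + j)" using that by (subst mod_eq_dvd_iff_nat[symmetric]) auto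
    then show ?thesis using that by (auto dest: dvd_imp_le)
  qed
  from this[of i i'] this[of i' i] assms show ?thesis by (cases "i \<le> i'") auto
qed

lemma frame_rel_UN_shift:
  assumes "n > 0"
  shows "(\<Union>j<n. frame_shift M n \<Phi> j) = Id_on (space M - (\<Union>i<n. Range (\<Phi> i))) \<union> frame_rel n \<Phi>"
proof
  have "(i + j) mod n < n" for i j using assms by simp
  then show "(\<Union>j<n. frame_shift M n \<Phi> j) \<subseteq> Id_on (space M - (\<Union>i<n. Range (\<Phi> i))) \<union> frame_rel n \<Phi>"
    unfolding frame_shift_def frame_rel_def by (intro UN_least Un_least Un_upper1 le_supI2) blast
  have "(\<Phi> i)\<inverse> O \<Phi> k \<subseteq> (\<Union>j<n. frame_shift M n \<Phi> j)" if "i < n" "k < n" for i k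
  proof -
    \<comment> \<open>The shift by \<open>k - i\<close> modulo \<open>n\<close> takes index
      \<open>i\<close> to \<open>k\<close>; adding \<open>n\<close> first keeps the subtraction of
      naturals from truncating.\<close>
    have eq: "(i + (k + n - i) mod n) mod n = k"
      using that by (simp add: mod_add_right_eq)
    have "(\<Phi> i)\<inverse> O \<Phi> ((i + (k + n - i) mod n) mod n) \<subseteq> frame_shift M n \<Phi> ((k + n - i) mod n)"
      unfolding frame_shift_def by (rule le_supI2, rule UN_upper) (use that in simp)
    then have "(\<Phi> i)\<inverse> O \<Phi> k \<subseteq> frame_shift M n \<Phi> ((k + n - i) mod n)"
      unfolding eq .
    then show ?thesis using mod_less_divisor[OF assms] by blast
  qed
  then have "frame_rel n \<Phi> \<subseteq> (\<Union>j<n. frame_shift M n \<Phi> j)"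
    unfolding frame_rel_def by (intro UN_least) simp
  moreover have "Id_on (space M - (\<Union>i<n. Range (\<Phi> i))) \<subseteq> frame_shift M n \<Phi> 0"
    unfolding frame_shift_def by (rule Un_upper1)
  ultimately show "Id_on (space M - (\<Union>i<n. Range (\<Phi> i))) \<union> frame_rel n \<Phi> \<subseteq> (\<Union>j<n. frame_shift M n \<Phi> j)"
    using UN_upper[of 0 "{..<n}" "frame_shift M n \<Phi>"] assms by (intro Un_least) simp_all
qed

context
  fixes M :: "'a measure" and R n \<Phi> B
  assumes fr: "frame M R n \<Phi> B"
begin

lemma frame_pos: "n > 0"
  and frame_pbij: "i < n \<Longrightarrow> pbij M M (\<Phi> i)"
  and frame_sub: "i < n \<Longrightarrow> \<Phi> i \<subseteq> R"
  and frame_Domain: "i < n \<Longrightarrow> Domain (\<Phi> i) = B"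
  and frame_disj: "i < n \<Longrightarrow> j < n \<Longrightarrow> x \<in> Range (\<Phi> i) \<Longrightarrow> x \<in> Range (\<Phi> j) \<Longrightarrow> i = j"
  and frame_null: "space M - (\<Union>i<n. Range (\<Phi> i)) \<in> null_sets M"
  using fr unfolding frame_def by (auto; blast)+

lemma frame_base_sets: "B \<in> sets M"
  using pbij_Domain[OF frame_pbij[OF frame_pos]] frame_Domain[OF frame_pos] by simp

lemma frame_shift_pbij:
  shows "pbij M M (frame_shift M n \<Phi> j)"
proof -
  let ?N = "space M - (\<Union>i<n. Range (\<Phi> i))"
  \<comment> \<open>The index \<open>n\<close> stands for the identity on the leftover null set, so
    that a single countable union covers every piece of the shift.\<close>
  define P where "P i = (if i < n then (\<Phi> i)\<inverse> O \<Phi> ((i + j) mod n) else Id_on ?N)" for i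
  have lt: "(i + j) mod n < n" for i using frame_pos by simp
  have "frame_shift M n \<Phi> j = (\<Union>i\<in>{..n}. P i)"
  proof -
    have "{..n} = insert n {..<n}" by auto
    moreover have "(\<Union>i<n. P i) = (\<Union>i<n. (\<Phi> i)\<inverse> O \<Phi> ((i + j) mod n))"
      by (rule SUP_cong) (simp_all add: P_def)
    moreover have "P n = Id_on ?N" by (simp add: P_def)
    ultimately show ?thesis unfolding frame_shift_def by (simp only: UN_insert)
  qed
  moreover have "pbij M M (\<Union>i\<in>{..n}. P i)"
  proof (rule pbij_UN)
    show "pbij M M (P i)" for i
      using frame_pbij lt frame_null unfolding P_def
      by (auto intro!: pbij_comp pbij_converse pbij_Id_on)
    have Pc: "(i < n \<and> (\<exists>b. (b, x) \<in> \<Phi> i \<and> (b, y) \<in> \<Phi> ((i + j) mod n))) \<or> (\<not> i < n \<and> x = y \<and> x \<in> ?N)"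
      if "(x, y) \<in> P i" for i x y
      using that unfolding P_def by (auto split: if_splits)
    fix i i' x y z
    show "y = z" if h: "(x, y) \<in> P i" "(x, z) \<in> P i'"
    proof (cases "i < n")
      case True
      then obtain b where b: "(b, x) \<in> \<Phi> i" "(b, y) \<in> \<Phi> ((i + j) mod n)" using Pc[OF h(1)] by auto
      then have "i' < n" using Pc[OF h(2)] True by auto
      then obtain b' where b': "(b', x) \<in> \<Phi> i'" "(b', z) \<in> \<Phi> ((i' + j) mod n)" using Pc[OF h(2)] by auto
      have "i = i'" using frame_disj[OF True \<open>i' < n\<close>] b b' by blast
      then show ?thesis
        using b b' pbijD(3)[OF frame_pbij[OF True], of b x b'] pbijD(2)[OF frame_pbij[OF lt], of b y i z] by blast
    next
      case False
      then have "x = y" "x \<in> ?N" using Pc[OF h(1)] by auto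
      moreover from this have "x = z" using Pc[OF h(2)] by auto
      ultimately show ?thesis by simp
    qed
    show "x = y" if h: "(x, z) \<in> P i" "(y, z) \<in> P i'"
    proof (cases "i < n")
      case True
      then obtain b where b: "(b, x) \<in> \<Phi> i" "(b, z) \<in> \<Phi> ((i + j) mod n)" using Pc[OF h(1)] by auto
      then have "i' < n" using Pc[OF h(2)] True lt[of i] by auto
      then obtain b' where b': "(b', y) \<in> \<Phi> i'" "(b', z) \<in> \<Phi> ((i' + j) mod n)" using Pc[OF h(2)] by auto
      have "(i + j) mod n = (i' + j) mod n" using frame_disj[OF lt lt] b b' by blast
      then have "i = i'" using add_mod_cancel[OF True \<open>i' < n\<close>] by simp
      then show ?thesis
        using b b' pbijD(3)[OF frame_pbij[OF lt], of b z i b'] pbijD(2)[OF frame_pbij[OF True], of b x y] by blast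
    next
      case False
      then have "x = z" "x \<in> ?N" using Pc[OF h(1)] by auto
      moreover from this have "y = z" using Pc[OF h(2)] lt[of i'] by auto
      ultimately show ?thesis by simp
    qed
  qed simp
  ultimately show ?thesis by simp
qed

lemma frame_shift_Domain: "Domain (frame_shift M n \<Phi> j) = space M"
proof
  show "Domain (frame_shift M n \<Phi> j) \<subseteq> space M" using pbijD(1)[OF frame_shift_pbij] by auto
  show "space M \<subseteq> Domain (frame_shift M n \<Phi> j)"
  proof
    fix x assume x: "x \<in> space M"
    show "x \<in> Domain (frame_shift M n \<Phi> j)"
    proof (cases "\<exists>i<n. x \<in> Range (\<Phi> i)")
      case True
      then obtain i b where i: "i < n" "(b, x) \<in> \<Phi> i" by auto
      have lt: "(i + j) mod n < n" using frame_pos by simp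
      have "b \<in> Domain (\<Phi> ((i + j) mod n))" using i frame_Domain[OF i(1)] frame_Domain[OF lt] by auto
      then obtain y where "(b, y) \<in> \<Phi> ((i + j) mod n)" by auto
      then show ?thesis using i unfolding frame_shift_def by blast
    next
      case False
      then show ?thesis using x unfolding frame_shift_def by blast
    qed
  qed
qed

lemma frame_shift_Range: "Range (frame_shift M n \<Phi> j) = space M"
proof
  show "Range (frame_shift M n \<Phi> j) \<subseteq> space M" using pbijD(1)[OF frame_shift_pbij] by auto
  show "space M \<subseteq> Range (frame_shift M n \<Phi> j)"
  proof
    fix x assume x: "x \<in> space M"
    show "x \<in> Range (frame_shift M n \<Phi> j)"
    proof (cases "\<exists>i<n. x \<in> Range (\<Phi> i)")
      case True
      then obtain k b where k: "k < n" "(b, x) \<in> \<Phi> k" by auto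
      \<comment> \<open>The index that the shift by \<open>j\<close> moves to \<open>k\<close>,
        again arranged so that no subtraction truncates.\<close>
      define i where "i = (k + (n - j mod n)) mod n"
      have lt: "i < n" using frame_pos unfolding i_def by simp
      have "(i + j) mod n = (k + (n - j mod n) + j mod n) mod n"
        unfolding i_def by (simp add: mod_simps)
      also have "k + (n - j mod n) + j mod n = k + n"
        using less_imp_le[OF mod_less_divisor[OF frame_pos, of j]] by linarith
      also have "(k + n) mod n = k" using k(1) by simp
      finally have ik: "(i + j) mod n = k" .
      have "b \<in> Domain (\<Phi> i)" using k frame_Domain[OF k(1)] frame_Domain[OF lt] by auto
      then obtain y where "(b, y) \<in> \<Phi> i" by auto
      then show ?thesis using k lt ik unfolding frame_shift_def by blast
    next
      case False
      then show ?thesis using x unfolding frame_shift_def by blast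
    qed
  qed
qed

lemma frame_shift_sub:
  assumes "equiv (space M) R"
  shows "frame_shift M n \<Phi> j \<subseteq> R"
proof -
  have "(\<Phi> i)\<inverse> O \<Phi> k \<subseteq> R" if ik: "i < n" "k < n" for i k
  proof (rule subrelI)
    fix x y assume "(x, y) \<in> (\<Phi> i)\<inverse> O \<Phi> k"
    then obtain b where "(b, x) \<in> R" "(b, y) \<in> R"
      using frame_sub[OF ik(1)] frame_sub[OF ik(2)] by auto
    then show "(x, y) \<in> R" using assms unfolding equiv_def by (meson symD transD)
  qed
  moreover have "(i + j) mod n < n" for i using frame_pos by simp
  moreover have "Id_on (space M - (\<Union>i<n. Range (\<Phi> i))) \<subseteq> R"
    using assms unfolding equiv_def refl_on_def by auto
  ultimately show ?thesis unfolding frame_shift_def by (intro Un_least UN_least) auto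
qed

text \<open>All shifts are the identity on the leftover null set, so they are disjoint only up to a
  null set, which is what admissibility asks for. Elsewhere a pair determines its two indices, hence
  the amount of the shift.\<close>

lemma frame_shift_disjoint:
  assumes "i < n" "j < n" "i \<noteq> j"
  shows "frame_shift M n \<Phi> i \<inter> frame_shift M n \<Phi> j \<subseteq> Id_on (space M - (\<Union>i<n. Range (\<Phi> i)))"
proof (rule ccontr)
  assume "\<not> ?thesis"
  then obtain x y where xy: "(x, y) \<in> frame_shift M n \<Phi> i" "(x, y) \<in> frame_shift M n \<Phi> j"
    "(x, y) \<notin> Id_on (space M - (\<Union>i<n. Range (\<Phi> i)))" by auto
  have lt: "k mod n < n" for k using frame_pos by simp
  obtain k b where k: "k < n" "(b, x) \<in> \<Phi> k" "(b, y) \<in> \<Phi> ((k + i) mod n)"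
    using xy(1,3) unfolding frame_shift_def by auto
  obtain l c where l: "l < n" "(c, x) \<in> \<Phi> l" "(c, y) \<in> \<Phi> ((l + j) mod n)"
    using xy(2,3) unfolding frame_shift_def by auto
  have "k = l" using frame_disj[OF k(1) l(1)] k l by blast
  moreover have "(k + i) mod n = (l + j) mod n" using frame_disj[OF lt lt] k l by blast
  ultimately have "i = j" using add_mod_cancel[OF assms(1,2), of k] by (simp add: add.commute)
  then show False using assms by simp
qed

text \<open>Transitivity rests on disjointness of the ranges: the middle point determines its index
  and, by injectivity, its base point, so both pairs lie over the same base point.\<close>

lemma frame_rel_equiv:
  "equiv (space M) (Id_on (space M - (\<Union>i<n. Range (\<Phi> i))) \<union> frame_rel n \<Phi>)" (is "equiv _ ?F")
proof (rule equivI)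
  show "?F \<subseteq> space M \<times> space M"
    using pbijD(1)[OF frame_pbij] unfolding frame_rel_def by blast
  show "refl_on (space M) ?F"
    unfolding refl_on_def frame_rel_def by blast
  show "sym ?F" unfolding sym_def frame_rel_def by blast
  show "trans ?F"
  proof (rule transI)
    fix x y z assume xy: "(x, y) \<in> ?F" and yz: "(y, z) \<in> ?F"
    show "(x, z) \<in> ?F"
    proof (cases "(x, y) \<in> frame_rel n \<Phi> \<and> (y, z) \<in> frame_rel n \<Phi>")
      case True
      then obtain i j k l b c where i: "i < n" "j < n" "k < n" "l < n" "(b, x) \<in> \<Phi> i" "(b, y) \<in> \<Phi> j"
        "(c, y) \<in> \<Phi> k" "(c, z) \<in> \<Phi> l"
        unfolding frame_rel_def by auto
      have "j = k" using frame_disj[OF i(2,3)] i by blast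
      then have "b = c" using pbijD(3)[OF frame_pbij[OF i(2)]] i by blast
      then show ?thesis using i unfolding frame_rel_def by blast
    next
      case False
      then show ?thesis using xy yz by auto
    qed
  qed
qed

end

text \<open>The shifts of the frame play two roles: they are part of the graphing, and they are the
  test family \<open>A\<close>. The bound for the boundary is proportional to \<open>card A\<close>,
  which cancels, so only the cost of \<open>Q\<close> survives. The graphing \<open>K0\<close>
  serves as a witness that shifts and \<open>Q\<close> together generate \<open>R\<close>.\<close>

lemma isoperimetric_criterion:
  assumes sep: "separated M" and eR: "equiv (space M) R" and II: "type_II1 M R"
    and fr: "frame M R n \<Phi> B"
    and Q: "finite Q" "\<And>q. q \<in> Q \<Longrightarrow> pbij M M q \<and> q \<subseteq> R"
    and K0: "graphing M R K0" "K0 \<subseteq> (frame_rel n \<Phi> \<union> \<Union>Q \<union> (frame_rel n \<Phi> \<union> \<Union>Q)\<inverse>)\<^sup>*"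
  shows "uniform_isoperimetric_constant M R \<le> 2 * (\<Sum>q\<in>Q. emeasure M (Domain q))"
proof -
  let ?N = "space M - (\<Union>i<n. Range (\<Phi> i))"
  define A where "A = frame_shift M n \<Phi> ` {..<n}"
  have n0: "n > 0" using frame_pos[OF fr] .
  have UA: "\<Union>A = Id_on ?N \<union> frame_rel n \<Phi>"
    unfolding A_def using frame_rel_UN_shift[OF n0] by simp
  have A: "finite A" "A \<noteq> {}" unfolding A_def using n0 by auto
  have a: "pbij M M a \<and> a \<subseteq> R \<and> Range a = space M \<and> Domain a = space M" if "a \<in> A" for a
  proof -
    obtain j where j: "a = frame_shift M n \<Phi> j" using \<open>a \<in> A\<close> unfolding A_def by auto
    show ?thesis unfolding j
      by (intro conjI frame_shift_pbij[OF fr] frame_shift_sub[OF fr eR] frame_shift_Range[OF fr]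
        frame_shift_Domain[OF fr])
  qed
  let ?K = "\<Union>A \<union> \<Union>Q"
  have adm: "admissible_family M R A"
    unfolding admissible_family_def
  proof (intro conjI A subsetI pairwiseI)
    fix a assume "a \<in> A"
    from a[OF this] show "a \<in> symmetric_vertices M R" by (intro symmetric_verticesI) simp_all
  next
    fix a b assume ab: "a \<in> A" "b \<in> A" "a \<noteq> b"
    then obtain i j where ij: "i < n" "j < n" "a = frame_shift M n \<Phi> i" "b = frame_shift M n \<Phi> j"
      unfolding A_def by auto
    then have sub: "a \<inter> b \<subseteq> Id_on ?N"
      using frame_shift_disjoint[OF fr, of i j] ab(3) by metis
    have "AE x in M. emeasure (count_space UNIV) (a \<inter> b \<inter> rel_fibre R x) = 0"
      using AE_not_in[OF frame_null[OF fr]]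
    proof eventually_elim
      case (elim x)
      then have "a \<inter> b \<inter> rel_fibre R x = {}" using sub unfolding rel_fibre_def by auto
      then show ?case by simp
    qed
    then show "rel_measure M R (a \<inter> b) = 0"
      unfolding rel_measure_def by (subst nn_integral_cong_AE[where v="\<lambda>_. 0"]) auto
  qed
  have gen: "K0 \<subseteq> (?K \<union> ?K\<inverse>)\<^sup>*"
  proof -
    have "frame_rel n \<Phi> \<union> \<Union>Q \<union> (frame_rel n \<Phi> \<union> \<Union>Q)\<inverse> \<subseteq> ?K \<union> ?K\<inverse>" unfolding UA by auto
    then show ?thesis using K0(2) rtrancl_mono by blast
  qed
  have gen': "(K0 \<union> K0\<inverse>)\<^sup>* \<subseteq> (?K \<union> ?K\<inverse>)\<^sup>*"
  proof (rule rtrancl_subset_rtrancl)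
    have "sym ((?K \<union> ?K\<inverse>)\<^sup>*)" by (intro sym_rtrancl sym_Un_converse)
    then show "K0 \<union> K0\<inverse> \<subseteq> (?K \<union> ?K\<inverse>)\<^sup>*" using gen by (auto dest: symD)
  qed
  have "finite_graphing M R (\<Union>(A \<union> Q))"
  proof (rule finite_graphingI[OF sep])
    have "AE x in M. \<forall>y. (x, y) \<in> R \<longrightarrow> (x, y) \<in> (K0 \<union> K0\<inverse>)\<^sup>*"
      using K0(1) unfolding graphing_def by auto
    then show "AE x in M. \<forall>y. (x, y) \<in> R \<longrightarrow> (x, y) \<in> (\<Union>(A \<union> Q) \<union> (\<Union>(A \<union> Q))\<inverse>)\<^sup>*"
      using gen' by (auto simp: Union_Un_distrib)
    show "finite (A \<union> Q)" using A Q by simp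
    show "q \<in> A \<union> Q \<Longrightarrow> pbij M M q \<and> q \<subseteq> R" for q using a[of q] Q(2)[of q] by blast
  qed
  then have "finite_graphing M R ?K" by (simp add: Union_Un_distrib)
  then have "uniform_isoperimetric_constant M R \<le> isoperimetric_constant_of M R ?K"
    unfolding uniform_isoperimetric_constant_def by (intro INF_lower) auto
  also have "\<dots> \<le> edge_measure M R ?K (edge_boundary M R ?K A) / of_nat (card A)"
    unfolding isoperimetric_constant_of_def using adm by (intro INF_lower) auto
  also have "\<dots> \<le> of_nat (card A) * (2 * (\<Sum>q\<in>Q. emeasure M (Domain q))) / of_nat (card A)"
  proof (intro divide_right_mono_ennreal edge_measure_boundary_le[OF II A(1) _ _ Q eR])
    show "equiv (space M) (\<Union>A)" unfolding UA by (rule frame_rel_equiv[OF fr])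
  qed (use a in simp_all)
  also have "\<dots> = 2 * (\<Sum>q\<in>Q. emeasure M (Domain q))"
    using A by (subst mult.commute, intro ennreal_mult_divide_eq) simp_all
  finally show ?thesis .
qed

section \<open>Frames with small base in ergodic relations\<close>

text \<open>This replaces the uniformization theorem of Lusin and Novikov, by which every measured
  equivalence relation is a countable union of partial automorphisms.\<close>

definition covered_by :: "'a measure \<Rightarrow> ('a \<times> 'a) set \<Rightarrow> (nat \<Rightarrow> ('a \<times> 'a) set) \<Rightarrow> 'a set \<Rightarrow> bool" where
  "covered_by M R \<kappa> N \<longleftrightarrow> N \<in> null_sets M \<and> R `` N \<subseteq> N \<and>
     (\<forall>k. pbij M M (\<kappa> k) \<and> \<kappa> k \<subseteq> R) \<and> (\<forall>x y. (x, y) \<in> R \<longrightarrow> x \<notin> N \<longrightarrow> (\<exists>k. (x, y) \<in> \<kappa> k))"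

lemma covered_byD:
  assumes "covered_by M R \<kappa> N"
  shows "N \<in> null_sets M" "\<And>x y. x \<in> N \<Longrightarrow> (x, y) \<in> R \<Longrightarrow> y \<in> N"
    "\<And>k. pbij M M (\<kappa> k)" "\<And>k. \<kappa> k \<subseteq> R" "\<And>x y. (x, y) \<in> R \<Longrightarrow> x \<notin> N \<Longrightarrow> \<exists>k. (x, y) \<in> \<kappa> k"
  using assms unfolding covered_by_def by auto

text \<open>If \<open>L\<close> had positive measure, it would contain a set \<open>P\<close> of
  positive but strictly smaller measure. By ergodicity the saturation of \<open>P\<close> is conull,
  yet up to a null set it misses \<open>L - P\<close>, since a point of \<open>L - P\<close>
  equivalent to a point of \<open>P\<close> would coincide with it. Then \<open>L - P\<close> is
  null and \<open>P\<close> has the full measure of \<open>L\<close>, a contradiction.\<close>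

lemma partial_transversal_null:
  assumes "prob_space M" and eR: "equiv (space M) R" and erg: "ergodic_rel M R"
    and na: "non_atomic M" and cov: "covered_by M R \<kappa> N" and L: "L \<in> sets M"
    and trans: "\<And>x y. (x, y) \<in> R \<Longrightarrow> x \<in> L \<Longrightarrow> y \<in> L \<Longrightarrow> x \<notin> N \<Longrightarrow> x = y"
  shows "L \<in> null_sets M"
proof (rule ccontr)
  interpret prob_space M by fact
  note c = covered_byD[OF cov]
  assume "L \<notin> null_sets M"
  then have "emeasure M L > 0" using L by (auto simp: null_sets_def zero_less_iff_neq_zero)
  then obtain P where P: "P \<in> sets M" "P \<subseteq> L" "0 < emeasure M P" "emeasure M P < emeasure M L"
    using na L unfolding non_atomic_def by blast
  \<comment> \<open>The saturation of \<open>P\<close>, enlarged by the null set \<open>N\<close>.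
    Writing it as a countable union of images makes it measurable, and the invariance of
    \<open>N\<close> makes it exactly saturated.\<close>
  define S where "S = N \<union> (\<Union>k. \<kappa> k `` P)"
  have S: "S \<in> sets M" unfolding S_def using c(1) pbijD(4)[OF c(3) P(1)] by auto
  have Pn: "P \<subseteq> S"
  proof
    fix p assume p: "p \<in> P"
    then have "p \<in> space M" using P(1) sets.sets_into_space by blast
    then have "(p, p) \<in> R" using eR unfolding equiv_def refl_on_def by auto
    then show "p \<in> S" using c(5)[of p p] p unfolding S_def by auto
  qed
  have "R `` S = S"
  proof
    show "S \<subseteq> R `` S"
      using sets.sets_into_space[OF S] eR unfolding equiv_def refl_on_def by auto
    show "R `` S \<subseteq> S"
    proof
      fix y assume "y \<in> R `` S"
      then obtain x where x: "x \<in> S" "(x, y) \<in> R" by auto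
      show "y \<in> S"
      proof (cases "x \<in> N")
        case True
        then show ?thesis using c(2)[OF _ x(2)] unfolding S_def by auto
      next
        case False
        then obtain p k where p: "p \<in> P" "(p, x) \<in> \<kappa> k" using x unfolding S_def by auto
        then have py: "(p, y) \<in> R" using c(4) x(2) eR unfolding equiv_def by (meson subsetD transD)
        show ?thesis
        proof (cases "p \<in> N")
          case True
          then show ?thesis using c(2)[OF _ py] unfolding S_def by auto
        next
          case False
          then show ?thesis using c(5)[OF py] p(1) unfolding S_def by auto
        qed
      qed
    qed
  qed
  then have "emeasure M S = 0 \<or> emeasure M S = 1" using erg S unfolding ergodic_rel_def by auto
  moreover have "emeasure M P \<le> emeasure M S" using Pn S by (rule emeasure_mono)
  ultimately have S1: "emeasure M S = 1" using P(3) by auto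
  have "space M - S \<in> null_sets M"
    using S S1 emeasure_compl[OF S] emeasure_space_1 by (auto simp: null_sets_def)
  moreover have "L - P \<subseteq> (space M - S) \<union> N"
  proof
    fix y assume y: "y \<in> L - P"
    show "y \<in> (space M - S) \<union> N"
    proof (rule ccontr)
      assume n: "\<not> ?thesis"
      have "y \<in> space M" using y L sets.sets_into_space by blast
      then have "y \<in> S" "y \<notin> N" using n by auto
      then obtain p k where p: "p \<in> P" "(p, y) \<in> \<kappa> k" unfolding S_def by auto
      then have py: "(p, y) \<in> R" using c(4) by auto
      have "p \<notin> N" using c(2)[OF _ py] \<open>y \<notin> N\<close> by auto
      then have "p = y" using trans[OF py] p(1) P(2) y by auto
      then show False using p y by auto
    qed
  qed
  ultimately have LP: "L - P \<in> null_sets M"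
    using c(1) P(1) L by (meson null_sets.Un null_sets_subset sets.Diff)
  moreover have "L - (L - P) = P" using P(2) by auto
  ultimately have "emeasure M P = emeasure M L"
    using emeasure_Diff_null_set[OF LP L] by simp
  then show False using P(4) by simp
qed

text \<open>Greedily match pairs of points of \<open>C\<close> by restrictions of the \<open>\<kappa> k\<close> to sets of the form
  \<open>U \<times> (space M - U)\<close>, with \<open>U\<close> in a countable separating family; two equivalent points can never
  both remain unmatched.\<close>

lemma halving:
  assumes sep: "separated M" and prob: "prob_space M" and eR: "equiv (space M) R"
    and erg: "ergodic_rel M R" and na: "non_atomic M" and cov: "covered_by M R \<kappa> N"
    and C: "C \<in> sets M"
  obtains \<theta> where "pbij M M \<theta>" "\<theta> \<subseteq> R" "Domain \<theta> \<inter> Range \<theta> = {}" "Domain \<theta> \<union> Range \<theta> \<subseteq> C"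
    "C - (Domain \<theta> \<union> Range \<theta>) \<in> null_sets M"
proof -
  note c = covered_byD[OF cov]
  obtain \<U> where \<U>: "countable \<U>" "\<U> \<subseteq> sets M"
    "\<forall>x\<in>space M. \<forall>y\<in>space M. x \<noteq> y \<longrightarrow> (\<exists>U\<in>\<U>. x \<in> U \<and> y \<notin> U)"
    using sep unfolding separated_def by meson
  \<comment> \<open>The empty set is inserted because the enumeration needs a non-empty family; it
    only contributes empty pieces \<open>T n\<close>.\<close>
  define U where "U n = from_nat_into (insert {} \<U>) n" for n
  have U: "U n \<in> sets M" for n
    using from_nat_into[of "insert {} \<U>" n] \<U>(2) unfolding U_def by auto
  define T where "T n = \<kappa> (fst (prod_decode n)) \<inter>
      U (snd (prod_decode n)) \<times> (space M - U (snd (prod_decode n)))" for n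
  have T: "pbij M M (T n)" for n
    unfolding T_def by (intro pbij_restrict c(3) U sets.compl_sets)
  have T_disj: "Domain (T n) \<inter> Range (T n) = {}" for n unfolding T_def by auto
  have TI: "\<exists>n. (x, y) \<in> T n" if xy: "(x, y) \<in> \<kappa> k" "x \<noteq> y" for x y k
  proof -
    have sp: "x \<in> space M" "y \<in> space M" using pbijD(6,7)[OF c(3) xy(1)] .
    then obtain V where V: "V \<in> \<U>" "x \<in> V" "y \<notin> V" using \<U>(3) xy(2) by blast
    obtain l where "U l = V"
      using from_nat_into_surj[of "insert {} \<U>" V] \<U>(1) V(1) unfolding U_def by auto
    then have "(x, y) \<in> T (prod_encode (k, l))" using V xy(1) sp unfolding T_def by simp
    then show ?thesis by blast
  qed
  \<comment> \<open>\<open>rem n\<close> holds the points still unmatched before stage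
    \<open>n\<close>; \<open>E n\<close> is the part of \<open>T n\<close> that joins two of
    them.\<close>
  define rem where "rem = rec_nat C (\<lambda>n D. D - (Domain (T n \<inter> D \<times> D) \<union> Range (T n \<inter> D \<times> D)))"
  define E where "E n = T n \<inter> rem n \<times> rem n" for n
  have rem0: "rem 0 = C" unfolding rem_def by simp
  have remS: "rem (Suc n) = rem n - (Domain (E n) \<union> Range (E n))" for n
    unfolding rem_def E_def by simp
  have rem: "rem n \<in> sets M" for n
  proof (induction n)
    case (Suc n)
    have "pbij M M (E n)" unfolding E_def by (intro pbij_restrict T Suc)
    then show ?case unfolding remS using Suc pbij_Domain pbij_Range by blast
  qed (simp add: rem0 C)
  have E: "pbij M M (E n)" for n unfolding E_def by (intro pbij_restrict T rem)
  have mono: "rem n \<subseteq> rem m" if "m \<le> n" for m n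
    using lift_Suc_antimono_le[of rem, OF _ that] remS by auto
  \<comment> \<open>No point is matched at two different stages. This gives both the injectivity of
    the union \<theta> and the disjointness of its domain and range.\<close>
  have once: "m = n" if "z \<in> Domain (E m) \<union> Range (E m)" "z \<in> Domain (E n) \<union> Range (E n)" for z m n
  proof -
    have False if h: "m < n" "z \<in> Domain (E m) \<union> Range (E m)" "z \<in> Domain (E n) \<union> Range (E n)" for m n
    proof -
      have "z \<notin> rem (Suc m)" using h(2) remS by auto
      moreover have "z \<in> rem n" using h(3) unfolding E_def by auto
      ultimately show False using mono[of "Suc m" n] h(1) by auto
    qed
    then show ?thesis using that by (meson linorder_neqE_nat)
  qed
  define \<theta> where "\<theta> = (\<Union>n. E n)"
  show ?thesis
  proof (rule that[of \<theta>])
    show "pbij M M \<theta>" unfolding \<theta>_def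
    proof (rule pbij_UN)
      fix m n x y z
      show "y = z" if h: "(x, y) \<in> E m" "(x, z) \<in> E n"
      proof -
        have "m = n" using once[of x m n] h by auto
        then show ?thesis using pbijD(2)[OF E] h by blast
      qed
      show "x = y" if h: "(x, z) \<in> E m" "(y, z) \<in> E n"
      proof -
        have "m = n" using once[of z m n] h by auto
        then show ?thesis using pbijD(3)[OF E] h by blast
      qed
    qed (use E in auto)
    show "\<theta> \<subseteq> R" unfolding \<theta>_def E_def T_def using c(4) by auto
    show "Domain \<theta> \<inter> Range \<theta> = {}"
    proof -
      have False if h: "(x, y) \<in> E m" "(z, x) \<in> E n" for x y z m n
      proof -
        have "m = n" using once[of x m n] h by auto
        then show False using h T_disj[of n] unfolding E_def by auto
      qed
      then show ?thesis unfolding \<theta>_def by auto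
    qed
    show "Domain \<theta> \<union> Range \<theta> \<subseteq> C"
      using mono[of 0] rem0 unfolding \<theta>_def E_def by auto
    show "C - (Domain \<theta> \<union> Range \<theta>) \<in> null_sets M"
    proof (rule partial_transversal_null[OF prob eR erg na cov])
      show "C - (Domain \<theta> \<union> Range \<theta>) \<in> sets M"
        using C pbij_Domain[OF \<open>pbij M M \<theta>\<close>] pbij_Range[OF \<open>pbij M M \<theta>\<close>] by auto
      fix x y assume xy: "(x, y) \<in> R" "x \<in> C - (Domain \<theta> \<union> Range \<theta>)" "y \<in> C - (Domain \<theta> \<union> Range \<theta>)" "x \<notin> N"
      have inr: "z \<in> rem n" if "z \<in> C - (Domain \<theta> \<union> Range \<theta>)" for z n
      proof (induction n)
        case (Suc n)
        have "z \<notin> Domain (E n) \<union> Range (E n)" using that unfolding \<theta>_def by blast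
        then show ?case using Suc remS by blast
      qed (use that rem0 in simp)
      show "x = y"
      proof (rule ccontr)
        assume "x \<noteq> y"
        moreover obtain k where "(x, y) \<in> \<kappa> k" using c(5)[OF xy(1,4)] by auto
        ultimately obtain n where "(x, y) \<in> T n" using TI by blast
        then have "(x, y) \<in> E n" using inr[OF xy(2)] inr[OF xy(3)] unfolding E_def by auto
        then show False using xy(2) unfolding \<theta>_def by auto
      qed
    qed
  qed
qed

section \<open>Doubling of frames\<close>

text \<open>Since \<theta> maps one half of the base onto the other, the old images of the second
  half become new images of the first half: the first \<open>n\<close> maps are restrictions of the
  old ones, the last \<open>n\<close> go through \<theta> first.\<close>

lemma frame_double:
  assumes fr: "frame M R n \<Phi> B" and eR: "equiv (space M) R" and II: "type_II1 M R"
    and \<theta>: "pbij M M \<theta>" "\<theta> \<subseteq> R" "Domain \<theta> \<inter> Range \<theta> = {}" "Domain \<theta> \<union> Range \<theta> \<subseteq> B"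
    "B - (Domain \<theta> \<union> Range \<theta>) \<in> null_sets M"
  shows "frame M R (2 * n) (\<lambda>i. if i < n then \<Phi> i \<inter> Domain \<theta> \<times> space M else \<theta> O \<Phi> (i - n)) (Domain \<theta>)"
    (is "frame M R _ ?\<Psi> _")
  unfolding frame_def
proof (intro conjI allI impI)
  note pb = frame_pbij[OF fr] and dom = frame_Domain[OF fr] and sub = frame_sub[OF fr]
  have D: "Domain \<theta> \<in> sets M" "Range \<theta> \<in> sets M" using pbij_Domain[OF \<theta>(1)] pbij_Range[OF \<theta>(1)] .
  show "0 < 2 * n" using frame_pos[OF fr] by simp
  fix i assume i: "i < 2 * n"
  show "pbij M M (?\<Psi> i)"
    using i pb D by (auto intro!: pbij_comp \<theta>(1) pbij_restrict)
  have "\<theta> O \<Phi> j \<subseteq> R" if "j < n" for j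
  proof (rule subrelI)
    fix x z assume "(x, z) \<in> \<theta> O \<Phi> j"
    then obtain y where "(x, y) \<in> R" "(y, z) \<in> R" using sub[OF \<open>j < n\<close>] \<theta>(2) by auto
    then show "(x, z) \<in> R" using eR unfolding equiv_def by (meson transD)
  qed
  then show "?\<Psi> i \<subseteq> R"
    using i sub[of i] by auto
  have "Domain (\<theta> O \<Phi> j) = Domain \<theta>" if "j < n" for j
    using dom[OF that] \<theta>(4) by blast
  moreover have "Domain (\<Phi> j \<inter> Domain \<theta> \<times> space M) = Domain \<theta>" if "j < n" for j
    using dom[OF that] \<theta>(4) pbijD(1)[OF pb[OF that]] by blast
  ultimately show "Domain (?\<Psi> i) = Domain \<theta>"
    using i by auto
next
  note pb = frame_pbij[OF fr] and dom = frame_Domain[OF fr] and disj = frame_disj[OF fr]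
  \<comment> \<open>\<open>k i\<close> is the old index from which the new map \<open>i\<close>
    arises. A point determines its old index and its old base point, and the half containing that
    base point tells whether \<open>i < n\<close>.\<close>
  define k where "k i = (if i < n then i else i - n)" for i
  have pc: "\<exists>b. (b, x) \<in> \<Phi> (k i) \<and> (if i < n then b \<in> Domain \<theta> else b \<in> Range \<theta>)" if "x \<in> Range (?\<Psi> i)" for i x
    using that unfolding k_def by (auto split: if_splits)
  fix i j :: nat assume ij: "i < 2 * n" "j < 2 * n" "i \<noteq> j"
  show "Range (?\<Psi> i) \<inter> Range (?\<Psi> j) = {}"
  proof (rule ccontr)
    assume "\<not> ?thesis"
    then obtain x where x: "x \<in> Range (?\<Psi> i)" "x \<in> Range (?\<Psi> j)" by blast
    obtain b where b: "(b, x) \<in> \<Phi> (k i)" "if i < n then b \<in> Domain \<theta> else b \<in> Range \<theta>"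
      using pc[OF x(1)] by blast
    obtain b' where b': "(b', x) \<in> \<Phi> (k j)" "if j < n then b' \<in> Domain \<theta> else b' \<in> Range \<theta>"
      using pc[OF x(2)] by blast
    have kn: "k i < n" "k j < n" using ij unfolding k_def by auto
    then have kk: "k i = k j" using disj b(1) b'(1) by blast
    then have "b = b'" using pbijD(3)[OF pb[OF kn(2)]] b(1) b'(1) by auto
    then have "i < n \<longleftrightarrow> j < n" using b(2) b'(2) \<theta>(3) by (auto split: if_splits)
    then show False using kk ij unfolding k_def by (auto split: if_splits)
  qed
next
  note pb = frame_pbij[OF fr] and dom = frame_Domain[OF fr] and sub = frame_sub[OF fr]
  let ?Z = "B - (Domain \<theta> \<union> Range \<theta>)"
  \<comment> \<open>The only newly uncovered points are images of the null part of \<open>B\<close>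
    that \<theta> leaves unmatched, and these images are null because the maps preserve the
    measure.\<close>
  have "space M - (\<Union>i<2*n. Range (?\<Psi> i)) \<subseteq> (space M - (\<Union>i<n. Range (\<Phi> i))) \<union> (\<Union>i<n. \<Phi> i `` ?Z)"
  proof
    fix x assume x: "x \<in> space M - (\<Union>i<2*n. Range (?\<Psi> i))"
    show "x \<in> (space M - (\<Union>i<n. Range (\<Phi> i))) \<union> (\<Union>i<n. \<Phi> i `` ?Z)"
    proof (cases "\<exists>i<n. x \<in> Range (\<Phi> i)")
      case False
      then show ?thesis using x by auto
    next
      case True
      then obtain i b where i: "i < n" "(b, x) \<in> \<Phi> i" by auto
      have bB: "b \<in> B" using i dom[OF i(1)] by auto
      have xs: "x \<in> space M" using x by simp
      have "b \<notin> Domain \<theta>"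
      proof
        assume "b \<in> Domain \<theta>"
        then have "x \<in> Range (?\<Psi> i)" using i xs by auto
        moreover have "i < 2 * n" using i by simp
        ultimately show False using x by blast
      qed
      moreover have "b \<notin> Range \<theta>"
      proof
        assume "b \<in> Range \<theta>"
        then have "x \<in> Range (?\<Psi> (i + n))" using i by auto
        moreover have "i + n < 2 * n" using i by simp
        ultimately show False using x by blast
      qed
      ultimately show ?thesis using i bB by blast
    qed
  qed
  moreover have "\<Phi> i `` ?Z \<in> null_sets M" if "i < n" for i
  proof -
    have "emeasure M (\<Phi> i `` ?Z) \<le> emeasure M ?Z"
      by (rule type_II1_image_le[OF II pb[OF that] sub[OF that]]) (use \<theta>(5) in auto)
    then show ?thesis using \<theta>(5) pbijD(4)[OF pb[OF that]] by (auto simp: null_sets_def)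
  qed
  then have "(space M - (\<Union>i<n. Range (\<Phi> i))) \<union> (\<Union>i<n. \<Phi> i `` ?Z) \<in> null_sets M"
    by (intro null_sets.Un frame_null[OF fr] null_sets_UN') auto
  moreover have "space M - (\<Union>i<2*n. Range (?\<Psi> i)) \<in> sets M"
  proof -
    have "pbij M M (?\<Psi> i)" if "i < 2 * n" for i
      using that pb pbij_Domain[OF \<theta>(1)] by (auto intro!: pbij_comp \<theta>(1) pbij_restrict)
    then have "Range (?\<Psi> i) \<in> sets M" if "i < 2 * n" for i using that pbij_Range by blast
    then show ?thesis by auto
  qed
  ultimately show "space M - (\<Union>i<2*n. Range (?\<Psi> i)) \<in> null_sets M"
    by (rule null_sets_subset[rotated 2])
qed

lemma frame_measure:
  assumes fr: "frame M R n \<Phi> B" and II: "type_II1 M R" and "prob_space M"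
  shows "of_nat n * emeasure M B \<le> 1"
proof -
  interpret prob_space M by fact
  note pb = frame_pbij[OF fr]
  have "of_nat n * emeasure M B = (\<Sum>i<n. emeasure M (Range (\<Phi> i)))"
    using type_II1_Range[OF II pb frame_sub[OF fr]] frame_Domain[OF fr] by simp
  also have "\<dots> = emeasure M (\<Union>i<n. Range (\<Phi> i))"
  proof (rule sum_emeasure)
    show "(\<lambda>i. Range (\<Phi> i)) ` {..<n} \<subseteq> sets M" using pbij_Range[OF pb] by auto
    show "disjoint_family_on (\<lambda>i. Range (\<Phi> i)) {..<n}"
      using frame_disj[OF fr] unfolding disjoint_family_on_def by blast
  qed simp
  also have "\<dots> \<le> 1" by (rule emeasure_le_1)
  finally show ?thesis .
qed

text \<open>Doubling \<open>k\<close> times gives \<open>2 ^ k\<close> disjoint images of the base,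
  all of the same measure, so the base has measure at most \<open>1 / 2 ^ k\<close>. The condition
  \<open>\<Phi> 0 = Id_on B\<close> survives doubling and later allows a point to be joined to its
  own base point by the frame relation.\<close>

lemma frame_exists:
  assumes sep: "separated M" and prob: "prob_space M" and eR: "equiv (space M) R"
    and erg: "ergodic_rel M R" and na: "non_atomic M" and cov: "covered_by M R \<kappa> N"
    and II: "type_II1 M R" and e: "\<epsilon> > 0"
  obtains n \<Phi> B where "frame M R n \<Phi> B" "\<Phi> 0 = Id_on B" "emeasure M B < ennreal \<epsilon>"
proof -
  have "\<exists>\<Phi> B. frame M R (2 ^ k) \<Phi> B \<and> \<Phi> 0 = Id_on B" for k
  proof (induction k)
    case 0
    have "frame M R (2 ^ 0) (\<lambda>_. Id_on (space M)) (space M)"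
      using eR unfolding frame_def equiv_def refl_on_def by (auto intro: pbij_Id_on)
    then show ?case by (intro exI[of _ "\<lambda>_. Id_on (space M)"]) auto
  next
    case (Suc k)
    then obtain \<Phi> B where fr: "frame M R (2 ^ k) \<Phi> B" and 0: "\<Phi> 0 = Id_on B" by auto
    obtain \<theta> where \<theta>: "pbij M M \<theta>" "\<theta> \<subseteq> R" "Domain \<theta> \<inter> Range \<theta> = {}" "Domain \<theta> \<union> Range \<theta> \<subseteq> B"
      "B - (Domain \<theta> \<union> Range \<theta>) \<in> null_sets M"
      by (rule halving[OF sep prob eR erg na cov frame_base_sets[OF fr]])
    let ?\<Psi> = "\<lambda>i. if i < 2 ^ k then \<Phi> i \<inter> Domain \<theta> \<times> space M else \<theta> O \<Phi> (i - 2 ^ k)"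
    have "frame M R (2 ^ Suc k) ?\<Psi> (Domain \<theta>)"
      using frame_double[OF fr eR II \<theta>] by simp
    moreover have "?\<Psi> 0 = Id_on (Domain \<theta>)"
      using \<theta>(4) pbijD(1)[OF \<theta>(1)] by (auto simp: 0)
    ultimately show ?case by blast
  qed
  note ex = this
  obtain k where k: "1 / \<epsilon> < 2 ^ k" using real_arch_pow[of 2 "1 / \<epsilon>"] by auto
  obtain \<Phi> B where fr: "frame M R (2 ^ k) \<Phi> B" "\<Phi> 0 = Id_on B" using ex[of k] by auto
  interpret prob_space M by fact
  have "of_nat (2 ^ k) * emeasure M B = ennreal (2 ^ k * measure M B)"
    unfolding emeasure_eq_measure ennreal_of_nat_eq_real_of_nat by (simp flip: ennreal_mult')
  then have "ennreal (2 ^ k * measure M B) \<le> 1"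
    using frame_measure[OF fr(1) II prob] by metis
  then have a: "measure M B * 2 ^ k \<le> 1" by (simp add: mult.commute)
  have b: "1 < \<epsilon> * 2 ^ k" using k e by (simp add: field_simps)
  from le_less_trans[OF a b] have "measure M B < \<epsilon>" by (rule mult_right_less_imp_less) simp
  then have "emeasure M B < ennreal \<epsilon>" using e by (simp add: emeasure_eq_measure ennreal_lessI)
  then show ?thesis by (rule that[OF fr])
qed

section \<open>Decompositions as a product\<close>

lemma product_rel_iff: "((a, b), (c, d)) \<in> product_rel P Q \<longleftrightarrow> (a, c) \<in> P \<and> (b, d) \<in> Q"
  unfolding product_rel_def by auto

text \<open>Words in finitely many pieces and their inverses are countable in number and exhaust
  \<open>R\<close> off a null set. This is where the countable covers of the two factor relations
  ultimately come from.\<close>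

lemma finite_graphing_words:
  assumes "finite_graphing M R K" and eR: "equiv (space M) R"
  obtains W where "countable W" "\<And>w. w \<in> W \<Longrightarrow> pbij M M w \<and> w \<subseteq> R"
    "AE x in M. \<forall>y. (x, y) \<in> R \<longrightarrow> (\<exists>w\<in>W. (x, y) \<in> w)"
proof -
  obtain Q where Q: "finite Q" "K = \<Union>Q" "\<And>q. q \<in> Q \<Longrightarrow> pbij M M q \<and> q \<subseteq> R"
    by (rule finite_graphing_pbij[OF assms(1)]) blast
  define Q' where "Q' = Q \<union> converse ` Q"
  define w where "w qs = foldr (O) qs (Id_on (space M))" for qs
  have Q': "pbij M M q" if "q \<in> Q'" for q
    using that Q(3) pbij_converse[of M M] unfolding Q'_def by auto
  have Q'R: "q \<subseteq> R" if "q \<in> Q'" for q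
    using that Q(3) eR unfolding Q'_def equiv_def by (auto dest: symD)
  have wR: "w qs \<subseteq> R" if "qs \<in> lists Q'" for qs
    using that
  proof (induction qs)
    case Nil
    then show ?case using eR unfolding w_def equiv_def by (auto dest: refl_onD)
  next
    case (Cons q qs)
    have "q O w qs \<subseteq> R O R" using Cons.IH Q'R[OF Cons.hyps(1)] by (rule relcomp_mono[rotated])
    also have "R O R \<subseteq> R" using eR unfolding equiv_def by (simp add: trans_O_subset)
    finally show ?case unfolding w_def by simp
  qed
  have w: "pbij M M (w qs)" if "qs \<in> lists Q'" for qs
    using that unfolding w_def
    by (induction qs) (auto intro: pbij_Id_on pbij_comp Q')
  have "(x, y) \<in> R \<Longrightarrow> (x, y) \<in> (K \<union> K\<inverse>)\<^sup>* \<Longrightarrow> \<exists>qs\<in>lists Q'. (x, y) \<in> w qs" for x y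
  proof -
    assume "(x, y) \<in> R" and xy: "(x, y) \<in> (K \<union> K\<inverse>)\<^sup>*"
    then have y: "y \<in> space M" using eR by (auto simp: equiv_def dest: refl_onD)
    from xy show "\<exists>qs\<in>lists Q'. (x, y) \<in> w qs"
    proof (induction rule: converse_rtrancl_induct)
      case base
      show ?case using y by (intro bexI[of _ "[]"]) (auto simp: w_def)
    next
      case (step x z)
      then obtain qs where qs: "qs \<in> lists Q'" "(z, y) \<in> w qs" by auto
      obtain q where "q \<in> Q'" "(x, z) \<in> q" using step(1) unfolding Q(2) Q'_def by auto
      then show ?case using qs by (intro bexI[of _ "q # qs"]) (auto simp: w_def)
    qed
  qed
  moreover have "AE x in M. \<forall>y. (x, y) \<in> R \<longrightarrow> (x, y) \<in> (K \<union> K\<inverse>)\<^sup>*"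
    using assms(1) unfolding finite_graphing_def graphing_def by auto
  ultimately have "AE x in M. \<forall>y. (x, y) \<in> R \<longrightarrow> (\<exists>v\<in>w ` lists Q'. (x, y) \<in> v)"
    by (auto elim!: eventually_mono)
  moreover have "countable Q'" using Q(1) unfolding Q'_def by (simp add: countable_finite)
  then have "countable (w ` lists Q')" by simp
  ultimately show ?thesis using that[of "w ` lists Q'"] w wR by (metis (no_types, lifting) imageE)
qed

text \<open>By Fubini: on each slice with fixed second coordinate the map acts as \<open>P\<close>,
  which does not enlarge measures.\<close>

lemma (in pair_prob_space) emeasure_prod_image_le1:
  assumes P: "pbij M1 M1 P" "P \<subseteq> R1" and II: "type_II1 M1 R1" and Z: "Z \<in> sets (M1 \<Otimes>\<^sub>M M2)"
  shows "emeasure (M1 \<Otimes>\<^sub>M M2) (product_rel P (Id_on (space M2)) `` Z) \<le> emeasure (M1 \<Otimes>\<^sub>M M2) Z"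
proof -
  have "product_rel P (Id_on (space M2)) `` Z \<in> sets (M1 \<Otimes>\<^sub>M M2)"
    by (rule pbijD(4)[OF pbij_prod[OF P(1) pbij_Id_on] Z]) simp
  then have "emeasure (M1 \<Otimes>\<^sub>M M2) (product_rel P (Id_on (space M2)) `` Z) =
      (\<integral>\<^sup>+y. emeasure M1 ((\<lambda>x. (x, y)) -` (product_rel P (Id_on (space M2)) `` Z)) \<partial>M2)"
    by (rule emeasure_pair_measure_alt2)
  also have "\<dots> \<le> (\<integral>\<^sup>+y. emeasure M1 ((\<lambda>x. (x, y)) -` Z) \<partial>M2)"
  proof (rule nn_integral_mono)
    fix y assume y: "y \<in> space M2"
    have "(\<lambda>x. (x, y)) -` (product_rel P (Id_on (space M2)) `` Z) = P `` ((\<lambda>x. (x, y)) -` Z)"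
    proof (intro Set.set_eqI iffI)
      fix x assume "x \<in> P `` ((\<lambda>x. (x, y)) -` Z)"
      then obtain a where a: "(a, y) \<in> Z" "(a, x) \<in> P" by auto
      then have "((a, y), (x, y)) \<in> product_rel P (Id_on (space M2))"
        using y by (simp add: product_rel_iff Id_on_iff)
      then show "x \<in> (\<lambda>x. (x, y)) -` (product_rel P (Id_on (space M2)) `` Z)" using a(1) by blast
    qed (auto simp: product_rel_iff)
    then show "emeasure M1 ((\<lambda>x. (x, y)) -` (product_rel P (Id_on (space M2)) `` Z))
        \<le> emeasure M1 ((\<lambda>x. (x, y)) -` Z)"
      using type_II1_image_le[OF II P sets_Pair2[OF Z]] by simp
  qed
  also have "\<dots> = emeasure (M1 \<Otimes>\<^sub>M M2) Z"
    by (rule emeasure_pair_measure_alt2[OF Z, symmetric])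
  finally show ?thesis .
qed

lemma (in pair_prob_space) emeasure_prod_image_le2:
  assumes P: "pbij M2 M2 P" "P \<subseteq> R2" and II: "type_II1 M2 R2" and Z: "Z \<in> sets (M1 \<Otimes>\<^sub>M M2)"
  shows "emeasure (M1 \<Otimes>\<^sub>M M2) (product_rel (Id_on (space M1)) P `` Z) \<le> emeasure (M1 \<Otimes>\<^sub>M M2) Z"
proof -
  have "product_rel (Id_on (space M1)) P `` Z \<in> sets (M1 \<Otimes>\<^sub>M M2)"
    by (rule pbijD(4)[OF pbij_prod[OF pbij_Id_on P(1)] Z]) simp
  then have "emeasure (M1 \<Otimes>\<^sub>M M2) (product_rel (Id_on (space M1)) P `` Z) =
      (\<integral>\<^sup>+x. emeasure M2 (Pair x -` (product_rel (Id_on (space M1)) P `` Z)) \<partial>M1)"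
    by (rule M2.emeasure_pair_measure_alt)
  also have "\<dots> \<le> (\<integral>\<^sup>+x. emeasure M2 (Pair x -` Z) \<partial>M1)"
  proof (rule nn_integral_mono)
    fix x assume x: "x \<in> space M1"
    have "Pair x -` (product_rel (Id_on (space M1)) P `` Z) = P `` (Pair x -` Z)"
    proof (intro Set.set_eqI iffI)
      fix y assume "y \<in> P `` (Pair x -` Z)"
      then obtain b where b: "(x, b) \<in> Z" "(b, y) \<in> P" by auto
      then have "((x, b), (x, y)) \<in> product_rel (Id_on (space M1)) P"
        using x by (simp add: product_rel_iff Id_on_iff)
      then show "y \<in> Pair x -` (product_rel (Id_on (space M1)) P `` Z)" using b(1) by blast
    qed (auto simp: product_rel_iff)
    then show "emeasure M2 (Pair x -` (product_rel (Id_on (space M1)) P `` Z))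
        \<le> emeasure M2 (Pair x -` Z)"
      using type_II1_image_le[OF II P sets_Pair1[OF Z]] by simp
  qed
  also have "\<dots> = emeasure (M1 \<Otimes>\<^sub>M M2) Z"
    by (rule M2.emeasure_pair_measure_alt[OF Z, symmetric])
  finally show ?thesis .
qed

lemma measured_equiv_relD:
  assumes "measured_equiv_rel M R"
  shows "equiv (space M) R" "\<And>N. N \<in> null_sets M \<Longrightarrow> R `` N \<in> null_sets M"
    "\<And>x. x \<in> space M \<Longrightarrow> (x, x) \<in> R" "\<And>x y. (x, y) \<in> R \<Longrightarrow> (y, x) \<in> R"
    "\<And>x y z. (x, y) \<in> R \<Longrightarrow> (y, z) \<in> R \<Longrightarrow> (x, z) \<in> R"
    "\<And>x y. (x, y) \<in> R \<Longrightarrow> x \<in> space M" "\<And>x y. (x, y) \<in> R \<Longrightarrow> y \<in> space M"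
  using assms unfolding measured_equiv_rel_def equiv_def
  by (auto dest: symD transD refl_onD)

section \<open>Transfer between the relation and the product\<close>

text \<open>\<open>F\<close> is the graph of the isomorphism, which is a bijection between conull
  sets only. Every pointwise argument below has to stay clear of the points where it or its inverse
  is undefined.\<close>

locale product_decomposition = pair_prob_space M1 M2 + M: prob_space M
  for M1 :: "'b measure" and M2 :: "'c measure" and M :: "'a measure" +
  fixes R :: "('a \<times> 'a) set" and R1 :: "('b \<times> 'b) set" and R2 :: "('c \<times> 'c) set"
    and F :: "('a \<times> 'b \<times> 'c) set"
  assumes sep: "separated M" and sep1: "separated M1" and sep2: "separated M2"
    and mer: "measured_equiv_rel M R" and mer1: "measured_equiv_rel M1 R1"
    and mer2: "measured_equiv_rel M2 R2"
    and II: "type_II1 M R" and II1: "type_II1 M1 R1" and II2: "type_II1 M2 R2"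
    and na1: "non_atomic M1" and na2: "non_atomic M2"
    and erg: "ergodic_rel M R" and fin_gen: "finitely_generated_rel M R"
    and F: "pbij M (M1 \<Otimes>\<^sub>M M2) F"
    and F_Domain: "space M - Domain F \<in> null_sets M"
    and F_Range: "space (M1 \<Otimes>\<^sub>M M2) - Range F \<in> null_sets (M1 \<Otimes>\<^sub>M M2)"
    and F_measure: "\<And>C. C \<in> sets M \<Longrightarrow> C \<subseteq> Domain F \<Longrightarrow> emeasure (M1 \<Otimes>\<^sub>M M2) (F `` C) = emeasure M C"
    and F_rel: "\<And>x y u v. (x, u) \<in> F \<Longrightarrow> (y, v) \<in> F \<Longrightarrow> (x, y) \<in> R \<longleftrightarrow> (u, v) \<in> product_rel R1 R2"
begin

abbreviation "N \<equiv> M1 \<Otimes>\<^sub>M M2"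
abbreviation "S \<equiv> product_rel R1 R2"

lemma S_refl: "u \<in> space N \<Longrightarrow> (u, u) \<in> S"
  using measured_equiv_relD(3)[OF mer1] measured_equiv_relD(3)[OF mer2]
  by (cases u) (auto simp: product_rel_iff space_pair_measure)

lemma S_sym: "(u, v) \<in> S \<Longrightarrow> (v, u) \<in> S"
  using measured_equiv_relD(4)[OF mer1] measured_equiv_relD(4)[OF mer2]
  by (cases u, cases v) (simp add: product_rel_iff)

lemma S_trans:
  assumes "(u, v) \<in> S" "(v, w) \<in> S"
  shows "(u, w) \<in> S"
proof -
  obtain u1 u2 v1 v2 w1 w2 where eq: "u = (u1, u2)" "v = (v1, v2)" "w = (w1, w2)" by (meson surj_pair)
  show ?thesis
    using assms measured_equiv_relD(5)[OF mer1, of u1 v1 w1] measured_equiv_relD(5)[OF mer2, of u2 v2 w2]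
    unfolding eq by (simp add: product_rel_iff)
qed

lemma S_space: "(u, v) \<in> S \<Longrightarrow> u \<in> space N"
  using measured_equiv_relD(6)[OF mer1] measured_equiv_relD(6)[OF mer2]
  by (cases u, cases v) (auto simp: product_rel_iff space_pair_measure)

lemma F_vimage_measure:
  assumes D: "D \<in> sets N"
  shows "emeasure M (F\<inverse> `` D) = emeasure N D"
proof -
  have "F\<inverse> `` D \<subseteq> Domain F" by auto
  then have "emeasure M (F\<inverse> `` D) = emeasure N (F `` (F\<inverse> `` D))"
    using F_measure[OF pbijD(5)[OF F D]] by simp
  also have "F `` (F\<inverse> `` D) = D - (space N - Range F)"
  proof (intro Set.set_eqI iffI)
    fix u assume "u \<in> F `` (F\<inverse> `` D)"
    then obtain x u' where "(x, u) \<in> F" "(x, u') \<in> F" "u' \<in> D" by auto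
    moreover from this have "u' = u" using pbijD(2)[OF F] by blast
    ultimately show "u \<in> D - (space N - Range F)" by auto
  next
    fix u assume "u \<in> D - (space N - Range F)"
    then show "u \<in> F `` (F\<inverse> `` D)" using sets.sets_into_space[OF D] by auto
  qed
  also have "emeasure N \<dots> = emeasure N D"
    by (rule emeasure_Diff_null_set[OF F_Range D])
  finally show ?thesis .
qed

lemma F_vimage_null: "D \<in> null_sets N \<Longrightarrow> F\<inverse> `` D \<in> null_sets M"
  using F_vimage_measure[of D] pbijD(5)[OF F, of D] by (auto simp: null_sets_def)

lemma F_image_null:
  assumes C: "C \<in> null_sets M"
  shows "F `` C \<in> null_sets N"
proof -
  have s: "C \<inter> Domain F \<in> sets M" using C pbij_Domain[OF F] by auto
  have "F `` C = F `` (C \<inter> Domain F)" by auto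
  then have "emeasure N (F `` C) = emeasure M (C \<inter> Domain F)"
    using F_measure[OF s] by simp
  also have "\<dots> = 0" using C s by (meson emeasure_eq_0 inf_le1 null_setsD1 null_setsD2)
  finally show ?thesis using pbijD(4)[OF F] C by (auto simp: null_sets_def)
qed

text \<open>Ergodicity of \<open>R\<close> concerns exactly saturated sets, whereas the pullback of
  \<open>A\<close> is saturated only within \<open>Domain F\<close>. Adding the saturation of the
  null complement of \<open>Domain F\<close> repairs this without changing the measure.\<close>

lemma ergodic_S:
  assumes A: "A \<in> sets N" and inv: "S `` A \<subseteq> A"
  shows "emeasure N A = 0 \<or> emeasure N A = 1"
proof -
  define Z where "Z = R `` (space M - Domain F)"
  define C where "C = F\<inverse> `` A \<union> Z"
  note R = measured_equiv_relD[OF mer]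
  have Z: "Z \<in> null_sets M" unfolding Z_def by (rule R(2)[OF F_Domain])
  have FA: "F\<inverse> `` A \<in> sets M" by (rule pbijD(5)[OF F A])
  have C: "C \<in> sets M" unfolding C_def using FA Z by auto
  have "R `` C = C"
  proof
    show "C \<subseteq> R `` C" using sets.sets_into_space[OF C] R(3) by auto
    show "R `` C \<subseteq> C"
    proof
      fix y assume "y \<in> R `` C"
      then obtain x where x: "x \<in> C" "(x, y) \<in> R" by auto
      show "y \<in> C"
      proof (cases "x \<in> Z")
        case True
        then show ?thesis using R(5)[OF _ x(2)] unfolding C_def Z_def by auto
      next
        case False
        then obtain u where u: "(x, u) \<in> F" "u \<in> A" using x unfolding C_def by auto
        show ?thesis
        proof (cases "y \<in> Domain F")
          case True
          then obtain v where v: "(y, v) \<in> F" by auto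
          then have "(u, v) \<in> S" using F_rel[OF u(1) v] x(2) by simp
          then have "v \<in> A" using inv u(2) by auto
          then show ?thesis using v unfolding C_def by auto
        next
          case False
          then show ?thesis using R(7)[OF x(2)] R(3) unfolding C_def Z_def by auto
        qed
      qed
    qed
  qed
  then have "emeasure M C = 0 \<or> emeasure M C = 1" using erg C unfolding ergodic_rel_def by auto
  moreover have "emeasure M C = emeasure N A"
    unfolding C_def using emeasure_Un_null_set[OF FA Z] F_vimage_measure[OF A] by simp
  ultimately show ?thesis by simp
qed

lemma ergodic_factor1: "ergodic_rel M1 R1"
  unfolding ergodic_rel_def
proof (intro ballI impI)
  fix A assume A: "A \<in> sets M1" "R1 `` A = A"
  have "S `` (A \<times> space M2) \<subseteq> A \<times> space M2"
  proof
    fix v assume "v \<in> S `` (A \<times> space M2)"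
    then obtain u1 u2 v1 v2 where "v = (v1, v2)" "u1 \<in> A" "(u1, v1) \<in> R1" "(u2, v2) \<in> R2"
      unfolding product_rel_def by auto
    then show "v \<in> A \<times> space M2" using A(2) measured_equiv_relD(7)[OF mer2, of u2 v2] by auto
  qed
  then have "emeasure N (A \<times> space M2) = 0 \<or> emeasure N (A \<times> space M2) = 1"
    using A(1) by (intro ergodic_S) simp_all
  then show "emeasure M1 A = 0 \<or> emeasure M1 A = 1"
    using A(1) by (simp add: M2.emeasure_pair_measure_Times M2.emeasure_space_1)
qed

lemma ergodic_factor2: "ergodic_rel M2 R2"
  unfolding ergodic_rel_def
proof (intro ballI impI)
  fix A assume A: "A \<in> sets M2" "R2 `` A = A"
  have "S `` (space M1 \<times> A) \<subseteq> space M1 \<times> A"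
  proof
    fix v assume "v \<in> S `` (space M1 \<times> A)"
    then obtain u1 u2 v1 v2 where "v = (v1, v2)" "u2 \<in> A" "(u1, v1) \<in> R1" "(u2, v2) \<in> R2"
      unfolding product_rel_def by auto
    then show "v \<in> space M1 \<times> A" using A(2) measured_equiv_relD(7)[OF mer1, of u1 v1] by auto
  qed
  then have "emeasure N (space M1 \<times> A) = 0 \<or> emeasure N (space M1 \<times> A) = 1"
    using A(1) by (intro ergodic_S) simp_all
  then show "emeasure M2 A = 0 \<or> emeasure M2 A = 1"
    using A(1) by (simp add: M2.emeasure_pair_measure_Times M1.emeasure_space_1)
qed

text \<open>For \<open>L\<close> one of the factors and \<open>I\<close> an embedding of it as a slice of the product, the factor
  relation is covered by the traces on the slice of the words in a finite graphing of \<open>R\<close>.\<close>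

lemma covered_by_section:
  assumes I: "pbij L N I" "Domain I = space L" and T: "measured_equiv_rel L T"
    and IT: "\<And>x y u v. (x, u) \<in> I \<Longrightarrow> (y, v) \<in> I \<Longrightarrow> (x, y) \<in> T \<longleftrightarrow> (u, v) \<in> S"
    and Z: "space N - Range F \<subseteq> Z" "Z \<in> sets N" "I\<inverse> `` Z \<in> null_sets L"
    and W: "countable W" "\<And>w. w \<in> W \<Longrightarrow> pbij M M w \<and> w \<subseteq> R"
      "\<And>x u y. (x, u) \<in> F \<Longrightarrow> u \<notin> Z \<Longrightarrow> (x, y) \<in> R \<Longrightarrow> \<exists>w\<in>W. (x, y) \<in> w"
  shows "\<exists>\<kappa> N'. covered_by L T \<kappa> N'"
proof -
  note T' = measured_equiv_relD[OF T]
  \<comment> \<open>From the slice pass to \<open>M\<close>, follow the word \<open>w\<close>,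
    return through \<open>F\<close>, and keep what lands in the slice again.\<close>
  define G where "G w = (I O F\<inverse>) O w O (F O I\<inverse>)" for w
  define \<kappa> where "\<kappa> = from_nat_into (insert {} (G ` W))"
  \<comment> \<open>Saturating the bad set ensures that a point off \<open>N'\<close> has its whole
    class off the bad set, so that both ends of a pair have preimages under
    \<open>F\<close>.\<close>
  define N' where "N' = T `` (I\<inverse> `` Z)"
  have IF: "pbij L M (I O F\<inverse>)" by (rule pbij_comp[OF I(1) pbij_converse[OF F]])
  have FI: "pbij M L (F O I\<inverse>)" by (rule pbij_comp[OF F pbij_converse[OF I(1)]])
  have pb: "pbij L L (G w)" if "w \<in> W" for w
    unfolding G_def by (intro pbij_comp[OF IF] pbij_comp[OF _ FI] conjunct1[OF W(2)] that)
  have sub: "G w \<subseteq> T" if "w \<in> W" for w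
  proof (rule subrelI)
    fix x y assume "(x, y) \<in> G w"
    then obtain u x' y' v where h: "(x, u) \<in> I" "(x', u) \<in> F" "(x', y') \<in> w" "(y', v) \<in> F" "(y, v) \<in> I"
      unfolding G_def by auto
    have "(x', y') \<in> R" using W(2)[OF that] h(3) by auto
    then show "(x, y) \<in> T" using F_rel[OF h(2,4)] IT[OF h(1,5)] by simp
  qed
  have "\<kappa> k = {} \<or> (\<exists>w\<in>W. \<kappa> k = G w)" for k
    using from_nat_into[of "insert {} (G ` W)" k] unfolding \<kappa>_def by auto
  then have \<kappa>: "pbij L L (\<kappa> k) \<and> \<kappa> k \<subseteq> T" for k
    using pb sub pbij_Id_on[of "{}" L] by (metis Id_on_empty empty_subsetI sets.empty_sets)
  have "covered_by L T \<kappa> N'"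
    unfolding covered_by_def
  proof (intro conjI allI impI)
    show "N' \<in> null_sets L" unfolding N'_def by (rule T'(2)[OF Z(3)])
    show "T `` N' \<subseteq> N'" unfolding N'_def using T'(5) by blast
    show "pbij L L (\<kappa> k)" "\<kappa> k \<subseteq> T" for k using \<kappa> by auto
    fix x y assume xy: "(x, y) \<in> T" "x \<notin> N'"
    have nZ: "z \<notin> I\<inverse> `` Z" if "(x, z) \<in> T" for z
      using xy(2) T'(4)[OF that] unfolding N'_def by auto
    have "x \<in> Domain I" "y \<in> Domain I" using T'(6,7)[OF xy(1)] I(2) by auto
    then obtain u v where uv: "(x, u) \<in> I" "(y, v) \<in> I" by auto
    have "u \<notin> Z" "v \<notin> Z" using nZ[OF T'(3)[OF T'(6)[OF xy(1)]]] nZ[OF xy(1)] uv by auto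
    moreover have "u \<in> space N" "v \<in> space N" using pbijD(7)[OF I(1)] uv by auto
    ultimately have "u \<in> Range F" "v \<in> Range F" using Z(1) by auto
    then obtain x' y' where x': "(x', u) \<in> F" "(y', v) \<in> F" by auto
    have "(x', y') \<in> R" using F_rel[OF x'] IT[OF uv] xy(1) by simp
    then obtain w where w: "w \<in> W" "(x', y') \<in> w" using W(3)[OF x'(1) \<open>u \<notin> Z\<close>] by auto
    have "(x, y) \<in> G w" unfolding G_def using uv x' w(2) by auto
    moreover obtain k where "\<kappa> k = G w"
      using from_nat_into_surj[of "insert {} (G ` W)" "G w"] W(1) w(1) unfolding \<kappa>_def by auto
    ultimately show "\<exists>k. (x, y) \<in> \<kappa> k" by auto
  qed
  then show ?thesis by blast
qed

text \<open>The bad points of the product form a null set, so by Fubini almost every slice in either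
  direction meets it in a null set. One such slice in each direction is enough.\<close>

lemma covered_factors: "\<exists>\<kappa> N1. covered_by M1 R1 \<kappa> N1" "\<exists>\<mu> N2. covered_by M2 R2 \<mu> N2"
proof -
  obtain K where K: "finite_graphing M R K" using fin_gen unfolding finitely_generated_rel_def by auto
  obtain W where W: "countable W" "\<And>w. w \<in> W \<Longrightarrow> pbij M M w \<and> w \<subseteq> R"
    "AE x in M. \<forall>y. (x, y) \<in> R \<longrightarrow> (\<exists>w\<in>W. (x, y) \<in> w)"
    by (rule finite_graphing_words[OF K measured_equiv_relD(1)[OF mer]]) blast
  obtain Z0 where Z0: "Z0 \<in> null_sets M"
    "\<And>x. x \<in> space M - Z0 \<Longrightarrow> \<forall>y. (x, y) \<in> R \<longrightarrow> (\<exists>w\<in>W. (x, y) \<in> w)"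
    by (rule AE_E3[OF W(3)]) blast
  \<comment> \<open>A point is bad if it has no preimage under \<open>F\<close>, or if its preimage
    is one where the words fail to reach the whole class.\<close>
  define Z where "Z = (space N - Range F) \<union> F `` Z0"
  have Z: "Z \<in> null_sets N" unfolding Z_def by (intro null_sets.Un F_Range F_image_null Z0(1))
  then have Zs: "Z \<in> sets N" by auto
  have ZW: "\<exists>w\<in>W. (x, y) \<in> w" if "(x, u) \<in> F" "u \<notin> Z" "(x, y) \<in> R" for x u y
    using that Z0(2)[of x] pbijD(6)[OF F that(1)] unfolding Z_def by auto
  have Z1: "space N - Range F \<subseteq> Z" unfolding Z_def by auto
  have "(\<integral>\<^sup>+y. emeasure M1 ((\<lambda>x. (x, y)) -` Z) \<partial>M2) = 0"
    using emeasure_pair_measure_alt2[OF Zs] Z by auto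
  then have "AE y in M2. emeasure M1 ((\<lambda>x. (x, y)) -` Z) = 0"
    using measurable_emeasure_Pair2[OF Zs] by (simp add: nn_integral_0_iff_AE)
  then have ae: "AE y in M2. emeasure M1 ((\<lambda>x. (x, y)) -` Z) = 0 \<and> y \<in> space M2" by auto
  have "ae_filter M2 \<noteq> bot" by (simp add: ae_filter_eq_bot_iff M2.emeasure_space_1)
  from eventually_happens'[OF this ae]
  obtain y where y: "emeasure M1 ((\<lambda>x. (x, y)) -` Z) = 0" "y \<in> space M2" by auto
  let ?I = "{(x, (x, y)) | x. x \<in> space M1}"
  show "\<exists>\<kappa> N1. covered_by M1 R1 \<kappa> N1"
  proof (rule covered_by_section[OF pbij_section1[OF y(2) separated_singleton[OF sep2 y(2)]] _ mer1 _ Z1 Zs _ W(1,2) ZW])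
    show "(x, x') \<in> R1 \<longleftrightarrow> (u, v) \<in> S" if "(x, u) \<in> ?I" "(x', v) \<in> ?I" for x x' u v
      using that measured_equiv_relD(3)[OF mer2 y(2)] by (auto simp: product_rel_iff)
    have "?I\<inverse> `` Z = (\<lambda>x. (x, y)) -` Z"
      using sets.sets_into_space[OF Zs] by (auto simp: space_pair_measure)
    then show "?I\<inverse> `` Z \<in> null_sets M1" using y(1) sets_Pair2[OF Zs, of y] by (auto simp: null_sets_def)
  qed auto
  have "(\<integral>\<^sup>+x. emeasure M2 (Pair x -` Z) \<partial>M1) = 0"
    using M2.emeasure_pair_measure_alt[OF Zs] Z by auto
  then have "AE x in M1. emeasure M2 (Pair x -` Z) = 0"
    using M2.measurable_emeasure_Pair[OF Zs] by (simp add: nn_integral_0_iff_AE)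
  then have ae: "AE x in M1. emeasure M2 (Pair x -` Z) = 0 \<and> x \<in> space M1" by auto
  have "ae_filter M1 \<noteq> bot" by (simp add: ae_filter_eq_bot_iff M1.emeasure_space_1)
  from eventually_happens'[OF this ae]
  obtain x where x: "emeasure M2 (Pair x -` Z) = 0" "x \<in> space M1" by auto
  let ?J = "{(y, (x, y)) | y. y \<in> space M2}"
  show "\<exists>\<mu> N2. covered_by M2 R2 \<mu> N2"
  proof (rule covered_by_section[OF pbij_section2[OF x(2) separated_singleton[OF sep1 x(2)]] _ mer2 _ Z1 Zs _ W(1,2) ZW])
    show "(y, y') \<in> R2 \<longleftrightarrow> (u, v) \<in> S" if "(y, u) \<in> ?J" "(y', v) \<in> ?J" for y y' u v
      using that measured_equiv_relD(3)[OF mer1 x(2)] by (auto simp: product_rel_iff)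
    have "?J\<inverse> `` Z = Pair x -` Z"
      using sets.sets_into_space[OF Zs] by (auto simp: space_pair_measure)
    then show "?J\<inverse> `` Z \<in> null_sets M2" using x(1) sets_Pair1[OF Zs, of x] by (auto simp: null_sets_def)
  qed auto
qed

text \<open>Two equivalent points of the product are joined by changing the second coordinate along
  some \<open>\<mu> l\<close> and then the first along some \<open>\<kappa> k\<close>. Apart from
  the exceptional sets of the factors, the saturation of \<open>Z\<close> is therefore a countable
  union of images under maps that change one coordinate only, and by Fubini those keep null sets
  null.\<close>

lemma product_saturation_null:
  assumes c1: "covered_by M1 R1 \<kappa> N1" and c2: "covered_by M2 R2 \<mu> N2" and Z: "Z \<in> null_sets N"
  obtains Y where "Y \<in> null_sets N" "Z \<subseteq> Y" "S `` Y \<subseteq> Y"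
proof
  note d1 = covered_byD[OF c1] and d2 = covered_byD[OF c2]
  define Y where "Y = N1 \<times> space M2 \<union> space M1 \<times> N2 \<union>
      (\<Union>k. \<Union>l. product_rel (\<kappa> k) (Id_on (space M2)) `` (product_rel (Id_on (space M1)) (\<mu> l) `` Z))"
  have sub1: "N1 \<subseteq> space M1" "N2 \<subseteq> space M2"
    using d1(1) d2(1) sets.sets_into_space by (auto simp: null_sets_def)
  have ZI: "v \<in> Y" if "u \<in> Z" "(u, v) \<in> S" for u v
  proof (cases "v \<in> N1 \<times> space M2 \<union> space M1 \<times> N2")
    case False
    obtain u1 u2 v1 v2 where uv: "u = (u1, u2)" "v = (v1, v2)" by (meson surj_pair)
    have r: "(u1, v1) \<in> R1" "(u2, v2) \<in> R2" using that(2) unfolding uv by (simp_all add: product_rel_iff)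
    have sp: "u1 \<in> space M1" "v1 \<in> space M1" "u2 \<in> space M2" "v2 \<in> space M2"
      using measured_equiv_relD(6,7)[OF mer1 r(1)] measured_equiv_relD(6,7)[OF mer2 r(2)] by auto
    have "u1 \<notin> N1" "u2 \<notin> N2" using False d1(2)[OF _ r(1)] d2(2)[OF _ r(2)] sp uv by auto
    then obtain k l where "(u1, v1) \<in> \<kappa> k" "(u2, v2) \<in> \<mu> l" using d1(5)[OF r(1)] d2(5)[OF r(2)] by auto
    then have "((u1, u2), (u1, v2)) \<in> product_rel (Id_on (space M1)) (\<mu> l)"
      "((u1, v2), (v1, v2)) \<in> product_rel (\<kappa> k) (Id_on (space M2))"
      using sp by (auto simp: product_rel_iff)
    then show ?thesis using that(1) unfolding Y_def uv by blast
  qed (auto simp: Y_def)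
  show "Z \<subseteq> Y"
    using ZI S_refl sets.sets_into_space[OF null_setsD2[OF Z]] by blast
  show "S `` Y \<subseteq> Y"
  proof
    fix w assume "w \<in> S `` Y"
    then obtain v where v: "v \<in> Y" "(v, w) \<in> S" by auto
    have ws: "w \<in> space N" using S_space[OF S_sym[OF v(2)]] .
    show "w \<in> Y"
    proof (cases "v \<in> N1 \<times> space M2 \<union> space M1 \<times> N2")
      case True
      obtain v1 v2 w1 w2 where vw: "v = (v1, v2)" "w = (w1, w2)" by (meson surj_pair)
      have r: "(v1, w1) \<in> R1" "(v2, w2) \<in> R2" using v(2) unfolding vw by (simp_all add: product_rel_iff)
      show ?thesis
        using True ws d1(2)[OF _ r(1)] d2(2)[OF _ r(2)] unfolding vw Y_def by (auto simp: space_pair_measure)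
    next
      case False
      then obtain k l u u' where u: "u \<in> Z" "(u, u') \<in> product_rel (Id_on (space M1)) (\<mu> l)"
          "(u', v) \<in> product_rel (\<kappa> k) (Id_on (space M2))"
        using v(1) unfolding Y_def by auto
      have "product_rel (Id_on (space M1)) (\<mu> l) \<subseteq> S" "product_rel (\<kappa> k) (Id_on (space M2)) \<subseteq> S"
        using d1(4)[of k] d2(4)[of l] measured_equiv_relD(3)[OF mer1] measured_equiv_relD(3)[OF mer2]
        by (auto simp: product_rel_def)
      then have "(u, w) \<in> S" using u v(2) S_trans by blast
      then show ?thesis by (rule ZI[OF u(1)])
    qed
  qed
  have im: "product_rel (\<kappa> k) (Id_on (space M2)) `` (product_rel (Id_on (space M1)) (\<mu> l) `` Z) \<in> null_sets N" for k l
  proof -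
    let ?Z' = "product_rel (Id_on (space M1)) (\<mu> l) `` Z"
    have Z': "?Z' \<in> sets N"
      by (rule pbijD(4)[OF pbij_prod[OF pbij_Id_on d2(3)]]) (use Z in auto)
    have "emeasure N ?Z' = 0"
      using emeasure_prod_image_le2[OF d2(3,4) II2 null_setsD2[OF Z]] Z by auto
    moreover have "product_rel (\<kappa> k) (Id_on (space M2)) `` ?Z' \<in> sets N"
      by (rule pbijD(4)[OF pbij_prod[OF d1(3) pbij_Id_on] Z']) simp
    moreover have "emeasure N (product_rel (\<kappa> k) (Id_on (space M2)) `` ?Z') \<le> emeasure N ?Z'"
      by (rule emeasure_prod_image_le1[OF d1(3,4) II1 Z'])
    ultimately show ?thesis by (auto simp: null_sets_def)
  qed
  have "emeasure N (N1 \<times> space M2) = 0" "emeasure N (space M1 \<times> N2) = 0"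
    "N1 \<times> space M2 \<in> sets N" "space M1 \<times> N2 \<in> sets N"
    using null_setsD1[OF d1(1)] null_setsD1[OF d2(1)] null_setsD2[OF d1(1)] null_setsD2[OF d2(1)]
    by (simp_all add: M2.emeasure_pair_measure_Times)
  then have n: "N1 \<times> space M2 \<in> null_sets N" "space M1 \<times> N2 \<in> null_sets N" by (simp_all only: null_setsI)
  have "(\<Union>k. \<Union>l. product_rel (\<kappa> k) (Id_on (space M2)) `` (product_rel (Id_on (space M1)) (\<mu> l) `` Z)) \<in> null_sets N"
    by (rule null_sets_UN, rule null_sets_UN, rule im)
  from null_sets.Un[OF null_sets.Un[OF n] this] show "Y \<in> null_sets N" unfolding Y_def .
qed

end

section \<open>Generating the relation from lifted frames\<close>

lemma sum_Un_le:
  fixes f :: "'a \<Rightarrow> ennreal"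
  assumes "finite A" "finite B"
  shows "sum f (A \<union> B) \<le> sum f A + sum f B"
  using sum.union_inter[OF assms, of f] by (metis le_iff_add)

lemma sum_image_bounded:
  fixes f :: "'a \<Rightarrow> ennreal"
  assumes "finite I" "\<And>i. i \<in> I \<Longrightarrow> f (g i) \<le> c"
  shows "sum f (g ` I) \<le> of_nat (card I) * c"
proof -
  have "sum f (g ` I) \<le> sum (f \<circ> g) I" using assms(1) by (intro sum_image_le) auto
  also have "\<dots> \<le> of_nat (card I) * c" using assms(2) by (intro sum_bounded_above) auto
  finally show ?thesis .
qed

context product_decomposition
begin

abbreviation pull :: "(('b \<times> 'c) \<times> ('b \<times> 'c)) set \<Rightarrow> ('a \<times> 'a) set" where
  "pull P \<equiv> F O P O F\<inverse>"

lemma pull_pbij: "pbij N N P \<Longrightarrow> pbij M M (pull P)"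
  by (rule pbij_comp[OF F pbij_comp[OF _ pbij_converse[OF F]]])

lemma pullI: "(x, u) \<in> F \<Longrightarrow> (u, v) \<in> P \<Longrightarrow> (y, v) \<in> F \<Longrightarrow> (x, y) \<in> pull P"
  by blast

lemma pull_subset:
  assumes "P \<subseteq> S"
  shows "pull P \<subseteq> R"
proof (rule subrelI)
  fix x y assume "(x, y) \<in> pull P"
  then obtain u v where "(x, u) \<in> F" "(u, v) \<in> P" "(y, v) \<in> F" by auto
  then show "(x, y) \<in> R" using F_rel assms by blast
qed

lemma pull_Domain_le:
  assumes "D \<in> sets N" "Domain P \<subseteq> D"
  shows "emeasure M (Domain (pull P)) \<le> emeasure N D"
proof -
  have "Domain (pull P) \<subseteq> F\<inverse> `` D" using assms(2) by auto
  then have "emeasure M (Domain (pull P)) \<le> emeasure M (F\<inverse> `` D)"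
    using pbijD(5)[OF F assms(1)] by (rule emeasure_mono)
  then show ?thesis using F_vimage_measure[OF assms(1)] by simp
qed

lemma product_rel_mono: "P \<subseteq> R1 \<Longrightarrow> Q \<subseteq> R2 \<Longrightarrow> product_rel P Q \<subseteq> S"
  unfolding product_rel_def by auto

text \<open>Almost every pair of \<open>q\<close> is carried by \<open>F\<close> to a pair in some
  product of a \<open>\<kappa> k\<close> with a \<open>\<mu> l\<close>. The domains of what remains
  therefore decrease to a null set, and continuity from above applies to the finite measure.\<close>

lemma approximate_by_products:
  assumes c1: "covered_by M1 R1 \<kappa> N1" and c2: "covered_by M2 R2 \<mu> N2"
    and Q: "finite Q" "\<And>q. q \<in> Q \<Longrightarrow> pbij M M q \<and> q \<subseteq> R" and e: "\<epsilon> > 0"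
  shows "\<exists>m. (\<Sum>q\<in>Q. emeasure M (Domain (q - (\<Union>k<m. \<Union>l<m. pull (product_rel (\<kappa> k) (\<mu> l)))))) < \<epsilon>"
proof -
  note d1 = covered_byD[OF c1] and d2 = covered_byD[OF c2]
  define T where "T k l = pull (product_rel (\<kappa> k) (\<mu> l))" for k l
  define U where "U m = (\<Union>k<m. \<Union>l<m. T k l)" for m
  have T: "pbij M M (T k l)" for k l unfolding T_def by (intro pull_pbij pbij_prod d1(3) d2(3))
  have Ueq: "U m = \<Union>((\<lambda>(k, l). T k l) ` ({..<m} \<times> {..<m}))" for m unfolding U_def by auto
  have Uq: "pbij M M (q - U m)" if "q \<in> Q" for q m
    unfolding Ueq by (rule pbij_Diff_Union[OF sep]) (use Q(2)[OF that] T in auto)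
  have lim: "(\<lambda>m. emeasure M (Domain (q - U m))) \<longlonglongrightarrow> 0" if q: "q \<in> Q" for q
  proof -
    note qp = conjunct1[OF Q(2)[OF q]] and qR = conjunct2[OF Q(2)[OF q]]
    let ?D = "\<lambda>m. Domain (q - U m)"
    have "U m \<subseteq> U m'" if "m \<le> m'" for m m' using that unfolding U_def by fastforce
    then have "decseq ?D" unfolding decseq_def by blast
    moreover have sets: "range ?D \<subseteq> sets M" using pbij_Domain[OF Uq[OF q]] by auto
    ultimately have "(\<lambda>m. emeasure M (?D m)) \<longlonglongrightarrow> emeasure M (\<Inter>m. ?D m)"
      by (intro Lim_emeasure_decseq) auto
    moreover have "(\<Inter>m. ?D m) \<in> null_sets M"
    proof (rule null_sets_subset)
      let ?Z = "(space M - Domain F) \<union> q\<inverse> `` (space M - Domain F) \<union> F\<inverse> `` (N1 \<times> space M2 \<union> space M1 \<times> N2)"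
      have "emeasure N (N1 \<times> space M2) = 0" "emeasure N (space M1 \<times> N2) = 0"
        "N1 \<times> space M2 \<in> sets N" "space M1 \<times> N2 \<in> sets N"
        using null_setsD1[OF d1(1)] null_setsD1[OF d2(1)] null_setsD2[OF d1(1)] null_setsD2[OF d2(1)]
        by (simp_all add: M2.emeasure_pair_measure_Times)
      then have n: "N1 \<times> space M2 \<union> space M1 \<times> N2 \<in> null_sets N"
        by (intro null_sets.Un) (simp_all only: null_setsI)
      have "q\<inverse> `` (space M - Domain F) \<in> null_sets M"
      proof -
        have "q\<inverse> \<subseteq> R" using qR measured_equiv_relD(4)[OF mer] by auto
        from type_II1_image_le[OF II pbij_converse[OF qp] this null_setsD2[OF F_Domain]]
        have "emeasure M (q\<inverse> `` (space M - Domain F)) = 0" using null_setsD1[OF F_Domain] by simp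
        then show ?thesis using pbijD(5)[OF qp null_setsD2[OF F_Domain]] by (rule null_setsI)
      qed
      then show "?Z \<in> null_sets M" by (intro null_sets.Un F_Domain F_vimage_null n)
      show "(\<Inter>m. ?D m) \<in> sets M" using sets by auto
      show "(\<Inter>m. ?D m) \<subseteq> ?Z"
      proof
        fix x assume x: "x \<in> (\<Inter>m. ?D m)"
        then obtain y where y: "(x, y) \<in> q" by auto
        \<comment> \<open>As \<open>q\<close> is single-valued, it is the same pair that is left
          over at every stage.\<close>
        have nU: "(x, y) \<notin> U m" for m
        proof -
          have "x \<in> ?D m" using x by blast
          then obtain y' where "(x, y') \<in> q - U m" by auto
          then show ?thesis using pbijD(2)[OF qp y] by blast
        qed
        show "x \<in> ?Z"
        proof (rule ccontr)
          assume n: "x \<notin> ?Z"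
          have sp: "x \<in> space M" "y \<in> space M" using pbijD(6,7)[OF qp y] .
          have "x \<in> Domain F" using n sp by blast
          moreover have "y \<in> Domain F" using n sp y by blast
          ultimately obtain u v where uv: "(x, u) \<in> F" "(y, v) \<in> F" by auto
          have "(u, v) \<in> S" using F_rel[OF uv] qR y by auto
          then obtain u1 u2 v1 v2 where e: "u = (u1, u2)" "v = (v1, v2)" "(u1, v1) \<in> R1" "(u2, v2) \<in> R2"
            unfolding product_rel_def by auto
          have "u \<in> space N" using pbijD(7)[OF F uv(1)] .
          then have "u1 \<notin> N1" "u2 \<notin> N2" using n uv(1) e(1) by (auto simp: space_pair_measure)
          then obtain k l where "(u1, v1) \<in> \<kappa> k" "(u2, v2) \<in> \<mu> l" using d1(5) d2(5) e by metis
          then have "(x, y) \<in> T k l" unfolding T_def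
            by (intro pullI[OF uv(1) _ uv(2)]) (simp add: e product_rel_iff)
          then have "(x, y) \<in> U (Suc (max k l))" unfolding U_def
            by (intro UN_I[of k] UN_I[of l]) auto
          then show False using nU by simp
        qed
      qed
    qed
    ultimately show ?thesis by (simp add: null_setsD1)
  qed
  have "(\<lambda>m. \<Sum>q\<in>Q. emeasure M (Domain (q - U m))) \<longlonglongrightarrow> (\<Sum>q\<in>Q. 0)"
    by (intro tendsto_sum lim)
  then have "(\<lambda>m. \<Sum>q\<in>Q. emeasure M (Domain (q - U m))) \<longlonglongrightarrow> 0" by simp
  from order_tendstoD(2)[OF this e] obtain m where "(\<Sum>q\<in>Q. emeasure M (Domain (q - U m))) < \<epsilon>"
    by (auto dest: eventually_happens'[OF sequentially_bot])
  then show ?thesis unfolding U_def T_def by blast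
qed

text \<open>Cutting with the complement of \<open>Y\<close> preserves the frame because
  \<open>Y\<close> is saturated: a base point off \<open>Y\<close> has all its images off
  \<open>Y\<close>. As \<open>Y\<close> also contains the points without preimage, nothing is lost
  on the way back to \<open>M\<close>, and all the lifted maps keep one common domain.\<close>

lemma frame_lift:
  assumes fr: "frame M1 R1 n \<Psi> B" and Y: "Y \<in> null_sets N" "S `` Y \<subseteq> Y" "space N - Range F \<subseteq> Y"
    "(space M1 - (\<Union>i<n. Range (\<Psi> i))) \<times> space M2 \<subseteq> Y"
  shows "frame M R n (\<lambda>i. pull (product_rel (\<Psi> i) (Id_on (space M2)) \<inter> (space N - Y) \<times> (space N - Y)))
    (F\<inverse> `` (B \<times> space M2 \<inter> (space N - Y)))" (is "frame M R n ?\<Phi> ?B")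
proof -
  let ?X = "space N - Y"
  let ?P = "\<lambda>i. product_rel (\<Psi> i) (Id_on (space M2)) \<inter> ?X \<times> ?X"
  have X: "?X \<in> sets N" using Y(1) by auto
  have XF: "u \<in> Range F" if "u \<in> ?X" for u using Y(3) that by auto
  have XS: "v \<in> ?X" if "(u, v) \<in> S" "u \<in> ?X" for u v
    using Y(2) S_sym[OF that(1)] that(2) S_space[OF S_sym[OF that(1)]] by auto
  note pb = frame_pbij[OF fr] and sub = frame_sub[OF fr] and dom = frame_Domain[OF fr] and disj = frame_disj[OF fr]
  have PS: "product_rel (\<Psi> i) (Id_on (space M2)) \<subseteq> S" if "i < n" for i
    using sub[OF that] measured_equiv_relD(3)[OF mer2] by (intro product_rel_mono) auto
  have pb': "pbij N N (?P i)" if "i < n" for i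
    by (intro pbij_restrict pbij_prod pb that pbij_Id_on X) simp
  show ?thesis unfolding frame_def
  proof (intro conjI allI impI)
    show "0 < n" by (rule frame_pos[OF fr])
    fix i assume i: "i < n"
    show "pbij M M (?\<Phi> i)" by (rule pull_pbij[OF pb'[OF i]])
    show "?\<Phi> i \<subseteq> R" by (rule pull_subset) (use PS[OF i] in auto)
    show "Domain (?\<Phi> i) = ?B"
    proof (intro Set.set_eqI iffI)
      fix x assume "x \<in> Domain (?\<Phi> i)"
      then obtain u v where uv: "(x, u) \<in> F" "(u, v) \<in> ?P i" by blast
      then have "u \<in> B \<times> space M2" using dom[OF i] by (cases u, cases v) (auto simp: product_rel_iff)
      then show "x \<in> ?B" using uv by blast
    next
      fix x assume "x \<in> ?B"
      then obtain b w where u: "(x, (b, w)) \<in> F" "b \<in> B" "w \<in> space M2" "(b, w) \<in> ?X" by auto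
      obtain c where c: "(b, c) \<in> \<Psi> i" using dom[OF i] u(2) by auto
      have P: "((b, w), (c, w)) \<in> product_rel (\<Psi> i) (Id_on (space M2))"
        using c u(3) by (simp add: product_rel_iff Id_on_iff)
      have cX: "(c, w) \<in> ?X" using XS[OF _ u(4)] PS[OF i] P by blast
      then obtain y where "(y, (c, w)) \<in> F" using XF by blast
      then show "x \<in> Domain (?\<Phi> i)" using u(1,4) P cX by blast
    qed
  next
    fix i j assume ij: "i < n" "j < n" "i \<noteq> j"
    show "Range (?\<Phi> i) \<inter> Range (?\<Phi> j) = {}"
    proof (rule ccontr)
      assume "\<not> ?thesis"
      then obtain y where y: "y \<in> Range (?\<Phi> i)" "y \<in> Range (?\<Phi> j)" by blast
      obtain u v where v: "(y, v) \<in> F" "(u, v) \<in> product_rel (\<Psi> i) (Id_on (space M2))" using y(1) by blast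
      obtain u' v' where v': "(y, v') \<in> F" "(u', v') \<in> product_rel (\<Psi> j) (Id_on (space M2))" using y(2) by blast
      have "v = v'" by (rule pbijD(2)[OF F v(1) v'(1)])
      then have "fst v \<in> Range (\<Psi> i)" "fst v \<in> Range (\<Psi> j)"
        using v(2) v'(2) unfolding product_rel_def by auto
      then show False using disj[OF ij(1,2)] ij(3) by blast
    qed
  next
    show "space M - (\<Union>i<n. Range (?\<Phi> i)) \<in> null_sets M"
    proof (rule null_sets_subset)
      show "(space M - Domain F) \<union> F\<inverse> `` Y \<in> null_sets M"
        by (intro null_sets.Un F_Domain F_vimage_null Y(1))
      have "Range (?\<Phi> i) \<in> sets M" if "i < n" for i by (rule pbij_Range[OF pull_pbij[OF pb'[OF that]]])
      then show "space M - (\<Union>i<n. Range (?\<Phi> i)) \<in> sets M" by (intro sets.Diff sets.finite_UN) auto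
      show "space M - (\<Union>i<n. Range (?\<Phi> i)) \<subseteq> (space M - Domain F) \<union> F\<inverse> `` Y"
      proof
        fix x assume x: "x \<in> space M - (\<Union>i<n. Range (?\<Phi> i))"
        show "x \<in> (space M - Domain F) \<union> F\<inverse> `` Y"
        proof (rule ccontr)
          assume n: "\<not> ?thesis"
          then obtain u where u: "(x, u) \<in> F" "u \<notin> Y" using x by auto
          have uX: "u \<in> ?X" using u pbijD(7)[OF F u(1)] by simp
          obtain u1 w where uw: "u = (u1, w)" by (cases u)
          have sp: "u1 \<in> space M1" "w \<in> space M2" using uX uw by (auto simp: space_pair_measure)
          have "u1 \<in> (\<Union>i<n. Range (\<Psi> i))"
          proof (rule ccontr)
            assume "u1 \<notin> (\<Union>i<n. Range (\<Psi> i))"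
            then have "(u1, w) \<in> (space M1 - (\<Union>i<n. Range (\<Psi> i))) \<times> space M2" using sp by blast
            then show False using Y(4) u(2) uw by blast
          qed
          then obtain i where i: "i < n" "u1 \<in> Range (\<Psi> i)" by blast
          then obtain b where b: "(b, u1) \<in> \<Psi> i" by auto
          have P: "((b, w), u) \<in> product_rel (\<Psi> i) (Id_on (space M2))"
            using b sp uw by (simp add: product_rel_iff Id_on_iff)
          have bX: "(b, w) \<in> ?X" using XS[OF S_sym _] PS[OF i(1)] P uX by blast
          then obtain z where "(z, (b, w)) \<in> F" using XF by blast
          then have "(z, x) \<in> ?\<Phi> i" using u(1) P bX uX by blast
          then show False using x i(1) by blast
        qed
      qed
    qed
  qed
qed

text \<open>Let \<open>b\<close> and \<open>d\<close> be the base points of \<open>u1\<close> and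
  \<open>v1\<close> in the first frame, and \<open>b'\<close> that of \<open>u2\<close> in the
  second. The path runs (u1, u2), (b, u2), (b, b'), (u1, b'), (v1, b'), (d, b'), (d, u2), (d, v2),
  (v1, v2). Every change of the second coordinate takes place over \<open>B\<close>, and the map
  \<open>P\<close> is applied only over \<open>B'\<close>; all other moves belong to the first
  frame, whose relation is available everywhere off \<open>Y\<close>.\<close>

lemma generate_by_frames:
  assumes E: "trans E" "sym E"
    and Y: "S `` Y \<subseteq> Y" "space N - Range F \<subseteq> Y"
    and fr1: "frame M1 R1 n \<Psi> B" "\<Psi> 0 = Id_on B" "(space M1 - (\<Union>i<n. Range (\<Psi> i))) \<times> space M2 \<subseteq> Y"
    and fr2: "frame M2 R2 n' \<Psi>' B'" "space M1 \<times> (space M2 - (\<Union>i<n'. Range (\<Psi>' i))) \<subseteq> Y"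
    and Efr: "\<And>i j b c c' w. i < n \<Longrightarrow> j < n \<Longrightarrow> (b, c) \<in> \<Psi> i \<Longrightarrow> (b, c') \<in> \<Psi> j \<Longrightarrow>
      (c, w) \<in> space N - Y \<Longrightarrow> (c', w) \<in> space N - Y \<Longrightarrow> pull {((c, w), (c', w))} \<subseteq> E"
    and E1: "pull (product_rel (Id_on B) Q) \<subseteq> E" and E2: "\<And>i. i < n' \<Longrightarrow> pull (product_rel (Id_on B) (\<Psi>' i)) \<subseteq> E"
    and E3: "pull (product_rel P (Id_on B')) \<subseteq> E"
    and PQ: "P \<subseteq> R1" "Q \<subseteq> R2"
    and xy: "(x, u) \<in> F" "u \<notin> Y" "(u, v) \<in> product_rel P Q" "(y, v) \<in> F"
  shows "(x, y) \<in> E"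
proof -
  let ?X = "space N - Y"
  have XF: "u \<in> Range F" if "u \<in> ?X" for u using Y(2) that by auto
  have XS: "v \<in> ?X" if "(u, v) \<in> S" "u \<in> ?X" for u v
    using Y(1) S_sym[OF that(1)] that(2) S_space[OF S_sym[OF that(1)]] by auto
  \<comment> \<open>The inclusion \<open>pull {(u, v)} \<subseteq> E\<close> is vacuous at points
    without preimage under \<open>F\<close>. Requiring both points to lie off \<open>Y\<close>
    excludes this, which is what makes \<open>E'\<close> transitive.\<close>
  define E' where "E' = {(u, v). u \<in> ?X \<and> v \<in> ?X \<and> pull {(u, v)} \<subseteq> E}"
  have trE: "(u, w) \<in> E'" if uv: "(u, v) \<in> E'" and vw: "(v, w) \<in> E'" for u v w
  proof -
    obtain z where z: "(z, v) \<in> F" using XF uv unfolding E'_def by blast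
    have "(x, y) \<in> E" if "(x, u) \<in> F" "(y, w) \<in> F" for x y
    proof -
      have "(x, z) \<in> E" "(z, y) \<in> E" using uv vw z that unfolding E'_def by blast+
      then show ?thesis using E(1) by (rule transD[rotated])
    qed
    then show ?thesis using uv vw unfolding E'_def by auto
  qed
  have syE: "(v, u) \<in> E'" if "(u, v) \<in> E'" for u v
    using that E(2) unfolding E'_def by (auto dest: symD)
  obtain u1 u2 v1 v2 where e: "u = (u1, u2)" "v = (v1, v2)" "(u1, v1) \<in> P" "(u2, v2) \<in> Q"
    using xy(3) unfolding product_rel_def by auto
  have uX: "(u1, u2) \<in> ?X" using xy(1,2) e pbijD(7)[OF F] by auto
  \<comment> \<open>Each point of the path has coordinates equivalent to \<open>u1\<close> and
    \<open>u2\<close>, so saturation of \<open>Y\<close> keeps the whole path off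
    \<open>Y\<close>.\<close>
  have grid: "(a, b) \<in> ?X" if "(u1, a) \<in> R1" "(u2, b) \<in> R2" for a b
    using XS[OF _ uX] that by (simp add: product_rel_iff)
  note r1 = measured_equiv_relD[OF mer1] and r2 = measured_equiv_relD[OF mer2]
  have R: "(u1, v1) \<in> R1" "(u2, v2) \<in> R2" using e PQ by auto
  have R0: "(u1, u1) \<in> R1" "(u2, u2) \<in> R2" using r1(3,6) r2(3,6) R by blast+
  have fr_pt: "\<exists>i<n. \<exists>b\<in>B. (b, a) \<in> \<Psi> i \<and> (u1, b) \<in> R1" if a: "(u1, a) \<in> R1" for a
  proof -
    have "(a, u2) \<in> ?X" by (rule grid[OF a R0(2)])
    have "a \<in> (\<Union>i<n. Range (\<Psi> i))"
    proof (rule ccontr)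
      assume "a \<notin> (\<Union>i<n. Range (\<Psi> i))"
      then have "(a, u2) \<in> (space M1 - (\<Union>i<n. Range (\<Psi> i))) \<times> space M2"
        using \<open>(a, u2) \<in> ?X\<close> by (simp add: space_pair_measure)
      then show False using fr1(3) \<open>(a, u2) \<in> ?X\<close> by blast
    qed
    then obtain i b where "i < n" "(b, a) \<in> \<Psi> i" by blast
    moreover have "b \<in> B" using frame_Domain[OF fr1(1) \<open>i < n\<close>] \<open>(b, a) \<in> \<Psi> i\<close> by auto
    moreover have "(u1, b) \<in> R1" using frame_sub[OF fr1(1) \<open>i < n\<close>] \<open>(b, a) \<in> \<Psi> i\<close> r1(4,5) a by blast
    ultimately show ?thesis by blast
  qed
  obtain i b where b: "i < n" "b \<in> B" "(b, u1) \<in> \<Psi> i" "(u1, b) \<in> R1" using fr_pt[OF R0(1)] by blast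
  obtain j d where d: "j < n" "d \<in> B" "(d, v1) \<in> \<Psi> j" "(u1, d) \<in> R1" using fr_pt[OF R(1)] by blast
  have "u2 \<in> (\<Union>i<n'. Range (\<Psi>' i))"
  proof (rule ccontr)
    assume "u2 \<notin> (\<Union>i<n'. Range (\<Psi>' i))"
    then have "(u1, u2) \<in> space M1 \<times> (space M2 - (\<Union>i<n'. Range (\<Psi>' i)))"
      using uX by (simp add: space_pair_measure)
    then show False using fr2(2) uX by blast
  qed
  then obtain i' b' where b': "i' < n'" "(b', u2) \<in> \<Psi>' i'" by blast
  have bB': "b' \<in> B'" using frame_Domain[OF fr2(1) b'(1)] b'(2) by auto
  have Rb': "(u2, b') \<in> R2" using frame_sub[OF fr2(1) b'(1)] b'(2) r2(4) by blast
  have 0: "0 < n" by (rule frame_pos[OF fr1(1)])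
  \<comment> \<open>Index 0 is the identity of the base, so the frame relation joins a point
    directly to its base point.\<close>
  have base: "(c, c) \<in> \<Psi> 0" if "c \<in> B" for c using that fr1(2) by auto
  have s1: "((u1, u2), (b, u2)) \<in> E'"
    using grid[OF R0] grid[OF b(4) R0(2)] Efr[OF b(1) 0 b(3) base[OF b(2)]] unfolding E'_def by auto
  have s2: "((c, b'), (c, u2)) \<in> E'" if "c \<in> B" "(u1, c) \<in> R1" for c
  proof -
    have "((c, b'), (c, u2)) \<in> product_rel (Id_on B) (\<Psi>' i')" using that b' by (simp add: product_rel_iff Id_on_iff)
    then have "pull {((c, b'), (c, u2))} \<subseteq> E" using E2[OF b'(1)] by blast
    then show ?thesis using grid[OF that(2) Rb'] grid[OF that(2) R0(2)] unfolding E'_def by auto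
  qed
  have s3: "((b, b'), (u1, b')) \<in> E'"
    using grid[OF R0(1) Rb'] grid[OF b(4) Rb'] Efr[OF 0 b(1) base[OF b(2)] b(3)] unfolding E'_def by auto
  have s4: "((u1, b'), (v1, b')) \<in> E'"
  proof -
    have "((u1, b'), (v1, b')) \<in> product_rel P (Id_on B')" using bB' e by (simp add: product_rel_iff Id_on_iff)
    then have "pull {((u1, b'), (v1, b'))} \<subseteq> E" using E3 by blast
    then show ?thesis using grid[OF R0(1) Rb'] grid[OF R(1) Rb'] unfolding E'_def by auto
  qed
  have s5: "((v1, b'), (d, b')) \<in> E'"
    using grid[OF R(1) Rb'] grid[OF d(4) Rb'] Efr[OF d(1) 0 d(3) base[OF d(2)]] unfolding E'_def by auto
  have s6: "((d, u2), (d, v2)) \<in> E'"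
  proof -
    have "((d, u2), (d, v2)) \<in> product_rel (Id_on B) Q" using d e by (simp add: product_rel_iff Id_on_iff)
    then have "pull {((d, u2), (d, v2))} \<subseteq> E" using E1 by blast
    then show ?thesis using grid[OF d(4) R0(2)] grid[OF d(4) R(2)] unfolding E'_def by auto
  qed
  have s7: "((d, v2), (v1, v2)) \<in> E'"
    using grid[OF R] grid[OF d(4) R(2)] Efr[OF 0 d(1) base[OF d(2)] d(3)] unfolding E'_def by auto
  have "((u1, u2), (v1, v2)) \<in> E'"
    by (rule trE[OF s1 trE[OF syE[OF s2[OF b(2,4)]] trE[OF s3 trE[OF s4 trE[OF s5 trE[OF s2[OF d(2,4)] trE[OF s6 s7]]]]]]])
  then show ?thesis using xy(1,4) e unfolding E'_def by auto
qed

lemma pull_Domain_le1: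
  assumes B: "B \<in> sets M1" and P: "Domain P \<subseteq> B" and Q: "Domain Q \<subseteq> space M2"
  shows "emeasure M (Domain (pull (product_rel P Q))) \<le> emeasure M1 B"
proof -
  have "Domain (product_rel P Q) \<subseteq> B \<times> space M2" using P Q unfolding product_rel_def by auto
  then have "emeasure M (Domain (pull (product_rel P Q))) \<le> emeasure N (B \<times> space M2)"
    using B by (intro pull_Domain_le) auto
  then show ?thesis using B by (simp add: M2.emeasure_pair_measure_Times M2.emeasure_space_1)
qed

lemma pull_Domain_le2:
  assumes B: "B \<in> sets M2" and P: "Domain P \<subseteq> space M1" and Q: "Domain Q \<subseteq> B"
  shows "emeasure M (Domain (pull (product_rel P Q))) \<le> emeasure M2 B"
proof -
  have "Domain (product_rel P Q) \<subseteq> space M1 \<times> B" using P Q unfolding product_rel_def by auto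
  then have "emeasure M (Domain (pull (product_rel P Q))) \<le> emeasure N (space M1 \<times> B)"
    using B by (intro pull_Domain_le) auto
  then show ?thesis using B by (simp add: M2.emeasure_pair_measure_Times M1.emeasure_space_1)
qed

theorem uniform_isoperimetric_constant_zero: "uniform_isoperimetric_constant M R = 0"
proof -
  note eR = measured_equiv_relD(1)[OF mer] and e1 = measured_equiv_relD(1)[OF mer1]
    and e2 = measured_equiv_relD(1)[OF mer2]
  obtain \<kappa> N1 where c1: "covered_by M1 R1 \<kappa> N1" using covered_factors(1) by blast
  obtain \<mu> N2 where c2: "covered_by M2 R2 \<mu> N2" using covered_factors(2) by blast
  note d1 = covered_byD[OF c1] and d2 = covered_byD[OF c2]
  obtain K where K: "finite_graphing M R K" using fin_gen unfolding finitely_generated_rel_def by auto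
  then have Kg: "graphing M R K" unfolding finite_graphing_def by simp
  obtain Q where Q: "finite Q" "K = \<Union>Q" "\<And>q. q \<in> Q \<Longrightarrow> pbij M M q \<and> q \<subseteq> R"
    by (rule finite_graphing_pbij[OF K]) blast
  \<comment> \<open>The added generators cost three times \<epsilon>, rounded up to four, and the
    count of boundary edges doubles this.\<close>
  have bound: "uniform_isoperimetric_constant M R \<le> ennreal (8 * \<epsilon>)" if \<epsilon>: "\<epsilon> > 0" for \<epsilon> :: real
  proof -
    obtain m where m: "(\<Sum>q\<in>Q. emeasure M (Domain (q - (\<Union>k<m. \<Union>l<m. pull (product_rel (\<kappa> k) (\<mu> l)))))) < ennreal \<epsilon>"
      using approximate_by_products[OF c1 c2 Q(1,3), of "ennreal \<epsilon>"] \<epsilon> by auto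
    define U where "U = (\<Union>k<m. \<Union>l<m. pull (product_rel (\<kappa> k) (\<mu> l)))"
    \<comment> \<open>\<open>B'\<close> will carry the \<open>m\<close> maps \<open>P3 k\<close>;
      the summand 1 keeps the bound positive and finite when \<open>m\<close> is 0.\<close>
    obtain n' \<Psi>' B' where fr2: "frame M2 R2 n' \<Psi>' B'" "emeasure M2 B' < ennreal (\<epsilon> / (m + 1))"
      by (rule frame_exists[OF sep2 M2.prob_space_axioms e2 ergodic_factor2 na2 c2 II2, of "\<epsilon> / (m + 1)"])
        (use \<epsilon> in auto)
    \<comment> \<open>\<open>B\<close> will carry the \<open>m\<close> maps \<open>P1 l\<close> and
      the \<open>n'\<close> maps \<open>P2 i\<close>, so its size can be prescribed only now that
      \<open>n'\<close> is known.\<close>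
    obtain n \<Psi> B where fr1: "frame M1 R1 n \<Psi> B" "\<Psi> 0 = Id_on B" "emeasure M1 B < ennreal (\<epsilon> / (m + n' + 1))"
      by (rule frame_exists[OF sep1 M1.prob_space_axioms e1 ergodic_factor1 na1 c1 II1, of "\<epsilon> / (m + n' + 1)"])
        (use \<epsilon> in auto)
    note B = frame_base_sets[OF fr1(1)] and B' = frame_base_sets[OF fr2(1)]
    have Bs: "B \<subseteq> space M1" "B' \<subseteq> space M2" using B B' sets.sets_into_space by auto
    let ?r1 = "space M1 - (\<Union>i<n. Range (\<Psi> i))" and ?r2 = "space M2 - (\<Union>i<n'. Range (\<Psi>' i))"
    have "emeasure N (?r1 \<times> space M2) = 0" "emeasure N (space M1 \<times> ?r2) = 0"
      "?r1 \<times> space M2 \<in> sets N" "space M1 \<times> ?r2 \<in> sets N"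
      using null_setsD1[OF frame_null[OF fr1(1)]] null_setsD1[OF frame_null[OF fr2(1)]]
        null_setsD2[OF frame_null[OF fr1(1)]] null_setsD2[OF frame_null[OF fr2(1)]]
      by (simp_all add: M2.emeasure_pair_measure_Times)
    then have "?r1 \<times> space M2 \<in> null_sets N" "space M1 \<times> ?r2 \<in> null_sets N"
      by (simp_all only: null_setsI)
    note rn = null_sets.Un[OF F_Range null_sets.Un[OF this]]
    \<comment> \<open>One saturated null set absorbs the points without preimage and the parts of
      the product that either frame leaves uncovered.\<close>
    obtain Y where Y: "Y \<in> null_sets N" "(space N - Range F) \<union> (?r1 \<times> space M2 \<union> space M1 \<times> ?r2) \<subseteq> Y" "S `` Y \<subseteq> Y"
      by (rule product_saturation_null[OF c1 c2 rn])
    have Ysub: "space N - Range F \<subseteq> Y" "?r1 \<times> space M2 \<subseteq> Y" "space M1 \<times> ?r2 \<subseteq> Y" using Y(2) by auto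
    define \<Phi> where "\<Phi> i = pull (product_rel (\<Psi> i) (Id_on (space M2)) \<inter> (space N - Y) \<times> (space N - Y))" for i
    have fr: "frame M R n \<Phi> (F\<inverse> `` (B \<times> space M2 \<inter> (space N - Y)))"
      unfolding \<Phi>_def by (rule frame_lift[OF fr1(1) Y(1,3) Ysub(1,2)])
    define A0 where "A0 = F\<inverse> `` (space N - Y)"
    have A0: "A0 \<in> sets M" unfolding A0_def using Y(1) by (intro pbijD(5)[OF F]) auto
    have A0n: "space M - A0 \<in> null_sets M"
    proof (rule null_sets_subset)
      show "(space M - Domain F) \<union> F\<inverse> `` Y \<in> null_sets M"
        by (intro null_sets.Un F_Domain F_vimage_null Y(1))
      show "space M - A0 \<subseteq> (space M - Domain F) \<union> F\<inverse> `` Y"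
        unfolding A0_def using pbijD(7)[OF F] by blast
    qed (use A0 in auto)
    \<comment> \<open>\<open>P1\<close> and \<open>P2\<close> change the second coordinate over
      \<open>B\<close>, \<open>P3\<close> changes the first over \<open>B'\<close>, and
      \<open>P4\<close> is what the products miss of the original graphing.\<close>
    define P1 where "P1 l = pull (product_rel (Id_on B) (\<mu> l))" for l
    define P2 where "P2 i = pull (product_rel (Id_on B) (\<Psi>' i))" for i
    define P3 where "P3 k = pull (product_rel (\<kappa> k) (Id_on B'))" for k
    define P4 where "P4 q = q - U" for q :: "('a \<times> 'a) set"
    \<comment> \<open>The criterion wants \<open>K\<close> inside the generated relation at every
      point, not just almost everywhere. The part of \<open>q\<close> starting in the null set where
      the path argument fails is added separately, at cost 0.\<close>
    define P5 where "P5 q = q \<inter> (space M - A0) \<times> space M" for q :: "('a \<times> 'a) set"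
    define C where "C = P1 ` {..<m} \<union> (P2 ` {..<n'} \<union> (P3 ` {..<m} \<union> (P4 ` Q \<union> P5 ` Q)))"
    have Ids: "Id_on B \<subseteq> R1" "Id_on B' \<subseteq> R2"
      using measured_equiv_relD(3)[OF mer1] measured_equiv_relD(3)[OF mer2] Bs by auto
    have U: "U = \<Union>((\<lambda>(k, l). pull (product_rel (\<kappa> k) (\<mu> l))) ` ({..<m} \<times> {..<m}))"
      unfolding U_def by auto
    have P4: "pbij M M (P4 q)" if "q \<in> Q" for q
      unfolding P4_def U using Q(3)[OF that]
      by (intro pbij_Diff_Union[OF sep]) (auto intro!: pull_pbij pbij_prod d1(3) d2(3))
    have C: "pbij M M c \<and> c \<subseteq> R" if "c \<in> C" for c
    proof -
      have 1: "pbij M M (P1 l) \<and> P1 l \<subseteq> R" for l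
        unfolding P1_def by (intro conjI pull_pbij pull_subset pbij_prod product_rel_mono d2(3,4) pbij_Id_on B Ids)
      have 2: "pbij M M (P2 i) \<and> P2 i \<subseteq> R" if "i < n'" for i
        unfolding P2_def by (intro conjI pull_pbij pull_subset pbij_prod product_rel_mono
            frame_pbij[OF fr2(1) that] frame_sub[OF fr2(1) that] pbij_Id_on B Ids)
      have 3: "pbij M M (P3 k) \<and> P3 k \<subseteq> R" for k
        unfolding P3_def by (intro conjI pull_pbij pull_subset pbij_prod product_rel_mono d1(3,4) pbij_Id_on B' Ids)
      have 4: "pbij M M (P4 q) \<and> P4 q \<subseteq> R" if "q \<in> Q" for q
        using P4[OF that] Q(3)[OF that] unfolding P4_def by auto
      have 5: "pbij M M (P5 q) \<and> P5 q \<subseteq> R" if "q \<in> Q" for q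
        using Q(3)[OF that] A0 unfolding P5_def by (auto intro: pbij_restrict)
      from that consider l where "c = P1 l" | i where "i < n'" "c = P2 i" | k where "c = P3 k"
        | q where "q \<in> Q" "c = P4 q" | q where "q \<in> Q" "c = P5 q"
        unfolding C_def by blast
      then show ?thesis by cases (simp_all add: 1 2 3 4 5)
    qed
    have finC: "finite C" unfolding C_def using Q(1) by simp
    let ?f = "\<lambda>c. emeasure M (Domain c)"
    have t1: "sum ?f (P1 ` {..<m}) + sum ?f (P2 ` {..<n'}) \<le> ennreal \<epsilon>"
    proof -
      have s: "sum ?f (P1 ` {..<m}) \<le> of_nat m * emeasure M1 B"
      proof -
        have "?f (P1 l) \<le> emeasure M1 B" for l
          unfolding P1_def by (rule pull_Domain_le1[OF B]) (use pbijD(6)[OF d2(3)] in auto)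
        then show ?thesis using sum_image_bounded[of "{..<m}" ?f P1 "emeasure M1 B"] by simp
      qed
      have s': "sum ?f (P2 ` {..<n'}) \<le> of_nat n' * emeasure M1 B"
      proof -
        have "?f (P2 i) \<le> emeasure M1 B" if "i < n'" for i
          unfolding P2_def by (rule pull_Domain_le1[OF B]) (use pbijD(6)[OF frame_pbij[OF fr2(1) \<open>i < n'\<close>]] in auto)
        then show ?thesis using sum_image_bounded[of "{..<n'}" ?f P2 "emeasure M1 B"] by simp
      qed
      have "of_nat m * emeasure M1 B + of_nat n' * emeasure M1 B = of_nat (m + n') * emeasure M1 B"
        by (simp add: distrib_right)
      also have "\<dots> \<le> of_nat (m + n') * ennreal (\<epsilon> / (m + n' + 1))"
        using fr1(3) by (intro mult_left_mono) auto
      also have "\<dots> = ennreal (real (m + n') * (\<epsilon> / (m + n' + 1)))"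
        unfolding ennreal_of_nat_eq_real_of_nat using \<epsilon> by (subst ennreal_mult[symmetric]) simp_all
      also have "\<dots> \<le> ennreal \<epsilon>"
        using \<epsilon> by (intro ennreal_leI) (simp add: field_simps)
      finally show ?thesis using add_mono[OF s s'] by (rule order_trans[rotated])
    qed
    have t3: "sum ?f (P3 ` {..<m}) \<le> ennreal \<epsilon>"
    proof -
      have "sum ?f (P3 ` {..<m}) \<le> of_nat m * emeasure M2 B'"
      proof -
        have "?f (P3 k) \<le> emeasure M2 B'" for k
          unfolding P3_def by (rule pull_Domain_le2[OF B']) (use pbijD(6)[OF d1(3)] in auto)
        then show ?thesis using sum_image_bounded[of "{..<m}" ?f P3 "emeasure M2 B'"] by simp
      qed
      also have "\<dots> \<le> of_nat m * ennreal (\<epsilon> / (m + 1))"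
        using fr2(2) by (intro mult_left_mono) auto
      also have "\<dots> = ennreal (real m * (\<epsilon> / (m + 1)))"
        unfolding ennreal_of_nat_eq_real_of_nat using \<epsilon> by (subst ennreal_mult[symmetric]) simp_all
      also have "\<dots> \<le> ennreal \<epsilon>"
        using \<epsilon> by (intro ennreal_leI) (simp add: field_simps)
      finally show ?thesis .
    qed
    have t4: "sum ?f (P4 ` Q) \<le> ennreal \<epsilon>"
    proof -
      have "sum ?f (P4 ` Q) \<le> sum (?f \<circ> P4) Q" using Q(1) by (intro sum_image_le) auto
      also have "\<dots> \<le> ennreal \<epsilon>" using m unfolding P4_def U_def by (simp add: less_imp_le)
      finally show ?thesis .
    qed
    have t5: "sum ?f (P5 ` Q) \<le> 0"
    proof -
      have "?f (P5 q) \<le> 0" for q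
      proof -
        have "?f (P5 q) \<le> emeasure M (space M - A0)"
          unfolding P5_def using A0 by (intro emeasure_mono) auto
        then show ?thesis using A0n by auto
      qed
      then show ?thesis using sum_image_bounded[of Q ?f P5 0] Q(1) by simp
    qed
    have "sum ?f C \<le> sum ?f (P1 ` {..<m}) + (sum ?f (P2 ` {..<n'}) + (sum ?f (P3 ` {..<m}) + (sum ?f (P4 ` Q) + sum ?f (P5 ` Q))))"
      unfolding C_def using Q(1)
      by (intro order_trans[OF sum_Un_le] add_left_mono) auto
    also have "\<dots> = (sum ?f (P1 ` {..<m}) + sum ?f (P2 ` {..<n'})) + (sum ?f (P3 ` {..<m}) + (sum ?f (P4 ` Q) + sum ?f (P5 ` Q)))"
      by (simp add: add.assoc)
    also have "\<dots> \<le> ennreal \<epsilon> + (ennreal \<epsilon> + (ennreal \<epsilon> + 0))"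
      by (intro add_mono t1 t3 t4 t5)
    also have "\<dots> \<le> ennreal (4 * \<epsilon>)"
      using \<epsilon> by (simp flip: ennreal_plus)
    finally have total: "sum ?f C \<le> ennreal (4 * \<epsilon>)" .
    define E where "E = (frame_rel n \<Phi> \<union> \<Union>C \<union> (frame_rel n \<Phi> \<union> \<Union>C)\<inverse>)\<^sup>*"
    have E: "trans E" "sym E" unfolding E_def by (rule trans_rtrancl, intro sym_rtrancl sym_Un_converse)
    have CE: "c \<subseteq> E" if "c \<in> C" for c unfolding E_def using that by blast
    have FE: "frame_rel n \<Phi> \<subseteq> E" unfolding E_def by blast
    have "K \<subseteq> E"
    proof (rule subrelI)
      fix x y assume "(x, y) \<in> K"
      then obtain q where q: "q \<in> Q" "(x, y) \<in> q" using Q(2) by auto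
      show "(x, y) \<in> E"
      proof (cases "x \<in> A0 \<and> (x, y) \<in> U")
        case False
        have sp: "x \<in> space M" "y \<in> space M" using pbijD(6,7)[OF conjunct1[OF Q(3)[OF q(1)]] q(2)] .
        have "(x, y) \<in> P4 q \<or> (x, y) \<in> P5 q" using False q(2) sp unfolding P4_def P5_def by blast
        moreover have "P4 q \<in> C" "P5 q \<in> C" using q(1) unfolding C_def by auto
        ultimately show ?thesis using CE by blast
      next
        case True
        then obtain k l where kl: "k < m" "l < m" "(x, y) \<in> pull (product_rel (\<kappa> k) (\<mu> l))" unfolding U_def by blast
        obtain u v where uv: "(x, u) \<in> F" "(u, v) \<in> product_rel (\<kappa> k) (\<mu> l)" "(y, v) \<in> F" using kl(3) by blast
        have "u \<notin> Y"
        proof -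
          obtain u' where "(x, u') \<in> F" "u' \<in> space N - Y" using True unfolding A0_def by auto
          then show ?thesis using pbijD(2)[OF F uv(1)] by auto
        qed
        show ?thesis
        proof (rule generate_by_frames[OF E Y(3) Ysub(1) fr1(1,2) Ysub(2) fr2(1) Ysub(3) _ _ _ _ d1(4) d2(4) uv(1) \<open>u \<notin> Y\<close> uv(2,3)])
          show "pull (product_rel (Id_on B) (\<mu> l)) \<subseteq> E"
            using CE[of "P1 l"] kl(2) unfolding C_def P1_def by blast
          show "pull (product_rel (Id_on B) (\<Psi>' i)) \<subseteq> E" if "i < n'" for i
            using CE[of "P2 i"] that unfolding C_def P2_def by blast
          show "pull (product_rel (\<kappa> k) (Id_on B')) \<subseteq> E"
            using CE[of "P3 k"] kl(1) unfolding C_def P3_def by blast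
          \<comment> \<open>Both points are images of \<open>(b, w)\<close>, which by saturation
            lies off \<open>Y\<close> and hence has a preimage under \<open>F\<close>; through it
            the lifted frame joins them.\<close>
          fix i j b c c' w
          assume h: "i < n" "j < n" "(b, c) \<in> \<Psi> i" "(b, c') \<in> \<Psi> j" "(c, w) \<in> space N - Y" "(c', w) \<in> space N - Y"
          have w: "w \<in> space M2" using h(5) by (simp add: space_pair_measure)
          have S1: "((c, w), (b, w)) \<in> S"
            using frame_sub[OF fr1(1) h(1)] h(3) measured_equiv_relD(4)[OF mer1] measured_equiv_relD(3)[OF mer2 w]
            by (auto simp: product_rel_iff)
          have bX: "(b, w) \<in> space N - Y"
            using Y(3) S_sym[OF S1] h(5) S_space[OF S_sym[OF S1]] by blast
          then obtain z where z: "(z, (b, w)) \<in> F" using Ysub(1) by blast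
          have "(x', y') \<in> frame_rel n \<Phi>" if "(x', (c, w)) \<in> F" "(y', (c', w)) \<in> F" for x' y'
          proof -
            have "(z, x') \<in> \<Phi> i" unfolding \<Phi>_def
              by (rule pullI[OF z _ that(1)]) (use h bX w in \<open>simp add: product_rel_iff Id_on_iff\<close>)
            moreover have "(z, y') \<in> \<Phi> j" unfolding \<Phi>_def
              by (rule pullI[OF z _ that(2)]) (use h bX w in \<open>simp add: product_rel_iff Id_on_iff\<close>)
            ultimately show ?thesis unfolding frame_rel_def using h(1,2) by blast
          qed
          then show "pull {((c, w), (c', w))} \<subseteq> E" using FE by blast
        qed
      qed
    qed
    then have "uniform_isoperimetric_constant M R \<le> 2 * sum ?f C"
      unfolding E_def by (intro isoperimetric_criterion[OF sep eR II fr finC C Kg])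
    also have "\<dots> \<le> 2 * ennreal (4 * \<epsilon>)" by (intro mult_left_mono total) simp
    also have "\<dots> = ennreal (8 * \<epsilon>)"
      using \<epsilon> ennreal_mult[of 2 "4 * \<epsilon>"] by simp
    finally show ?thesis .
  qed
  have "uniform_isoperimetric_constant M R \<le> 0"
  proof (rule ennreal_le_epsilon)
    fix \<epsilon> :: real assume "\<epsilon> > 0"
    then show "uniform_isoperimetric_constant M R \<le> 0 + ennreal \<epsilon>"
      using bound[of "\<epsilon> / 8"] by simp
  qed
  then show ?thesis by simp
qed

end

section \<open>Measure-preserving actions\<close>

lemma product_uniform_isoperimetric_constant:
  assumes M: "standard_nonatomic_prob M" "measured_equiv_rel M R" "finitely_generated_rel M R"
      "ergodic_rel M R" "type_II1 M R"
    and dec: "decomposes_as_product M R M1 R1 M2 R2"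
  shows "uniform_isoperimetric_constant M R = 0"
proof -
  have d: "standard_nonatomic_prob M1" "measured_equiv_rel M1 R1" "type_II1 M1 R1"
    "standard_nonatomic_prob M2" "measured_equiv_rel M2 R2" "type_II1 M2 R2"
    "isomorphic_rel M R (M1 \<Otimes>\<^sub>M M2) (product_rel R1 R2)"
    using dec unfolding decomposes_as_product_def by auto
  obtain A B f where f: "bimeasurable_bij M A (M1 \<Otimes>\<^sub>M M2) B f"
    "space M - A \<in> null_sets M" "space (M1 \<Otimes>\<^sub>M M2) - B \<in> null_sets (M1 \<Otimes>\<^sub>M M2)"
    "\<forall>C\<in>sets M. C \<subseteq> A \<longrightarrow> emeasure (M1 \<Otimes>\<^sub>M M2) (f ` C) = emeasure M C"
    "\<forall>x\<in>A. \<forall>y\<in>A. (x, y) \<in> R \<longleftrightarrow> (f x, f y) \<in> product_rel R1 R2"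
    using d(7) unfolding isomorphic_rel_def by (elim exE conjE)
  have dom: "Domain (graph_on A f) = A" and ran: "Range (graph_on A f) = B"
    using f(1) unfolding graph_on_def bimeasurable_bij_def bij_betw_def by auto
  have img: "graph_on A f `` C = f ` C" if "C \<subseteq> A" for C
    using that unfolding graph_on_def by auto
  interpret M: prob_space M using M(1) unfolding standard_nonatomic_prob_def by simp
  interpret M1: prob_space M1 using d(1) unfolding standard_nonatomic_prob_def by simp
  interpret M2: prob_space M2 using d(4) unfolding standard_nonatomic_prob_def by simp
  interpret pair_prob_space M1 M2 ..
  interpret product_decomposition M1 M2 M R R1 R2 "graph_on A f"
  proof unfold_locales
    show "pbij M (M1 \<Otimes>\<^sub>M M2) (graph_on A f)" by (rule bimeasurable_bij_imp_pbij[OF f(1)])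
    show "emeasure (M1 \<Otimes>\<^sub>M M2) (graph_on A f `` C) = emeasure M C"
      if "C \<in> sets M" "C \<subseteq> Domain (graph_on A f)" for C
      using that f(4) img unfolding dom by simp
    show "(x, y) \<in> R \<longleftrightarrow> (u, v) \<in> product_rel R1 R2"
      if "(x, u) \<in> graph_on A f" "(y, v) \<in> graph_on A f" for x y u v
      using that f(5) unfolding graph_on_def by auto
  qed (use M d f in \<open>simp_all add: standard_nonatomic_prob_def standard_borel_separated dom ran\<close>)
  show ?thesis by (rule uniform_isoperimetric_constant_zero)
qed

text \<open>Bijectivity is automatic, since the inverse element supplies a two-sided inverse map.
  Extensionality has to be supplied because the maps in \<open>BijGroup\<close> are normalised
  outside their domain.\<close>

lemma group_actionI:
  assumes G: "group G" and cl: "\<And>g x. g \<in> carrier G \<Longrightarrow> x \<in> E \<Longrightarrow> \<phi> g x \<in> E"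
    and ext: "\<And>g. g \<in> carrier G \<Longrightarrow> \<phi> g \<in> extensional E"
    and one: "\<And>x. x \<in> E \<Longrightarrow> \<phi> \<one>\<^bsub>G\<^esub> x = x"
    and mult: "\<And>g h x. g \<in> carrier G \<Longrightarrow> h \<in> carrier G \<Longrightarrow> x \<in> E \<Longrightarrow> \<phi> (g \<otimes>\<^bsub>G\<^esub> h) x = \<phi> g (\<phi> h x)"
  shows "group_action G E \<phi>"
proof -
  interpret group G by fact
  have Bij: "\<phi> g \<in> Bij E" if g: "g \<in> carrier G" for g
  proof -
    have "bij_betw (\<phi> g) E E"
    proof (rule bij_betw_byWitness[where f' = "\<phi> (inv\<^bsub>G\<^esub> g)"])
      show "\<forall>x\<in>E. \<phi> (inv\<^bsub>G\<^esub> g) (\<phi> g x) = x" using mult[symmetric] one g by simp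
      show "\<forall>x\<in>E. \<phi> g (\<phi> (inv\<^bsub>G\<^esub> g) x) = x" using mult[symmetric] one g by simp
    qed (use cl g in auto)
    then show ?thesis unfolding Bij_def using ext[OF g] by simp
  qed
  show ?thesis
  proof (unfold group_action_def group_hom_def group_hom_axioms_def, intro conjI G group_BijGroup)
    show "\<phi> \<in> hom G (BijGroup E)"
    proof (rule homI)
      show "\<phi> g \<in> carrier (BijGroup E)" if "g \<in> carrier G" for g
        using Bij[OF that] by (simp add: BijGroup_def)
      fix g h assume gh: "g \<in> carrier G" "h \<in> carrier G"
      have "\<phi> (g \<otimes>\<^bsub>G\<^esub> h) = compose E (\<phi> g) (\<phi> h)"
        by (rule extensionalityI[of _ E]) (use ext gh mult in \<open>auto simp: compose_eq\<close>)
      then show "\<phi> (g \<otimes>\<^bsub>G\<^esub> h) = \<phi> g \<otimes>\<^bsub>BijGroup E\<^esub> \<phi> h"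
        using Bij gh by (simp add: BijGroup_def)
    qed
  qed
qed

locale pmp_action = group_action G "space M" \<alpha> + prob_space M
  for G :: "('g, 'r) monoid_scheme" (structure) and M :: "'a measure" and \<alpha> +
  assumes countable_G: "countable (carrier G)" and sep: "separated M"
    and meas: "\<And>g. g \<in> carrier G \<Longrightarrow> \<alpha> g \<in> measurable M M"
    and pres: "\<And>g. g \<in> carrier G \<Longrightarrow> distr M M (\<alpha> g) = M"
begin

sublocale G: group G
  using group_hom by (rule group_hom.axioms(1))

abbreviation "gr g \<equiv> graph_on (space M) (\<alpha> g)"

lemma act_inv: "g \<in> carrier G \<Longrightarrow> x \<in> space M \<Longrightarrow> \<alpha> (inv g) (\<alpha> g x) = x"
  "g \<in> carrier G \<Longrightarrow> x \<in> space M \<Longrightarrow> \<alpha> g (\<alpha> (inv g) x) = x"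
  using composition_rule[of x "inv g" g] composition_rule[of x g "inv g"] id_eq_one
  by (auto dest: fun_cong[where x=x])

lemma gr_image:
  assumes "g \<in> carrier G" "C \<subseteq> space M"
  shows "gr g `` C = \<alpha> (inv g) -` C \<inter> space M" "(gr g)\<inverse> `` C = \<alpha> g -` C \<inter> space M"
proof -
  show "(gr g)\<inverse> `` C = \<alpha> g -` C \<inter> space M" unfolding graph_on_def by auto
  show "gr g `` C = \<alpha> (inv g) -` C \<inter> space M"
  proof (intro Set.set_eqI iffI)
    fix y assume "y \<in> gr g `` C"
    then obtain x where "x \<in> C" "y = \<alpha> g x" unfolding graph_on_def by auto
    then show "y \<in> \<alpha> (inv g) -` C \<inter> space M"
      using assms act_inv(1)[OF assms(1), of x] element_image[OF assms(1), of x] by auto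
  next
    fix y assume y: "y \<in> \<alpha> (inv g) -` C \<inter> space M"
    then have "(\<alpha> (inv g) y, y) \<in> gr g"
      using assms act_inv(2)[OF assms(1), of y] unfolding graph_on_def by auto
    then show "y \<in> gr g `` C" using y by blast
  qed
qed

lemma gr_pbij:
  assumes g: "g \<in> carrier G"
  shows "pbij M M (gr g)"
proof (rule pbijI)
  show "gr g \<subseteq> space M \<times> space M" using element_image[OF g] unfolding graph_on_def by auto
  show "\<And>x y z. (x, y) \<in> gr g \<Longrightarrow> (x, z) \<in> gr g \<Longrightarrow> y = z" unfolding graph_on_def by auto
  show "x = y" if "(x, z) \<in> gr g" "(y, z) \<in> gr g" for x y z
  proof -
    have "x \<in> space M" "y \<in> space M" "\<alpha> g x = \<alpha> g y" using that unfolding graph_on_def by auto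
    then show ?thesis using act_inv(1)[OF g] by metis
  qed
  show "gr g `` C \<in> sets M" if "C \<in> sets M" for C
    using gr_image(1)[OF g sets.sets_into_space[OF that]] measurable_sets[OF meas[OF G.inv_closed[OF g]] that] by simp
  show "(gr g)\<inverse> `` C \<in> sets M" if "C \<in> sets M" for C
    using gr_image(2)[OF g sets.sets_into_space[OF that]] measurable_sets[OF meas[OF g] that] by simp
qed

lemma gr_image_measure:
  assumes g: "g \<in> carrier G" and C: "C \<in> sets M"
  shows "emeasure M (gr g `` C) = emeasure M C"
proof -
  have "emeasure M (gr g `` C) = emeasure (distr M M (\<alpha> (inv g))) C"
    using gr_image(1)[OF g sets.sets_into_space[OF C]] meas[OF G.inv_closed[OF g]] C
    by (simp add: emeasure_distr)
  then show ?thesis using pres[OF G.inv_closed[OF g]] by simp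
qed

lemma orbit_rel_UN: "orbit_rel G M \<alpha> = (\<Union>g\<in>carrier G. gr g)"
  unfolding orbit_rel_def orbit_def graph_on_def by auto

lemma orbit_rel_equiv: "equiv (space M) (orbit_rel G M \<alpha>)"
proof (rule equivI)
  show "orbit_rel G M \<alpha> \<subseteq> space M \<times> space M"
    unfolding orbit_rel_UN using pbijD(1)[OF gr_pbij] by blast
  show "refl_on (space M) (orbit_rel G M \<alpha>)"
    unfolding refl_on_def orbit_rel_def using orbit_refl by auto
  show "sym (orbit_rel G M \<alpha>)"
  proof (rule symI)
    fix x y assume "(x, y) \<in> orbit_rel G M \<alpha>"
    then obtain g where g: "g \<in> carrier G" "x \<in> space M" "y = \<alpha> g x" unfolding orbit_rel_def orbit_def by auto
    then have "x = \<alpha> (inv g) y" "y \<in> space M" using act_inv(1) element_image[OF g(1,2)] by auto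
    then show "(y, x) \<in> orbit_rel G M \<alpha>" using g(1) unfolding orbit_rel_def orbit_def by blast
  qed
  show "trans (orbit_rel G M \<alpha>)"
  proof (rule transI)
    fix x y z assume "(x, y) \<in> orbit_rel G M \<alpha>" "(y, z) \<in> orbit_rel G M \<alpha>"
    then obtain g h where g: "g \<in> carrier G" "h \<in> carrier G" "x \<in> space M" "y = \<alpha> g x" "z = \<alpha> h y"
      unfolding orbit_rel_def orbit_def by auto
    then have "z = \<alpha> (h \<otimes> g) x" using composition_rule by simp
    then show "(x, z) \<in> orbit_rel G M \<alpha>" using g unfolding orbit_rel_def orbit_def by blast
  qed
qed

lemma orbit_rel_measured: "measured_equiv_rel M (orbit_rel G M \<alpha>)"
  unfolding measured_equiv_rel_def
proof (intro conjI ballI orbit_rel_equiv)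
  show "orbit_rel G M \<alpha> \<in> sets (M \<Otimes>\<^sub>M M)"
    unfolding orbit_rel_UN using pbij_in_sets[OF sep gr_pbij] countable_G
    by (intro sets.countable_UN'') auto
  fix x assume "x \<in> space M"
  have "orbit_rel G M \<alpha> `` {x} \<subseteq> (\<lambda>g. \<alpha> g x) ` carrier G"
    unfolding orbit_rel_def orbit_def by auto
  then show "countable (orbit_rel G M \<alpha> `` {x})" using countable_G by (meson countable_image countable_subset)
next
  fix N assume N: "N \<in> null_sets M"
  have "orbit_rel G M \<alpha> `` N = (\<Union>g\<in>carrier G. gr g `` N)" unfolding orbit_rel_UN by auto
  moreover have "gr g `` N \<in> null_sets M" if "g \<in> carrier G" for g
    using gr_image_measure[OF that null_setsD2[OF N]] pbijD(4)[OF gr_pbij[OF that] null_setsD2[OF N]] N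
    by (auto simp: null_sets_def)
  ultimately show "orbit_rel G M \<alpha> `` N \<in> null_sets M"
    using countable_G by (simp add: null_sets_UN')
qed

text \<open>Countably many group elements cover the orbit relation, so the domain of a partial
  automorphism splits into countably many disjoint measurable pieces on each of which it agrees with
  a single element. Each piece keeps its measure, and injectivity keeps the images disjoint.\<close>

lemma orbit_rel_type_II1: "type_II1 M (orbit_rel G M \<alpha>)"
  unfolding type_II1_def
proof (intro allI impI ballI)
  fix A B \<phi> C
  assume pa: "partial_automorphism M (orbit_rel G M \<alpha>) A B \<phi>" and C: "C \<in> sets M" "C \<subseteq> A"
  let ?P = "graph_on A \<phi>"
  have P: "pbij M M ?P" by (rule partial_automorphism_imp_pbij[OF pa])
  have PR: "?P \<subseteq> orbit_rel G M \<alpha>" using pa unfolding partial_automorphism_def by simp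
  have ne: "carrier G \<noteq> {}" using G.one_closed by auto
  define g where "g = from_nat_into (carrier G)"
  have g: "g n \<in> carrier G" for n unfolding g_def by (rule from_nat_into[OF ne])
  define D' where "D' n = C \<inter> Domain (?P \<inter> gr (g n))" for n
  define D where "D = disjointed D'"
  have D'm: "D' n \<in> sets M" for n
    unfolding D'_def using pbij_agree[OF sep P gr_pbij[OF g]] C(1) by auto
  have Dm: "range D \<subseteq> sets M" unfolding D_def using D'm by (intro sets.range_disjointed_sets) auto
  have Dsub: "D n \<subseteq> D' n" for n unfolding D_def by (rule disjointed_subset)
  have disj: "disjoint_family D" unfolding D_def by (rule disjoint_family_disjointed)
  have UD: "(\<Union>n. D n) = C"
  proof -
    have "(\<Union>n. D' n) = C"
    proof
      show "C \<subseteq> (\<Union>n. D' n)"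
      proof
        fix x assume x: "x \<in> C"
        then have xP: "(x, \<phi> x) \<in> ?P" using C(2) unfolding graph_on_def by auto
        then obtain h where h: "h \<in> carrier G" "(x, \<phi> x) \<in> gr h" using PR unfolding orbit_rel_UN by auto
        obtain n where "g n = h" using from_nat_into_surj[OF countable_G h(1)] unfolding g_def by auto
        then have "x \<in> D' n" using x xP h(2) unfolding D'_def by auto
        then show "x \<in> (\<Union>n. D' n)" by auto
      qed
    qed (auto simp: D'_def)
    then show ?thesis unfolding D_def UN_disjointed_eq .
  qed
  have im: "?P `` D n = gr (g n) `` D n" for n
  proof -
    have "\<phi> x = \<alpha> (g n) x \<and> x \<in> A \<and> x \<in> space M" if "x \<in> D n" for x
      using that Dsub[of n] unfolding D'_def graph_on_def by auto
    then show ?thesis unfolding graph_on_def by force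
  qed
  have "\<phi> ` C = ?P `` C" using C(2) unfolding graph_on_def by auto
  also have "\<dots> = (\<Union>n. ?P `` D n)" using UD by auto
  finally have "emeasure M (\<phi> ` C) = emeasure M (\<Union>n. ?P `` D n)" by simp
  also have "\<dots> = suminf (\<lambda>n. emeasure M (?P `` D n))"
  proof (rule suminf_emeasure[symmetric])
    show "range (\<lambda>n. ?P `` D n) \<subseteq> sets M" using Dm pbijD(4)[OF P] by auto
    show "disjoint_family (\<lambda>n. ?P `` D n)"
    proof (unfold disjoint_family_on_def, intro ballI impI)
      fix m n :: nat assume "m \<noteq> n"
      then have "D m \<inter> D n = {}" using disj unfolding disjoint_family_on_def by auto
      then show "?P `` D m \<inter> ?P `` D n = {}" using pbijD(3)[OF P] by blast
    qed
  qed
  also have "\<dots> = suminf (\<lambda>n. emeasure M (D n))"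
    unfolding im using gr_image_measure[OF g] Dm by auto
  also have "\<dots> = emeasure M (\<Union>n. D n)" by (rule suminf_emeasure[OF Dm disj])
  also have "\<dots> = emeasure M C" unfolding UD ..
  finally show "emeasure M (\<phi> ` C) = emeasure M C" .
qed

lemma orbit_rel_finitely_generated:
  assumes "finitely_generated_group G"
  shows "finitely_generated_rel M (orbit_rel G M \<alpha>)"
proof -
  obtain S where S: "finite S" "S \<subseteq> carrier G" "generate G S = carrier G"
    using assms unfolding finitely_generated_group_def by auto
  let ?K = "\<Union>(gr ` S)"
  have path: "\<forall>x\<in>space M. (x, \<alpha> g x) \<in> (?K \<union> ?K\<inverse>)\<^sup>*" if "g \<in> generate G S" for g
    using that
  proof (induction g rule: generate.induct)
    case one
    have "\<alpha> \<one> x = x" if "x \<in> space M" for x using id_eq_one that by (auto dest: fun_cong[where x=x])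
    then show ?case by simp
  next
    case (incl h)
    then show ?case unfolding graph_on_def by blast
  next
    case (inv h)
    have hG: "h \<in> carrier G" using inv S(2) by auto
    show ?case
    proof
      fix x assume x: "x \<in> space M"
      have "(\<alpha> (inv h) x, x) \<in> gr h"
        unfolding graph_on_def using act_inv(2)[OF hG x] element_image[OF G.inv_closed[OF hG] x] by auto
      then have "(x, \<alpha> (inv h) x) \<in> ?K\<inverse>" using inv by blast
      then show "(x, \<alpha> (inv h) x) \<in> (?K \<union> ?K\<inverse>)\<^sup>*" by blast
    qed
  next
    case (eng h1 h2)
    have hG: "h1 \<in> carrier G" "h2 \<in> carrier G" using eng(1,2) S(3) by auto
    show ?case
    proof
      fix x assume x: "x \<in> space M"
      have "(x, \<alpha> h2 x) \<in> (?K \<union> ?K\<inverse>)\<^sup>*" using eng(4) x by auto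
      moreover have "(\<alpha> h2 x, \<alpha> h1 (\<alpha> h2 x)) \<in> (?K \<union> ?K\<inverse>)\<^sup>*"
        using eng(3) element_image[OF hG(2) x] by auto
      ultimately show "(x, \<alpha> (h1 \<otimes> h2) x) \<in> (?K \<union> ?K\<inverse>)\<^sup>*"
        using composition_rule[OF x hG] by simp
    qed
  qed
  have "finite_graphing M (orbit_rel G M \<alpha>) ?K"
  proof (rule finite_graphingI[OF sep])
    show "finite (gr ` S)" using S(1) by simp
    show "pbij M M q \<and> q \<subseteq> orbit_rel G M \<alpha>" if "q \<in> gr ` S" for q
      using that S(2) gr_pbij unfolding orbit_rel_UN by auto
    have "(x, y) \<in> (?K \<union> ?K\<inverse>)\<^sup>*" if "(x, y) \<in> orbit_rel G M \<alpha>" for x y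
      using that path S(3) unfolding orbit_rel_def orbit_def by auto
    then show "AE x in M. \<forall>y. (x, y) \<in> orbit_rel G M \<alpha> \<longrightarrow> (x, y) \<in> (?K \<union> ?K\<inverse>)\<^sup>*" by auto
  qed
  then show ?thesis unfolding finitely_generated_rel_def by auto
qed

end

section \<open>Non-atomic and standard Borel spaces, and their transport along injections\<close>

text \<open>Restrict the measure to \<open>A\<close> and push it forward by \<open>f\<close>. As
  fibres of \<open>f\<close> are null, the distribution function is continuous, so by the
  intermediate value theorem some sublevel set cuts \<open>A\<close> exactly in half.\<close>

lemma non_atomicI:
  assumes "prob_space M" and f: "f \<in> borel_measurable M"
    and null: "\<And>t::real. emeasure M (f -` {t} \<inter> space M) = 0"
  shows "non_atomic M"
  unfolding non_atomic_def
proof (intro ballI impI)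
  interpret prob_space M by fact
  fix A assume A: "A \<in> sets M" "0 < emeasure M A"
  define \<nu> where "\<nu> = distr (density M (indicator A)) borel f"
  have \<nu>: "emeasure \<nu> S = emeasure M (A \<inter> (f -` S \<inter> space M))" if "S \<in> sets borel" for S
    unfolding \<nu>_def using that f A(1)
    by (subst emeasure_distr) (auto simp: emeasure_density_const emeasure_restricted measurable_sets)
  have fin: "emeasure \<nu> (space \<nu>) \<noteq> \<infinity>"
    using \<nu>[of UNIV] by (simp add: \<nu>_def)
  interpret \<nu>: finite_borel_measure \<nu>
    by (intro finite_borel_measure.intro finite_measureI fin finite_borel_measure_axioms.intro) (simp add: \<nu>_def)
  have "measure \<nu> {t} = 0" for t
  proof -
    have "emeasure \<nu> {t} \<le> emeasure M (f -` {t} \<inter> space M)"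
      using \<nu>[of "{t}"] f by (auto intro!: emeasure_mono)
    then show ?thesis using null by (simp add: measure_def)
  qed
  then have cont: "isCont (cdf \<nu>) t" for t using \<nu>.isCont_cdf by simp
  have tot: "measure \<nu> (space \<nu>) = measure M A"
    using \<nu>[of UNIV] sets.sets_into_space[OF A(1)] by (simp add: \<nu>_def measure_def Int_absorb2)
  have pos: "0 < measure M A" using A by (simp add: emeasure_eq_measure)
  then have half: "0 < measure M A / 2" "measure M A / 2 < measure M A" by simp_all
  have "eventually (\<lambda>t. cdf \<nu> t < measure M A / 2) at_bot"
    by (rule order_tendstoD(2)[OF \<nu>.cdf_lim_at_bot half(1)])
  then obtain a where a: "cdf \<nu> a < measure M A / 2" by (auto simp: eventually_at_bot_linorder)
  have "eventually (\<lambda>t. measure M A / 2 < cdf \<nu> t) at_top"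
    by (rule order_tendstoD(1)[OF \<nu>.cdf_lim_at_top]) (simp add: tot pos)
  then obtain b where b: "\<And>t. t \<ge> b \<Longrightarrow> measure M A / 2 < cdf \<nu> t" by (auto simp: eventually_at_top_linorder)
  have "\<exists>t\<ge>a. t \<le> max a b \<and> cdf \<nu> t = measure M A / 2"
    using a b[of "max a b"] cont by (intro IVT) auto
  then obtain t where t: "cdf \<nu> t = measure M A / 2" by auto
  have m: "A \<inter> (f -` {..t} \<inter> space M) \<in> sets M" using A(1) f by auto
  have "measure M (A \<inter> (f -` {..t} \<inter> space M)) = measure M A / 2"
    using t \<nu>[of "{..t}"] by (simp add: cdf_def measure_def)
  then show "\<exists>B\<in>sets M. B \<subseteq> A \<and> 0 < emeasure M B \<and> emeasure M B < emeasure M A"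
    using m pos by (intro bexI[of _ "A \<inter> (f -` {..t} \<inter> space M)"]) (auto simp: emeasure_eq_measure ennreal_less_iff)
qed

lemma standard_borel_borel:
  fixes M :: "'a::{complete_space, second_countable_topology} measure"
  assumes "sets M = sets borel"
  shows "standard_borel M"
  unfolding standard_borel_def
proof (intro exI[of _ euclidean] conjI)
  show "completely_metrizable_space (euclidean :: 'a topology)" by (rule completely_metrizable_space_euclidean)
  obtain B :: "'a set set" where B: "countable B" "topological_basis B" using ex_countable_basis by auto
  show "second_countable (euclidean :: 'a topology)"
    unfolding second_countable_def using B topological_basis_open[OF B(2)]
    by (intro exI[of _ B]) (auto elim!: topological_basisE[OF B(2)])
  show "topspace euclidean = space M" using sets_eq_imp_space_eq[OF assms] by simp
  show "sets M = sigma_sets (topspace euclidean) {U :: 'a set. openin euclidean U}"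
    using assms by (simp add: borel_def)
qed

text \<open>The preimage algebra of the inverse map consists of the images of measurable sets, so
  the whole structure is carried along an arbitrary injection \<open>j\<close>. It is used to place
  the Bernoulli action on a set of reals, where the ergodic constant takes its infimum.\<close>

definition transport :: "'a measure \<Rightarrow> ('a \<Rightarrow> 'b) \<Rightarrow> 'b measure" where
  "transport N j = distr N (vimage_algebra (j ` space N) (inv_into (space N) j) N) j"

context
  fixes N :: "'a measure" and j :: "'a \<Rightarrow> 'b"
  assumes inj: "inj_on j (space N)"
begin

abbreviation (input) "transport_inv \<equiv> inv_into (space N) j"

lemma transport_k: "x \<in> space N \<Longrightarrow> transport_inv (j x) = x"
  using inj by simp

lemma space_transport: "space (transport N j) = j ` space N"
  unfolding transport_def by simp

lemma transport_vimage: "A \<subseteq> space N \<Longrightarrow> transport_inv -` A \<inter> j ` space N = j ` A"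
  using inj by (auto simp: inv_into_f_f)

lemma sets_transport: "sets (transport N j) = {j ` A | A. A \<in> sets N}"
proof -
  have "transport_inv \<in> j ` space N \<rightarrow> space N" using inj by auto
  then have "sets (transport N j) = {transport_inv -` A \<inter> j ` space N | A. A \<in> sets N}"
    unfolding transport_def by (simp add: sets_vimage_algebra2)
  also have "\<dots> = {j ` A | A. A \<in> sets N}"
    using transport_vimage sets.sets_into_space[of _ N] by (intro Collect_cong) metis
  finally show ?thesis .
qed

lemma transport_measurable: "j \<in> measurable N (transport N j)"
proof (rule measurableI)
  fix B assume "B \<in> sets (transport N j)"
  then obtain A where A: "B = j ` A" "A \<in> sets N" unfolding sets_transport by auto
  then have "j -` B \<inter> space N = A"
    using sets.sets_into_space[OF A(2)] inj by (auto dest: inj_onD)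
  then show "j -` B \<inter> space N \<in> sets N" using A by simp
qed (simp add: space_transport)

lemma distr_transport: "distr N (transport N j) j = transport N j"
  unfolding transport_def by (rule distr_cong) simp_all

lemma emeasure_transport:
  assumes A: "A \<in> sets N"
  shows "emeasure (transport N j) (j ` A) = emeasure N A"
proof -
  have "emeasure (transport N j) (j ` A) = emeasure (distr N (transport N j) j) (j ` A)"
    unfolding distr_transport ..
  also have "\<dots> = emeasure N (j -` (j ` A) \<inter> space N)"
    using A by (intro emeasure_distr transport_measurable) (auto simp: sets_transport)
  also have "j -` (j ` A) \<inter> space N = A"
    using sets.sets_into_space[OF A] inj by (auto dest: inj_onD)
  finally show ?thesis .
qed

lemma transport_pbij: "pbij (transport N j) N {(j x, x) | x. x \<in> space N}"
proof (rule pbijI)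
  show "{(j x, x) | x. x \<in> space N} `` C \<in> sets N" if C: "C \<in> sets (transport N j)" for C
  proof -
    obtain A where A: "C = j ` A" "A \<in> sets N" using C unfolding sets_transport by auto
    then have "{(j x, x) | x. x \<in> space N} `` C = A"
      using sets.sets_into_space[OF A(2)] inj by (auto dest: inj_onD)
    then show ?thesis using A by simp
  qed
  show "{(j x, x) | x. x \<in> space N}\<inverse> `` C \<in> sets (transport N j)" if C: "C \<in> sets N" for C
  proof -
    have "{(j x, x) | x. x \<in> space N}\<inverse> `` C = j ` C"
      using sets.sets_into_space[OF C] by auto
    then show ?thesis using C unfolding sets_transport by auto
  qed
qed (use inj in \<open>auto simp: space_transport dest: inj_onD\<close>)

lemma transport_prob: "prob_space N \<Longrightarrow> prob_space (transport N j)"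
  using emeasure_transport[OF sets.top] by (intro prob_spaceI) (simp add: space_transport prob_space.emeasure_space_1)

lemma transport_non_atomic:
  assumes "non_atomic N"
  shows "non_atomic (transport N j)"
  unfolding non_atomic_def
proof (intro ballI impI)
  fix C assume "C \<in> sets (transport N j)" "0 < emeasure (transport N j) C"
  then obtain A where A: "C = j ` A" "A \<in> sets N" "0 < emeasure N A"
    unfolding sets_transport using emeasure_transport by auto
  then obtain B where "B \<in> sets N" "B \<subseteq> A" "0 < emeasure N B" "emeasure N B < emeasure N A"
    using assms unfolding non_atomic_def by blast
  then show "\<exists>B\<in>sets (transport N j). B \<subseteq> C \<and> 0 < emeasure (transport N j) B \<and>
      emeasure (transport N j) B < emeasure (transport N j) C"
    using A emeasure_transport by (intro bexI[of _ "j ` B"]) (auto simp: sets_transport)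
qed

text \<open>The topology is carried along together with the sigma-algebra: pulled back along the
  inverse of \<open>j\<close> it makes \<open>j\<close> a homeomorphism onto its image.\<close>

lemma transport_standard_borel:
  assumes "standard_borel N"
  shows "standard_borel (transport N j)"
proof -
  obtain T where T: "completely_metrizable_space T" "second_countable T" "topspace T = space N"
    "sets N = sigma_sets (topspace T) {U. openin T U}"
    using assms unfolding standard_borel_def by auto
  define T' where "T' = pullback_topology (j ` space N) transport_inv T"
  have k: "transport_inv \<in> j ` space N \<rightarrow> space N" using inj by auto
  have op: "openin T' V \<longleftrightarrow> (\<exists>U. openin T U \<and> V = j ` U)" for V
    unfolding T'_def openin_pullback_topology
    using transport_vimage openin_subset[of T] T(3) by metis
  have top: "topspace T' = j ` space N"
    unfolding T'_def topspace_pullback_topology using k T(3) by auto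
  have "homeomorphic_map T T' j"
  proof (rule bijective_open_imp_homeomorphic_map)
    show "continuous_map T T' j"
    proof (unfold continuous_map_def, intro conjI allI impI)
      show "j \<in> topspace T \<rightarrow> topspace T'" using top T(3) by auto
      fix V assume "openin T' V"
      then obtain U where U: "openin T U" "V = j ` U" using op by auto
      then have "{x \<in> topspace T. j x \<in> V} = U"
        using openin_subset[OF U(1)] inj T(3) by (auto dest: inj_onD)
      then show "openin T {x \<in> topspace T. j x \<in> V}" using U by simp
    qed
    show "open_map T T' j" unfolding open_map_def using op by auto
  qed (use top T(3) inj in auto)
  then have hom: "T homeomorphic_space T'" by (rule homeomorphic_map_imp_homeomorphic_space)
  show ?thesis unfolding standard_borel_def
  proof (intro exI[of _ T'] conjI)
    show "completely_metrizable_space T'" using T(1) homeomorphic_completely_metrizable_space[OF hom] by simp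
    show "second_countable T'" using T(2) homeomorphic_space_second_countability[OF hom] by simp
    show "topspace T' = space (transport N j)" using top space_transport by simp
    have "sets (transport N j) = {transport_inv -` A \<inter> j ` space N | A. A \<in> sigma_sets (space N) {U. openin T U}}"
      unfolding transport_def using k T(3,4) by (simp add: sets_vimage_algebra2)
    also have "\<dots> = sigma_sets (j ` space N) {transport_inv -` A \<inter> j ` space N | A. A \<in> {U. openin T U}}"
      by (rule sigma_sets_vimage_commute[OF k])
    also have "{transport_inv -` A \<inter> j ` space N | A. A \<in> {U. openin T U}} = {V. openin T' V}"
      unfolding T'_def openin_pullback_topology by auto
    finally show "sets (transport N j) = sigma_sets (topspace T') {V. openin T' V}" using top by simp
  qed
qed

end

section \<open>Bernoulli shifts\<close>

abbreviation unif where "unif \<equiv> uniform_measure lborel {0..1::real}"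

text \<open>Coordinates are indexed by naturals rather than by group elements, so that the points
  form the Polish space of all real sequences; the group enters through an enumeration. The measure
  sits on sequences in the unit interval, but the space is the full type.\<close>

abbreviation bernoulli :: "(nat \<Rightarrow> real) measure" where
  "bernoulli \<equiv> \<Pi>\<^sub>M i\<in>UNIV. unif"

lemma prob_space_unif: "prob_space unif"
  by (rule prob_space_uniform_measure) auto

lemma unif_singleton: "emeasure unif {t} = 0"
proof -
  have "emeasure lborel ({0..1} \<inter> {t}) = 0"
    by (rule emeasure_lborel_countable) simp
  then show ?thesis by simp
qed

interpretation bernoulli: prob_space bernoulli
  by (rule prob_space_PiM) (rule prob_space_unif)

lemma restrict_UNIV: "restrict f UNIV = f"
  by (simp add: restrict_def)

lemma space_bernoulli: "space bernoulli = UNIV"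
  by (simp add: space_PiM)

lemma sets_bernoulli: "sets bernoulli = sets borel"
proof -
  have "sets bernoulli = sets (\<Pi>\<^sub>M i\<in>(UNIV::nat set). (borel :: real measure))"
    by (intro sets_PiM_cong) auto
  then show ?thesis by (simp only: sets_PiM_equal_borel)
qed

lemma standard_borel_bernoulli: "standard_borel bernoulli"
  by (rule standard_borel_borel[OF sets_bernoulli])

lemma distr_coordinate: "distr bernoulli unif (\<lambda>x. x i) = unif"
  by (rule distr_PiM_component[OF prob_space_unif]) simp

lemma non_atomic_bernoulli: "non_atomic bernoulli"
proof (rule non_atomicI[OF bernoulli.prob_space_axioms, of "\<lambda>x. x 0"])
  have m: "(\<lambda>x. x 0) \<in> measurable bernoulli unif" by (rule measurable_component_singleton) simp
  then show "(\<lambda>x. x 0) \<in> borel_measurable bernoulli" by simp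
  show "emeasure bernoulli ((\<lambda>x. x 0) -` {t} \<inter> space bernoulli) = 0" for t
  proof -
    have "emeasure bernoulli ((\<lambda>x. x 0) -` {t} \<inter> space bernoulli) = emeasure (distr bernoulli unif (\<lambda>x. x 0)) {t}"
      by (rule emeasure_distr[OF m, symmetric]) simp
    then show ?thesis unfolding distr_coordinate unif_singleton .
  qed
qed

lemma measurable_reindex: "(\<lambda>x. x \<circ> p) \<in> measurable bernoulli bernoulli"
proof -
  have "(\<lambda>x. \<lambda>i\<in>UNIV. x (p i)) \<in> measurable bernoulli bernoulli"
    by (intro measurable_restrict measurable_component_singleton) simp
  then show ?thesis by (simp only: comp_def restrict_UNIV)
qed

lemma distr_reindex:
  assumes "inj p"
  shows "distr bernoulli bernoulli (\<lambda>x. x \<circ> p) = bernoulli"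
  using distr_PiM_reindex[OF prob_space_unif assms, of UNIV] by (simp only: comp_def restrict_UNIV) simp

lemma indep_coordinates: "bernoulli.indep_vars (\<lambda>_. unif) (\<lambda>i x. x i) UNIV"
proof (subst bernoulli.indep_vars_iff_distr_eq_PiM)
  show "distr bernoulli bernoulli (\<lambda>x. \<lambda>i\<in>UNIV. x i) = Pi\<^sub>M UNIV (\<lambda>i. distr bernoulli unif (\<lambda>x. x i))"
    by (simp only: distr_coordinate restrict_UNIV) (simp add: distr_id2)
qed (simp_all add: measurable_component_singleton)

text \<open>By independence two coordinates have the product law, and the diagonal is null for it
  because single points are null. Essential freeness of the shift comes from this.\<close>

lemma coordinates_agree_null:
  assumes "i \<noteq> k"
  shows "{x. x i = x k} \<in> null_sets bernoulli"
proof -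
  interpret unif: prob_space unif by (rule prob_space_unif)
  have iv: "bernoulli.indep_var unif (\<lambda>x. x i) unif (\<lambda>x. x k)"
  proof -
    have "bernoulli.indep_var (Pi\<^sub>M {i} (\<lambda>_. unif)) (\<lambda>x. restrict (\<lambda>i. x i) {i})
        (Pi\<^sub>M {k} (\<lambda>_. unif)) (\<lambda>x. restrict (\<lambda>i. x i) {k})"
      by (rule bernoulli.indep_var_restrict[OF indep_coordinates]) (use assms in auto)
    then have "bernoulli.indep_var unif ((\<lambda>y. y i) \<circ> (\<lambda>x. restrict (\<lambda>i. x i) {i}))
        unif ((\<lambda>y. y k) \<circ> (\<lambda>x. restrict (\<lambda>i. x i) {k}))"
      by (rule bernoulli.indep_var_compose) (auto intro: measurable_component_singleton)
    then show ?thesis by (simp add: comp_def)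
  qed
  have d: "distr bernoulli unif (\<lambda>x. x i) \<Otimes>\<^sub>M distr bernoulli unif (\<lambda>x. x k) = distr bernoulli (unif \<Otimes>\<^sub>M unif) (\<lambda>x. (x i, x k))"
    using iv by (simp add: bernoulli.indep_var_distribution_eq)
  let ?D = "{p :: real \<times> real. fst p = snd p}"
  have D: "?D \<in> sets (unif \<Otimes>\<^sub>M unif)"
  proof -
    have "closed ?D" by (intro closed_Collect_eq continuous_intros)
    then have "?D \<in> sets (borel :: (real \<times> real) measure)" by simp
    moreover have "sets (unif \<Otimes>\<^sub>M unif) = sets (borel \<Otimes>\<^sub>M borel)" by (intro sets_pair_measure_cong) auto
    ultimately show ?thesis by (simp only: borel_prod)
  qed
  have "emeasure (unif \<Otimes>\<^sub>M unif) ?D = (\<integral>\<^sup>+s. emeasure unif (Pair s -` ?D) \<partial>unif)"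
    by (rule unif.emeasure_pair_measure_alt[OF D])
  also have "\<dots> = 0"
  proof -
    have "Pair s -` ?D = {s}" for s :: real by auto
    then show ?thesis using unif_singleton by simp
  qed
  finally have 0: "emeasure (distr bernoulli (unif \<Otimes>\<^sub>M unif) (\<lambda>x. (x i, x k))) ?D = 0"
    using d by (simp add: distr_coordinate)
  have m: "(\<lambda>x. (x i, x k)) \<in> measurable bernoulli (unif \<Otimes>\<^sub>M unif)" by measurable
  have eq: "(\<lambda>x. (x i, x k)) -` ?D \<inter> space bernoulli = {x. x i = x k}" by (auto simp: space_PiM)
  show ?thesis
    using emeasure_distr[OF m D] measurable_sets[OF m D] 0 unfolding eq by (metis null_setsI)
qed

section \<open>Cylinder approximation and the zero-one law\<close>

definition cyl :: "nat set \<Rightarrow> (nat \<Rightarrow> real) set \<Rightarrow> (nat \<Rightarrow> real) set" where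
  "cyl J D = {x. restrict x J \<in> D}"

lemma restrict_measurable: "(\<lambda>x. restrict x J) \<in> measurable bernoulli (\<Pi>\<^sub>M i\<in>J. unif)"
  by (rule measurable_restrict_subset) simp

lemma cyl_sets: "D \<in> sets (\<Pi>\<^sub>M i\<in>J. unif) \<Longrightarrow> cyl J D \<in> sets bernoulli"
  using measurable_sets[OF restrict_measurable] by (simp add: cyl_def vimage_def space_PiM)

text \<open>The sets that can be approximated to every precision form a sigma-algebra containing the
  basic cylinders: complementation leaves the symmetric difference unchanged, and a countable union
  is first cut to a finite one.\<close>

lemma approximate_by_cylinders:
  assumes "C \<in> sets bernoulli"
  shows "\<forall>\<epsilon>>0. \<exists>J D. finite J \<and> D \<in> sets (\<Pi>\<^sub>M i\<in>J. unif) \<and> measure bernoulli (sym_diff C (cyl J D)) < \<epsilon>"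
  using assms[unfolded sets_PiM]
proof (induction rule: sigma_sets.induct)
  case (Basic A)
  then obtain J E where J: "A = prod_emb UNIV (\<lambda>_. unif) J (Pi\<^sub>E J E)" "finite J" "\<And>i. i \<in> J \<Longrightarrow> E i \<in> sets unif"
    by (rule prod_algebraE) blast
  have "A = cyl J (Pi\<^sub>E J E)" unfolding J(1) cyl_def prod_emb_def by (auto simp: space_PiM)
  moreover have "Pi\<^sub>E J E \<in> sets (\<Pi>\<^sub>M i\<in>J. unif)" using J(2,3) by (intro sets_PiM_I_finite) auto
  ultimately show ?case using J(2) by (intro allI impI exI[of _ J] exI[of _ "Pi\<^sub>E J E"]) simp
next
  case Empty
  then show ?case by (intro allI impI exI[of _ "{}"]) (simp add: cyl_def)
next
  case (Compl A)
  show ?case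
  proof (intro allI impI)
    fix \<epsilon> :: real assume "\<epsilon> > 0"
    then obtain J D where J: "finite J" "D \<in> sets (\<Pi>\<^sub>M i\<in>J. unif)" "measure bernoulli (sym_diff A (cyl J D)) < \<epsilon>"
      using Compl by blast
    have "restrict x J \<in> space (\<Pi>\<^sub>M i\<in>J. unif)" for x by (simp add: space_PiM)
    then have "sym_diff ((\<Pi>\<^sub>E i\<in>UNIV. space unif) - A) (cyl J (space (\<Pi>\<^sub>M i\<in>J. unif) - D)) = sym_diff A (cyl J D)"
      unfolding cyl_def by auto
    then show "\<exists>J D. finite J \<and> D \<in> sets (\<Pi>\<^sub>M i\<in>J. unif) \<and>
        measure bernoulli (sym_diff ((\<Pi>\<^sub>E i\<in>UNIV. space unif) - A) (cyl J D)) < \<epsilon>"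
      using J by (intro exI[of _ J] exI[of _ "space (\<Pi>\<^sub>M i\<in>J. unif) - D"]) auto
  qed
next
  case (Union A)
  have A: "A i \<in> sets bernoulli" for i using Union(1) unfolding sets_PiM .
  show ?case
  proof (intro allI impI)
    fix \<epsilon> :: real assume \<epsilon>: "\<epsilon> > 0"
    define V where "V n = (\<Union>i<n. A i)" for n
    have V: "range V \<subseteq> sets bernoulli" "incseq V" "(\<Union>n. V n) = (\<Union>i. A i)"
    proof -
      show "range V \<subseteq> sets bernoulli" using A unfolding V_def by auto
      show "incseq V" unfolding V_def incseq_def by (intro allI impI UN_mono) auto
      show "(\<Union>n. V n) = (\<Union>i. A i)" unfolding V_def by (auto intro: lessI)
    qed
    have "(\<lambda>n. measure bernoulli (V n)) \<longlonglongrightarrow> measure bernoulli (\<Union>i. A i)"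
      using bernoulli.finite_Lim_measure_incseq[OF V(1,2)] V(3) by simp
    then have "eventually (\<lambda>n. measure bernoulli (\<Union>i. A i) - \<epsilon> / 2 < measure bernoulli (V n)) sequentially"
      by (rule order_tendstoD(1)) (use \<epsilon> in simp)
    then obtain n where n: "measure bernoulli (\<Union>i. A i) - \<epsilon> / 2 < measure bernoulli (V n)"
      by (auto simp: eventually_sequentially)
    \<comment> \<open>Half of \<epsilon> is spent on the tail of the union, the other half is shared
      by the \<open>n\<close> sets; dividing by \<open>n + 1\<close> also covers
      \<open>n = 0\<close>.\<close>
    define \<delta> where "\<delta> = \<epsilon> / (2 * (n + 1))"
    have \<delta>: "\<delta> > 0" "n * \<delta> \<le> \<epsilon> / 2" using \<epsilon> unfolding \<delta>_def by (auto simp: field_simps)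
    have "\<forall>i. \<exists>J D. finite J \<and> D \<in> sets (\<Pi>\<^sub>M i\<in>J. unif) \<and> measure bernoulli (sym_diff (A i) (cyl J D)) < \<delta>"
      using Union(2) \<delta>(1) by blast
    then obtain J D where J: "\<And>i. finite (J i)" "\<And>i. D i \<in> sets (\<Pi>\<^sub>M j\<in>J i. unif)"
      "\<And>i. measure bernoulli (sym_diff (A i) (cyl (J i) (D i))) < \<delta>" by metis
    \<comment> \<open>The finitely many cylinders are rewritten over their common set of
      coordinates, so that their union is a single cylinder.\<close>
    define K where "K = (\<Union>i<n. J i)"
    define E where "E = (\<Union>i<n. (\<lambda>y. restrict y (J i)) -` D i \<inter> space (\<Pi>\<^sub>M j\<in>K. unif))"
    have E: "E \<in> sets (\<Pi>\<^sub>M j\<in>K. unif)" unfolding E_def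
    proof (intro sets.finite_UN finite_lessThan)
      fix i assume "i \<in> {..<n}"
      then have "(\<lambda>y. restrict y (J i)) \<in> measurable (\<Pi>\<^sub>M j\<in>K. unif) (\<Pi>\<^sub>M j\<in>J i. unif)"
        by (intro measurable_restrict_subset) (auto simp: K_def)
      then show "(\<lambda>y. restrict y (J i)) -` D i \<inter> space (\<Pi>\<^sub>M j\<in>K. unif) \<in> sets (\<Pi>\<^sub>M j\<in>K. unif)"
        using J(2) by (rule measurable_sets)
    qed
    have "restrict (restrict x K) (J i) = restrict x (J i)" if "i < n" for x :: "nat \<Rightarrow> real" and i
      using that unfolding K_def by (auto simp: restrict_def fun_eq_iff)
    then have cE: "cyl K E = (\<Union>i<n. cyl (J i) (D i))"
      unfolding cyl_def E_def by (auto simp: space_PiM)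
    let ?S = "(\<Union>i. A i) - V n" and ?T = "\<lambda>i. sym_diff (A i) (cyl (J i) (D i))"
    have T: "?T i \<in> sets bernoulli" for i using A cyl_sets[OF J(2)] by auto
    have S: "?S \<in> sets bernoulli" using V(1) A by auto
    have "sym_diff (\<Union>i. A i) (cyl K E) \<subseteq> ?S \<union> (\<Union>i<n. ?T i)" unfolding cE V_def by auto
    then have "measure bernoulli (sym_diff (\<Union>i. A i) (cyl K E)) \<le> measure bernoulli (?S \<union> (\<Union>i<n. ?T i))"
      using S T by (intro bernoulli.finite_measure_mono) auto
    also have "\<dots> \<le> measure bernoulli ?S + measure bernoulli (\<Union>i<n. ?T i)"
      using S T by (intro measure_Un_le) auto
    also have "measure bernoulli (\<Union>i<n. ?T i) \<le> (\<Sum>i<n. measure bernoulli (?T i))"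
      using T by (intro measure_UNION_le) auto
    also have "(\<Sum>i<n. measure bernoulli (?T i)) \<le> (\<Sum>i<n. \<delta>)" using J(3) by (intro sum_mono less_imp_le)
    also have "\<dots> \<le> \<epsilon> / 2" using \<delta>(2) by simp
    also have "measure bernoulli ?S = measure bernoulli (\<Union>i. A i) - measure bernoulli (V n)"
      using V(1) A by (intro bernoulli.finite_measure_Diff) (auto simp: V_def)
    finally have "measure bernoulli (sym_diff (\<Union>i. A i) (cyl K E)) < \<epsilon>" using n by linarith
    moreover have "finite K" unfolding K_def using J(1) by simp
    ultimately show "\<exists>J D. finite J \<and> D \<in> sets (\<Pi>\<^sub>M i\<in>J. unif) \<and> measure bernoulli (sym_diff (\<Union>i. A i) (cyl J D)) < \<epsilon>"
      using E by blast
  qed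
qed

text \<open>The reindexed cylinder depends only on the coordinates in the image of \<open>J\<close>
  under \<open>p\<close>, which is disjoint from \<open>J\<close>.\<close>

lemma cyl_independent:
  assumes J: "J \<inter> p ` J = {}" and D: "D \<in> sets (\<Pi>\<^sub>M i\<in>J. unif)"
  shows "measure bernoulli (cyl J D \<inter> (\<lambda>x. x \<circ> p) -` cyl J D) =
    measure bernoulli (cyl J D) * measure bernoulli ((\<lambda>x. x \<circ> p) -` cyl J D)"
proof -
  let ?Y = "\<lambda>y :: nat \<Rightarrow> real. \<lambda>i\<in>J. y (p i)"
  have "bernoulli.indep_var (Pi\<^sub>M J (\<lambda>_. unif)) (\<lambda>\<omega>. restrict (\<lambda>i. \<omega> i) J)
      (Pi\<^sub>M (p ` J) (\<lambda>_. unif)) (\<lambda>\<omega>. restrict (\<lambda>i. \<omega> i) (p ` J))"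
    by (rule bernoulli.indep_var_restrict[OF indep_coordinates J]) auto
  moreover have "?Y \<in> measurable (Pi\<^sub>M (p ` J) (\<lambda>_. unif)) (Pi\<^sub>M J (\<lambda>_. unif))"
    by (intro measurable_restrict measurable_component_singleton) auto
  ultimately have "bernoulli.indep_var (Pi\<^sub>M J (\<lambda>_. unif)) (id \<circ> (\<lambda>\<omega>. restrict (\<lambda>i. \<omega> i) J))
      (Pi\<^sub>M J (\<lambda>_. unif)) (?Y \<circ> (\<lambda>\<omega>. restrict (\<lambda>i. \<omega> i) (p ` J)))"
    by (intro bernoulli.indep_var_compose) auto
  from bernoulli.indep_varD[OF this D D]
  have "measure bernoulli ((\<lambda>x. (restrict x J, ?Y (restrict x (p ` J)))) -` (D \<times> D)) =
      measure bernoulli ((\<lambda>x. restrict x J) -` D) * measure bernoulli ((\<lambda>x. ?Y (restrict x (p ` J))) -` D)"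
    by (simp add: space_PiM comp_def)
  moreover have "?Y (restrict x (p ` J)) = restrict (x \<circ> p) J" for x
    by (auto simp: restrict_def fun_eq_iff)
  ultimately show ?thesis by (simp add: cyl_def vimage_def Collect_conj_eq[symmetric])
qed

lemma measure_sym_diff_le:
  assumes "A \<in> sets bernoulli" "B \<in> sets bernoulli"
  shows "\<bar>measure bernoulli A - measure bernoulli B\<bar> \<le> measure bernoulli (sym_diff A B)"
proof -
  have "measure bernoulli A \<le> measure bernoulli (B \<union> sym_diff A B)"
    "measure bernoulli B \<le> measure bernoulli (A \<union> sym_diff A B)"
    using assms by (auto intro!: bernoulli.finite_measure_mono)
  moreover have "measure bernoulli (B \<union> sym_diff A B) \<le> measure bernoulli B + measure bernoulli (sym_diff A B)"
    "measure bernoulli (A \<union> sym_diff A B) \<le> measure bernoulli A + measure bernoulli (sym_diff A B)"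
    using assms by (intro measure_Un_le; auto)+
  ultimately show ?thesis by linarith
qed

text \<open>A mixing argument: if a cylinder \<open>A\<close> of measure \<open>a\<close>
  approximates \<open>C\<close>, then, as \<open>C\<close> is invariant under the reindexing, both
  \<open>A\<close> and its displaced copy approximate \<open>C\<close>, and so does their
  intersection, of measure \<open>a * a\<close> by independence. Hence the measure \<open>c\<close>
  of \<open>C\<close> satisfies \<open>c = c * c\<close>.\<close>

lemma bernoulli_zero_one_law:
  assumes C: "C \<in> sets bernoulli"
    and mix: "\<And>J. finite J \<Longrightarrow> \<exists>p. inj p \<and> J \<inter> p ` J = {} \<and> (\<lambda>x. x \<circ> p) -` C = C"
  shows "measure bernoulli C = 0 \<or> measure bernoulli C = 1"
proof -
  let ?m = "measure bernoulli"
  define c where "c = ?m C"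
  have c01: "0 \<le> c" "c \<le> 1" unfolding c_def by auto
  have le: "\<bar>c - c * c\<bar> \<le> 0 + \<epsilon>" if "\<epsilon> > 0" for \<epsilon>
  proof -
    \<comment> \<open>The intersection of two approximations costs twice the error, putting
      \<open>c\<close> within \<open>\<epsilon> / 2\<close> of \<open>a * a\<close>; and
      \<open>a * a\<close> is within \<open>\<epsilon> / 2\<close> of \<open>c * c\<close> because
      \<open>a + c\<close> is at most 2.\<close>
    have "\<epsilon> / 4 > 0" using that by simp
    from approximate_by_cylinders[OF C, rule_format, OF this]
    obtain J D where J: "finite J" "D \<in> sets (\<Pi>\<^sub>M i\<in>J. unif)" "?m (sym_diff C (cyl J D)) < \<epsilon> / 4"
      by blast
    obtain p where p: "inj p" "J \<inter> p ` J = {}" "(\<lambda>x. x \<circ> p) -` C = C" using mix[OF J(1)] by blast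
    let ?A = "cyl J D" and ?T = "\<lambda>S. (\<lambda>x. x \<circ> p) -` S"
    have A: "?A \<in> sets bernoulli" by (rule cyl_sets[OF J(2)])
    have T: "?T S \<in> sets bernoulli" "?m (?T S) = ?m S" if S: "S \<in> sets bernoulli" for S
    proof -
      show "?T S \<in> sets bernoulli" using measurable_sets[OF measurable_reindex S, of p] by (simp add: space_PiM)
      have "?m (?T S) = measure (distr bernoulli bernoulli (\<lambda>x. x \<circ> p)) S"
        using measure_distr[OF measurable_reindex S, of p] by (simp add: space_PiM)
      then show "?m (?T S) = ?m S" unfolding distr_reindex[OF p(1)] .
    qed
    define a where "a = ?m ?A"
    have a01: "0 \<le> a" "a \<le> 1" unfolding a_def by auto
    have aa: "?m (?A \<inter> ?T ?A) = a * a"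
      using cyl_independent[OF p(2) J(2)] T(2)[OF A] unfolding a_def by simp
    have ca: "\<bar>c - a\<bar> \<le> \<epsilon> / 4"
      using measure_sym_diff_le[OF C A] J(3) unfolding c_def a_def by linarith
    have sT: "sym_diff C (?T ?A) = ?T (sym_diff C ?A)" using p(3) by auto
    have "\<bar>c - a * a\<bar> \<le> ?m (sym_diff C (?A \<inter> ?T ?A))"
      using measure_sym_diff_le[of C "?A \<inter> ?T ?A"] C A T(1)[OF A] aa unfolding c_def by auto
    also have "\<dots> \<le> ?m (sym_diff C ?A \<union> sym_diff C (?T ?A))"
      using C A T(1)[OF A] by (intro bernoulli.finite_measure_mono) auto
    also have "\<dots> \<le> ?m (sym_diff C ?A) + ?m (sym_diff C (?T ?A))"
      using C A T(1)[OF A] by (intro measure_Un_le) auto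
    also have "\<dots> = ?m (sym_diff C ?A) + ?m (sym_diff C ?A)"
      unfolding sT using T(2)[of "sym_diff C ?A"] C A by auto
    also have "\<dots> \<le> \<epsilon> / 2" using J(3) by linarith
    finally have 1: "\<bar>c - a * a\<bar> \<le> \<epsilon> / 2" .
    have "a * a - c * c = (a - c) * (a + c)" by (simp add: algebra_simps)
    then have "\<bar>a * a - c * c\<bar> = \<bar>a - c\<bar> * (a + c)"
      using a01 c01 by (simp add: abs_mult)
    also have "\<dots> \<le> (\<epsilon> / 4) * 2" using ca a01 c01 that
      by (intro mult_mono) (simp_all add: abs_minus_commute)
    finally show ?thesis using 1 by linarith
  qed
  have "\<bar>c - c * c\<bar> \<le> 0" by (rule field_le_epsilon) (rule le)
  then have "c * (1 - c) = 0" by (simp add: algebra_simps)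
  then show ?thesis unfolding c_def by auto
qed

section \<open>The Bernoulli shift of a countably infinite group\<close>

locale bernoulli_shift = group G for G :: "('g, 'r) monoid_scheme" (structure) +
  fixes e :: "nat \<Rightarrow> 'g"
  assumes enum: "bij_betw e UNIV (carrier G)"
begin

text \<open>Translation by the inverse of \<open>g\<close>, read through the enumeration.
  Precomposition reverses the order of products and so does inversion, so \<open>shift\<close>
  becomes a left action.\<close>

definition perm :: "'g \<Rightarrow> nat \<Rightarrow> nat" where
  "perm g i = inv_into UNIV e (inv g \<otimes> e i)"

definition shift :: "'g \<Rightarrow> (nat \<Rightarrow> real) \<Rightarrow> (nat \<Rightarrow> real)" where
  "shift g x = x \<circ> perm g"

lemma e_closed [simp]: "e i \<in> carrier G"
  using enum by (auto simp: bij_betw_def)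

lemma e_perm: "g \<in> carrier G \<Longrightarrow> e (perm g i) = inv g \<otimes> e i"
  using enum unfolding perm_def bij_betw_def by (intro f_inv_into_f) simp

lemma e_inj: "e i = e j \<Longrightarrow> i = j"
  using enum unfolding bij_betw_def by (auto dest: injD)

lemma perm_inj: "g \<in> carrier G \<Longrightarrow> inj (perm g)"
  using e_perm e_inj by (intro injI) (metis e_closed inv_closed l_cancel)

lemma shift_one: "shift \<one> x = x"
proof -
  have "perm \<one> i = i" for i by (rule e_inj) (simp add: e_perm)
  then show ?thesis unfolding shift_def by (auto simp: fun_eq_iff)
qed

lemma shift_mult:
  assumes "g \<in> carrier G" "h \<in> carrier G"
  shows "shift (g \<otimes> h) x = shift g (shift h x)"
proof -
  have "perm (g \<otimes> h) i = perm h (perm g i)" for i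
    by (rule e_inj) (use assms in \<open>simp add: e_perm inv_mult_group m_assoc\<close>)
  then show ?thesis unfolding shift_def by (auto simp: fun_eq_iff)
qed

lemma shift_measurable: "shift g \<in> measurable bernoulli bernoulli"
  unfolding shift_def by (rule measurable_reindex)

lemma shift_distr: "g \<in> carrier G \<Longrightarrow> distr bernoulli bernoulli (shift g) = bernoulli"
  unfolding shift_def by (rule distr_reindex[OF perm_inj])

lemma shift_action: "group_action G UNIV shift"
  by (rule group_actionI) (auto simp: is_group shift_one shift_mult extensional_UNIV)

lemma countable_carrier: "countable (carrier G)"
  using enum by (metis bij_betw_def countableI_type countable_image)

sublocale shift: pmp_action G bernoulli shift
proof (unfold pmp_action_def pmp_action_axioms_def, intro conjI allI impI)
  show "group_action G (space bernoulli) shift" using shift_action by (simp add: space_PiM)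
qed (auto simp: shift_measurable shift_distr countable_carrier standard_borel_separated[OF standard_borel_bernoulli]
    bernoulli.prob_space_axioms)

text \<open>If \<open>perm g\<close> sends \<open>i\<close> to \<open>k\<close>, then
  \<open>g\<close> equals \<open>e i \<otimes> inv (e k)\<close>. Finitely many elements are thus
  excluded, and the group is infinite.\<close>

lemma shift_displaces:
  assumes J: "finite J"
  obtains g where "g \<in> carrier G" "J \<inter> perm g ` J = {}"
proof -
  have inf: "infinite (carrier G)"
    using enum bij_betw_finite infinite_UNIV_nat by blast
  have "finite ((\<lambda>(i, k). e i \<otimes> inv (e k)) ` (J \<times> J))" using J by simp
  then obtain g where g: "g \<in> carrier G" "g \<notin> (\<lambda>(i, k). e i \<otimes> inv (e k)) ` (J \<times> J)"
    using inf by (meson finite_subset subsetI)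
  have "perm g i \<noteq> k" if "i \<in> J" "k \<in> J" for i k
  proof
    assume "perm g i = k"
    then have "e k = inv g \<otimes> e i" using e_perm[OF g(1)] by auto
    then have "g = e i \<otimes> inv (e k)"
      using g(1) by (metis e_closed inv_closed inv_equality inv_inv inv_mult_group inv_solve_left m_assoc r_inv r_one l_inv l_one)
    then show False using g(2) that by auto
  qed
  then show ?thesis using that[OF g(1)] by blast
qed

lemma shift_ergodic:
  assumes C: "C \<in> sets bernoulli" and inv: "\<And>g x. g \<in> carrier G \<Longrightarrow> x \<in> C \<longleftrightarrow> shift g x \<in> C"
  shows "emeasure bernoulli C = 0 \<or> emeasure bernoulli C = 1"
proof -
  have "measure bernoulli C = 0 \<or> measure bernoulli C = 1"
  proof (rule bernoulli_zero_one_law[OF C])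
    fix J :: "nat set" assume "finite J"
    then obtain g where g: "g \<in> carrier G" "J \<inter> perm g ` J = {}" by (rule shift_displaces)
    have "(\<lambda>x. x \<circ> perm g) -` C = C" using inv[OF g(1)] unfolding shift_def by auto
    then show "\<exists>p. inj p \<and> J \<inter> p ` J = {} \<and> (\<lambda>x. x \<circ> p) -` C = C"
      using perm_inj[OF g(1)] g(2) by blast
  qed
  then show ?thesis by (auto simp: bernoulli.emeasure_eq_measure)
qed

text \<open>A null set that contains all points with non-trivial stabiliser. Comparing the single
  coordinate 0 with its translate is enough, since a non-trivial \<open>g\<close> moves the index
  0.\<close>

definition fixed :: "(nat \<Rightarrow> real) set" where
  "fixed = (\<Union>g\<in>carrier G - {\<one>}. {x. x 0 = x (perm g 0)})"

lemma fixed_null: "fixed \<in> null_sets bernoulli"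
  unfolding fixed_def
proof (rule null_sets_UN')
  show "countable (carrier G - {\<one>})" using countable_carrier by simp
  fix g assume g: "g \<in> carrier G - {\<one>}"
  have "0 \<noteq> perm g 0"
  proof
    assume "0 = perm g 0"
    then have "e 0 = inv g \<otimes> e 0" using e_perm[of g 0] g by auto
    then have "inv g = \<one>" using g by (metis DiffD1 e_closed inv_closed l_one one_closed r_cancel)
    then show False using g by (metis DiffD1 DiffD2 inv_inv inv_one singletonI)
  qed
  then show "{x. x 0 = x (perm g 0)} \<in> null_sets bernoulli" by (rule coordinates_agree_null)
qed

lemma shift_fixed:
  assumes "g \<in> carrier G" "shift g x = x" "x \<notin> fixed"
  shows "g = \<one>"
proof (rule ccontr)
  assume "g \<noteq> \<one>"
  moreover have "x 0 = x (perm g 0)" using assms(2) unfolding shift_def by (auto dest: fun_cong[where x=0])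
  ultimately show False using assms(1,3) unfolding fixed_def by auto
qed

end

section \<open>The product of two Bernoulli shifts as an action on a set of reals\<close>

lemma finitely_generated_countable:
  assumes "group G" and fg: "finitely_generated_group G"
  shows "countable (carrier G)"
proof -
  interpret group G by fact
  obtain S where S: "finite S" "S \<subseteq> carrier G" "generate G S = carrier G"
    using fg unfolding finitely_generated_group_def by auto
  define T where "T = S \<union> m_inv G ` S"
  have T: "T \<subseteq> carrier G" "finite T" using S unfolding T_def by auto
  define w where "w xs = foldr (mult G) xs \<one>\<^bsub>G\<^esub>" for xs
  have wc: "w xs \<in> carrier G" if "xs \<in> lists T" for xs
    using that T(1) unfolding w_def by (induction xs) auto
  have wa: "w (xs @ ys) = w xs \<otimes>\<^bsub>G\<^esub> w ys" if "xs \<in> lists T" "ys \<in> lists T" for xs ys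
    using that(1)
  proof (induction xs)
    case Nil
    then show ?case using wc[OF that(2)] unfolding w_def by simp
  next
    case (Cons x xs)
    then have "x \<in> carrier G" "w xs \<in> carrier G" using T(1) wc by auto
    moreover have "w (x # zs) = x \<otimes>\<^bsub>G\<^esub> w zs" for zs unfolding w_def by simp
    ultimately show ?case using Cons.IH wc[OF that(2)] by (simp add: m_assoc)
  qed
  have "g \<in> w ` lists T" if "g \<in> generate G S" for g
    using that
  proof (induction g rule: generate.induct)
    case one
    show ?case by (rule image_eqI[of _ _ "[]"]) (auto simp: w_def)
  next
    case (incl h)
    then show ?case using S(2) by (intro image_eqI[of _ _ "[h]"]) (auto simp: w_def T_def)
  next
    case (inv h)
    then show ?case using S(2) by (intro image_eqI[of _ _ "[m_inv G h]"]) (auto simp: w_def T_def)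
  next
    case (eng h1 h2)
    then obtain xs ys where "xs \<in> lists T" "ys \<in> lists T" "h1 = w xs" "h2 = w ys" by auto
    then show ?case using wa by (intro image_eqI[of _ _ "xs @ ys"]) auto
  qed
  then have "carrier G \<subseteq> w ` lists T" unfolding S(3) by blast
  moreover have "countable (w ` lists T)" using T(2) by (intro countable_image countable_lists countable_finite)
  ultimately show ?thesis by (rule countable_subset)
qed

text \<open>Reals are coded as sets of naturals. A pair of sequences of such sets becomes one set of
  pairs of naturals, with the even rows holding the first sequence and the odd rows the
  second.\<close>

lemma inj_real_sequence_pairs: "\<exists>j :: (nat \<Rightarrow> real) \<times> (nat \<Rightarrow> real) \<Rightarrow> real. inj j"
proof -
  obtain s :: "nat set \<Rightarrow> real" where s: "bij s"
    using nat_sets_eqpoll_reals unfolding eqpoll_def by auto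
  define t where "t = inv_into UNIV s"
  have t: "inj t" unfolding t_def using s by (simp add: bij_imp_bij_inv bij_is_inj)
  define c where "c p = {m. (if even (fst (prod_decode m)) then snd (prod_decode m) \<in> t (fst p (fst (prod_decode m) div 2))
      else snd (prod_decode m) \<in> t (snd p (fst (prod_decode m) div 2)))}" for p :: "(nat \<Rightarrow> real) \<times> (nat \<Rightarrow> real)"
  have "inj c"
  proof (rule injI)
    fix p q assume eq: "c p = c q"
    have "n \<in> t (fst p i) \<longleftrightarrow> n \<in> t (fst q i)" for n i
      using arg_cong[OF eq, of "\<lambda>A. prod_encode (2 * i, n) \<in> A"] unfolding c_def by simp
    moreover have "n \<in> t (snd p i) \<longleftrightarrow> n \<in> t (snd q i)" for n i
      using arg_cong[OF eq, of "\<lambda>A. prod_encode (2 * i + 1, n) \<in> A"] unfolding c_def by simp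
    ultimately have "t (fst p i) = t (fst q i)" "t (snd p i) = t (snd q i)" for i by blast+
    then show "p = q" using injD[OF t] by (auto simp: prod_eq_iff fun_eq_iff)
  qed
  then have "inj (s \<circ> c)" using bij_is_inj[OF s] by (rule inj_compose[rotated])
  then show ?thesis by blast
qed

lemma distr_prod_action:
  assumes f: "f \<in> measurable bernoulli bernoulli" "distr bernoulli bernoulli f = bernoulli"
    and g: "g \<in> measurable bernoulli bernoulli" "distr bernoulli bernoulli g = bernoulli"
  shows "distr (bernoulli \<Otimes>\<^sub>M bernoulli) (bernoulli \<Otimes>\<^sub>M bernoulli) (\<lambda>(x, y). (f x, g y)) = bernoulli \<Otimes>\<^sub>M bernoulli"
  using pair_measure_distr[OF f(1) g(1)] bernoulli.sigma_finite_measure_axioms f(2) g(2) by simp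

locale product_bernoulli = G: bernoulli_shift G e + H: bernoulli_shift H e' + \<Gamma>: group \<Gamma>
  for G :: "('h, 's) monoid_scheme" and e and H :: "('k, 't) monoid_scheme" and e'
    and \<Gamma> :: "('g, 'r) monoid_scheme" +
  fixes \<theta> :: "'g \<Rightarrow> 'h \<times> 'k" and j :: "(nat \<Rightarrow> real) \<times> (nat \<Rightarrow> real) \<Rightarrow> real"
  assumes \<theta>: "\<theta> \<in> iso \<Gamma> (G \<times>\<times> H)" and inj_j: "inj j"
begin

abbreviation "N \<equiv> bernoulli \<Otimes>\<^sub>M bernoulli"

definition act :: "'g \<Rightarrow> (nat \<Rightarrow> real) \<times> (nat \<Rightarrow> real) \<Rightarrow> (nat \<Rightarrow> real) \<times> (nat \<Rightarrow> real)" where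
  "act g = (\<lambda>(x, y). (G.shift (fst (\<theta> g)) x, H.shift (snd (\<theta> g)) y))"

abbreviation "M \<equiv> transport N j"

text \<open>The product action conjugated by \<open>j\<close>. The restriction makes each map
  extensional, as \<open>group_action\<close> requires.\<close>

definition \<alpha> :: "'g \<Rightarrow> real \<Rightarrow> real" where
  "\<alpha> g = restrict (\<lambda>r. j (act g (inv_into (space N) j r))) (space M)"

lemma space_N: "space N = UNIV"
  by (simp add: space_pair_measure space_PiM)

lemma inj': "inj_on j (space N)" using inj_j by (simp add: space_N)

lemma space_M: "space M = range j" using space_transport[OF inj'] by (simp add: space_N)

lemma \<alpha>_j: "\<alpha> g (j x) = j (act g x)"
  using transport_k[OF inj', of x] unfolding \<alpha>_def space_M by (simp add: space_N)

lemma \<theta>_closed: "g \<in> carrier \<Gamma> \<Longrightarrow> fst (\<theta> g) \<in> carrier G" "g \<in> carrier \<Gamma> \<Longrightarrow> snd (\<theta> g) \<in> carrier H"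
  using iso_imp_homomorphism[OF \<theta>] unfolding hom_def DirProd_def by (auto simp: mem_Times_iff Pi_iff)

lemma \<theta>_mult: "g \<in> carrier \<Gamma> \<Longrightarrow> h \<in> carrier \<Gamma> \<Longrightarrow>
    \<theta> (g \<otimes>\<^bsub>\<Gamma>\<^esub> h) = (fst (\<theta> g) \<otimes>\<^bsub>G\<^esub> fst (\<theta> h), snd (\<theta> g) \<otimes>\<^bsub>H\<^esub> snd (\<theta> h))"
  using iso_imp_homomorphism[OF \<theta>] unfolding hom_def DirProd_def by (auto simp: case_prod_beta)

lemma \<theta>_one: "\<theta> \<one>\<^bsub>\<Gamma>\<^esub> = (\<one>\<^bsub>G\<^esub>, \<one>\<^bsub>H\<^esub>)"
  using hom_one[OF iso_imp_homomorphism[OF \<theta>] \<Gamma>.is_group DirProd_group[OF G.is_group H.is_group]] by simp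

lemma \<theta>_surj: "g \<in> carrier G \<Longrightarrow> h \<in> carrier H \<Longrightarrow> \<exists>k\<in>carrier \<Gamma>. \<theta> k = (g, h)"
  using \<theta> unfolding iso_def bij_betw_def by (auto simp: DirProd_def image_iff) (metis (no_types, lifting) SigmaI imageE)

lemma act_one: "act \<one>\<^bsub>\<Gamma>\<^esub> x = x"
  unfolding act_def \<theta>_one by (simp add: G.shift_one H.shift_one case_prod_beta)

lemma act_mult: "g \<in> carrier \<Gamma> \<Longrightarrow> h \<in> carrier \<Gamma> \<Longrightarrow> act (g \<otimes>\<^bsub>\<Gamma>\<^esub> h) x = act g (act h x)"
  unfolding act_def by (simp add: \<theta>_mult G.shift_mult H.shift_mult \<theta>_closed case_prod_beta)

lemma act_measurable: "act g \<in> measurable N N"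
  unfolding act_def using G.shift_measurable[of "fst (\<theta> g)"] H.shift_measurable[of "snd (\<theta> g)"] by measurable

lemma act_distr: "g \<in> carrier \<Gamma> \<Longrightarrow> distr N N (act g) = N"
  unfolding act_def
  by (intro distr_prod_action G.shift_measurable H.shift_measurable G.shift_distr H.shift_distr \<theta>_closed)

lemma prob_space_N: "prob_space N"
proof -
  interpret pair_prob_space bernoulli bernoulli ..
  show ?thesis by (rule prob_space_axioms)
qed

lemma standard_borel_N: "standard_borel N"
proof (rule standard_borel_borel)
  have "sets N = sets (borel \<Otimes>\<^sub>M borel)" by (intro sets_pair_measure_cong sets_bernoulli)
  then show "sets N = sets borel" by (simp only: borel_prod)
qed

lemma non_atomic_N: "non_atomic N"
proof (rule non_atomicI[OF prob_space_N])
  have m: "(\<lambda>x. x 0) \<in> measurable bernoulli unif" by (rule measurable_component_singleton) simp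
  then have m': "(\<lambda>x. x 0) \<in> borel_measurable bernoulli" by simp
  then show "(\<lambda>p. fst p 0) \<in> borel_measurable N" by measurable
  show "emeasure N ((\<lambda>p. fst p 0) -` {t} \<inter> space N) = 0" for t :: real
  proof -
    let ?A = "(\<lambda>x :: nat \<Rightarrow> real. x 0) -` {t} \<inter> space bernoulli"
    have "emeasure bernoulli ?A = emeasure (distr bernoulli unif (\<lambda>x. x 0)) {t}"
      by (rule emeasure_distr[OF m, symmetric]) simp
    then have 0: "emeasure bernoulli ?A = 0" unfolding distr_coordinate unif_singleton .
    have "(\<lambda>p. fst p 0) -` {t} \<inter> space N = ?A \<times> space bernoulli"
      by (auto simp: space_pair_measure)
    moreover have "?A \<in> sets bernoulli" by (rule measurable_sets[OF m']) simp
    ultimately show ?thesis using 0 by (simp add: bernoulli.emeasure_pair_measure_Times)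
  qed
qed

lemma standard_M: "standard_nonatomic_prob M"
  unfolding standard_nonatomic_prob_def
  using transport_standard_borel[OF inj' standard_borel_N] transport_prob[OF inj' prob_space_N]
    transport_non_atomic[OF inj' non_atomic_N] by simp

lemma \<alpha>_action: "group_action \<Gamma> (space M) \<alpha>"
proof (rule group_actionI[OF \<Gamma>.is_group])
  show "\<alpha> g \<in> extensional (space M)" for g unfolding \<alpha>_def by simp
qed (auto simp: space_M \<alpha>_j act_one act_mult)

lemma \<alpha>_measurable: "\<alpha> g \<in> measurable M M"
proof -
  have k: "inv_into (space N) j \<in> measurable M N"
  proof (rule measurableI)
    show "inv_into (space N) j r \<in> space N" for r by (simp add: space_N)
    fix A assume A: "A \<in> sets N"
    have "inv_into (space N) j -` A \<inter> space M = j ` A"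
      using transport_vimage[OF inj' sets.sets_into_space[OF A]] space_transport[OF inj'] by simp
    then show "inv_into (space N) j -` A \<inter> space M \<in> sets M"
      using A sets_transport[OF inj'] by auto
  qed
  have "(\<lambda>r. j (act g (inv_into (space N) j r))) \<in> measurable M M"
    by (rule measurable_compose[OF measurable_compose[OF k act_measurable] transport_measurable[OF inj']])
  then show ?thesis unfolding \<alpha>_def by (subst measurable_cong) auto
qed

lemma \<alpha>_distr:
  assumes g: "g \<in> carrier \<Gamma>"
  shows "distr M M (\<alpha> g) = M"
proof -
  note jm = transport_measurable[OF inj'] and dt = distr_transport[OF inj']
  have "distr M M (\<alpha> g) = distr (distr N M j) M (\<alpha> g)" unfolding dt ..
  also have "\<dots> = distr N M (\<alpha> g \<circ> j)" by (rule distr_distr[OF \<alpha>_measurable jm])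
  also have "\<alpha> g \<circ> j = j \<circ> act g" by (auto simp: \<alpha>_j)
  also have "distr N M (j \<circ> act g) = distr (distr N N (act g)) M j"
    by (rule distr_distr[OF jm act_measurable, symmetric])
  also have "\<dots> = M" unfolding act_distr[OF g] dt ..
  finally show ?thesis .
qed

text \<open>As \<theta> is onto the direct product, the two coordinates can be moved independently,
  so orbits of the group are products of orbits of the factors.\<close>

lemma orbit_rel_j: "(j u, j v) \<in> orbit_rel \<Gamma> M \<alpha> \<longleftrightarrow>
    (u, v) \<in> product_rel (orbit_rel G bernoulli G.shift) (orbit_rel H bernoulli H.shift)"
proof -
  obtain x y x' y' where e: "u = (x, y)" "v = (x', y')" by (meson surj_pair)
  have "(j u, j v) \<in> orbit_rel \<Gamma> M \<alpha> \<longleftrightarrow> (\<exists>g\<in>carrier \<Gamma>. v = act g u)"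
  proof -
    have "j v = j (act g u) \<longleftrightarrow> v = act g u" for g using inj_eq[OF inj_j] .
    then show ?thesis unfolding orbit_rel_def orbit_def by (auto simp: space_M \<alpha>_j)
  qed
  also have "\<dots> \<longleftrightarrow> (\<exists>g\<in>carrier G. \<exists>h\<in>carrier H. x' = G.shift g x \<and> y' = H.shift h y)"
  proof
    assume "\<exists>g\<in>carrier \<Gamma>. v = act g u"
    then show "\<exists>g\<in>carrier G. \<exists>h\<in>carrier H. x' = G.shift g x \<and> y' = H.shift h y"
      using \<theta>_closed unfolding act_def e by auto
  next
    assume "\<exists>g\<in>carrier G. \<exists>h\<in>carrier H. x' = G.shift g x \<and> y' = H.shift h y"
    then obtain g h where gh: "g \<in> carrier G" "h \<in> carrier H" "x' = G.shift g x" "y' = H.shift h y" by auto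
    obtain k where "k \<in> carrier \<Gamma>" "\<theta> k = (g, h)" using \<theta>_surj[OF gh(1,2)] by auto
    then show "\<exists>g\<in>carrier \<Gamma>. v = act g u" using gh unfolding act_def e by (intro bexI[of _ k]) simp_all
  qed
  also have "\<dots> \<longleftrightarrow> (u, v) \<in> product_rel (orbit_rel G bernoulli G.shift) (orbit_rel H bernoulli H.shift)"
    unfolding e product_rel_iff orbit_rel_def orbit_def by (auto simp: space_PiM)
  finally show ?thesis .
qed

text \<open>Each slice of an invariant set with fixed second coordinate is invariant under the first
  shift and so has measure 0 or 1. The set of second coordinates with full slice is invariant under
  the second shift, hence is null or conull as well, and by Fubini its measure is that of the given
  set.\<close>

lemma act_ergodic:
  assumes A: "A \<in> sets N" and inv: "\<And>g u. g \<in> carrier \<Gamma> \<Longrightarrow> u \<in> A \<longleftrightarrow> act g u \<in> A"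
  shows "emeasure N A = 0 \<or> emeasure N A = 1"
proof -
  interpret pair_prob_space bernoulli bernoulli ..
  have invG: "(x, y) \<in> A \<longleftrightarrow> (G.shift g x, y) \<in> A" if g: "g \<in> carrier G" for g x y
  proof -
    obtain k where "k \<in> carrier \<Gamma>" "\<theta> k = (g, \<one>\<^bsub>H\<^esub>)" using \<theta>_surj[OF g H.one_closed] by auto
    then show ?thesis using inv[of k "(x, y)"] unfolding act_def by (simp add: H.shift_one)
  qed
  have invH: "(x, y) \<in> A \<longleftrightarrow> (x, H.shift h y) \<in> A" if h: "h \<in> carrier H" for h x y
  proof -
    obtain k where "k \<in> carrier \<Gamma>" "\<theta> k = (\<one>\<^bsub>G\<^esub>, h)" using \<theta>_surj[OF G.one_closed h] by auto
    then show ?thesis using inv[of k "(x, y)"] unfolding act_def by (simp add: G.shift_one)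
  qed
  let ?s = "\<lambda>y. (\<lambda>x. (x, y)) -` A"
  have s01: "emeasure bernoulli (?s y) = 0 \<or> emeasure bernoulli (?s y) = 1" for y
    by (rule G.shift_ergodic[OF sets_Pair2[OF A]]) (simp only: vimage_eq, rule invG)
  define D where "D = {y \<in> space bernoulli. emeasure bernoulli (?s y) = 1}"
  have "D = (\<lambda>y. emeasure bernoulli (?s y)) -` {1} \<inter> space bernoulli" unfolding D_def by auto
  then have D: "D \<in> sets bernoulli"
    using measurable_sets[OF measurable_emeasure_Pair2[OF A], of "{1}"] by simp
  have "emeasure bernoulli D = 0 \<or> emeasure bernoulli D = 1"
  proof (rule H.shift_ergodic[OF D])
    fix h y assume h: "h \<in> carrier H"
    have "?s (H.shift h y) = ?s y" unfolding vimage_def using invH[OF h] by blast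
    then show "y \<in> D \<longleftrightarrow> H.shift h y \<in> D" unfolding D_def by (simp add: space_PiM)
  qed
  moreover have "emeasure N A = emeasure bernoulli D"
  proof -
    have "emeasure N A = (\<integral>\<^sup>+y. emeasure bernoulli (?s y) \<partial>bernoulli)" by (rule emeasure_pair_measure_alt2[OF A])
    also have "\<dots> = (\<integral>\<^sup>+y. indicator D y \<partial>bernoulli)"
    proof (rule nn_integral_cong)
      fix y assume "y \<in> space bernoulli"
      then show "emeasure bernoulli (?s y) = indicator D y" using s01[of y] unfolding D_def by auto
    qed
    also have "\<dots> = emeasure bernoulli D" using D by simp
    finally show ?thesis .
  qed
  ultimately show ?thesis by simp
qed

lemma \<alpha>_ergodic: "ergodic_rel M (orbit_rel \<Gamma> M \<alpha>)"
  unfolding ergodic_rel_def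
proof (intro ballI impI)
  fix B assume B: "B \<in> sets M" "orbit_rel \<Gamma> M \<alpha> `` B = B"
  then obtain A where A: "A \<in> sets N" "B = j ` A" using sets_transport[OF inj'] by auto
  have sub: "act g u \<in> A" if "g \<in> carrier \<Gamma>" "u \<in> A" for g u
  proof -
    have "(j u, j (act g u)) \<in> orbit_rel \<Gamma> M \<alpha>"
    proof -
      have "j (act g u) \<in> orbit \<Gamma> \<alpha> (j u)"
        unfolding orbit_def using that(1) by (auto simp: \<alpha>_j[symmetric])
      then show ?thesis unfolding orbit_rel_def space_M by simp
    qed
    then have "j (act g u) \<in> j ` A" using B(2) that(2) unfolding A(2) by blast
    then show ?thesis using inj_image_mem_iff[OF inj_j] by simp
  qed
  have "emeasure N A = 0 \<or> emeasure N A = 1"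
  proof (rule act_ergodic[OF A(1)])
    fix g u assume g: "g \<in> carrier \<Gamma>"
    have ig: "inv\<^bsub>\<Gamma>\<^esub> g \<in> carrier \<Gamma>" using g by simp
    have "act (inv\<^bsub>\<Gamma>\<^esub> g) (act g u) = act (inv\<^bsub>\<Gamma>\<^esub> g \<otimes>\<^bsub>\<Gamma>\<^esub> g) u"
      by (rule act_mult[OF ig g, symmetric])
    also have "\<dots> = u" unfolding \<Gamma>.l_inv[OF g] by (rule act_one)
    finally have eq: "act (inv\<^bsub>\<Gamma>\<^esub> g) (act g u) = u" .
    show "u \<in> A \<longleftrightarrow> act g u \<in> A"
    proof
      assume "act g u \<in> A"
      from sub[OF ig this] show "u \<in> A" unfolding eq .
    qed (rule sub[OF g])
  qed
  then show "emeasure M B = 0 \<or> emeasure M B = 1"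
    unfolding A(2) using emeasure_transport[OF inj' A(1)] by simp
qed

text \<open>An element fixing a point whose coordinates avoid both exceptional sets has two trivial
  components, so it is trivial by injectivity of \<theta>.\<close>

lemma \<alpha>_free: "AE r in M. stabilizer \<Gamma> \<alpha> r = {\<one>\<^bsub>\<Gamma>\<^esub>}"
proof (rule AE_I')
  let ?Z = "G.fixed \<times> UNIV \<union> UNIV \<times> H.fixed"
  have "emeasure N (G.fixed \<times> space bernoulli) = 0" "emeasure N (space bernoulli \<times> H.fixed) = 0"
    "G.fixed \<times> space bernoulli \<in> sets N" "space bernoulli \<times> H.fixed \<in> sets N"
    using null_setsD1[OF G.fixed_null] null_setsD1[OF H.fixed_null] null_setsD2[OF G.fixed_null] null_setsD2[OF H.fixed_null]
    by (simp_all add: bernoulli.emeasure_pair_measure_Times)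
  then have Z: "?Z \<in> null_sets N"
    unfolding space_bernoulli by (intro null_sets.Un) (simp_all only: null_setsI)
  then show "j ` ?Z \<in> null_sets M"
    using emeasure_transport[OF inj' null_setsD2[OF Z]] sets_transport[OF inj'] by (auto intro!: null_setsI)
  show "{r \<in> space M. stabilizer \<Gamma> \<alpha> r \<noteq> {\<one>\<^bsub>\<Gamma>\<^esub>}} \<subseteq> j ` ?Z"
  proof
    fix r assume "r \<in> {r \<in> space M. stabilizer \<Gamma> \<alpha> r \<noteq> {\<one>\<^bsub>\<Gamma>\<^esub>}}"
    then obtain x y where r: "r = j (x, y)" "stabilizer \<Gamma> \<alpha> r \<noteq> {\<one>\<^bsub>\<Gamma>\<^esub>}" unfolding space_M by auto
    show "r \<in> j ` ?Z"
    proof (rule ccontr)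
      assume "r \<notin> j ` ?Z"
      then have nf: "x \<notin> G.fixed" "y \<notin> H.fixed" unfolding r(1) by auto
      have "g = \<one>\<^bsub>\<Gamma>\<^esub>" if g: "g \<in> carrier \<Gamma>" "\<alpha> g r = r" for g
      proof -
        have "act g (x, y) = (x, y)" using g(2) injD[OF inj_j] unfolding r(1) \<alpha>_j by auto
        then have "G.shift (fst (\<theta> g)) x = x" "H.shift (snd (\<theta> g)) y = y" unfolding act_def by auto
        then have "\<theta> g = (\<one>\<^bsub>G\<^esub>, \<one>\<^bsub>H\<^esub>)"
          using G.shift_fixed[OF \<theta>_closed(1)[OF g(1)] _ nf(1)] H.shift_fixed[OF \<theta>_closed(2)[OF g(1)] _ nf(2)]
          by (simp add: prod_eq_iff)
        then have "\<theta> g = \<theta> \<one>\<^bsub>\<Gamma>\<^esub>" unfolding \<theta>_one .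
        then show ?thesis using \<theta> g(1) unfolding iso_def bij_betw_def by (auto dest: inj_onD)
      qed
      moreover have "\<alpha> \<one>\<^bsub>\<Gamma>\<^esub> r = r" unfolding r(1) \<alpha>_j act_one ..
      ultimately have "stabilizer \<Gamma> \<alpha> r = {\<one>\<^bsub>\<Gamma>\<^esub>}" unfolding stabilizer_def by auto
      then show False using r(2) by simp
    qed
  qed
qed

lemma \<alpha>_decomposes:
  "decomposes_as_product M (orbit_rel \<Gamma> M \<alpha>) bernoulli (orbit_rel G bernoulli G.shift)
    bernoulli (orbit_rel H bernoulli H.shift)"
  unfolding decomposes_as_product_def
proof (intro conjI G.shift.orbit_rel_measured G.shift.orbit_rel_type_II1 H.shift.orbit_rel_measured H.shift.orbit_rel_type_II1)
  show "standard_nonatomic_prob bernoulli" "standard_nonatomic_prob bernoulli"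
    unfolding standard_nonatomic_prob_def
    using standard_borel_bernoulli bernoulli.prob_space_axioms non_atomic_bernoulli by auto
  let ?P = "{(j x, x) | x. x \<in> space N}"
  obtain f where f: "bimeasurable_bij M (Domain ?P) N (Range ?P) f" "?P = graph_on (Domain ?P) f"
    by (rule pbij_imp_bimeasurable_bij[OF transport_pbij[OF inj']])
  have dr: "Domain ?P = space M" "Range ?P = space N" unfolding space_M by (auto simp: space_N)
  have fj: "f (j u) = u" for u
  proof -
    have "(j u, u) \<in> ?P" unfolding space_N by blast
    then have "(j u, u) \<in> graph_on (Domain ?P) f" by (rule subst[OF f(2), of "\<lambda>A. (j u, u) \<in> A"])
    then show ?thesis unfolding graph_on_def by simp
  qed
  show "isomorphic_rel M (orbit_rel \<Gamma> M \<alpha>) N (product_rel (orbit_rel G bernoulli G.shift) (orbit_rel H bernoulli H.shift))"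
    unfolding isomorphic_rel_def
  proof (intro exI[of _ "space M"] exI[of _ "space N"] exI[of _ f] conjI ballI impI)
    show "bimeasurable_bij M (space M) N (space N) f" using f(1) unfolding dr .
    show "emeasure N (f ` C) = emeasure M C" if C: "C \<in> sets M" for C
    proof -
      obtain A where A: "A \<in> sets N" "C = j ` A" using C sets_transport[OF inj'] by auto
      have "f ` C = A" unfolding A(2) image_image fj by simp
      then show ?thesis unfolding A(2) using emeasure_transport[OF inj' A(1)] A(2) by simp
    qed
    fix r s assume "r \<in> space M" "s \<in> space M"
    then obtain u v where rs: "r = j u" "s = j v" unfolding space_M by auto
    show "(r, s) \<in> orbit_rel \<Gamma> M \<alpha> \<longleftrightarrow>
        (f r, f s) \<in> product_rel (orbit_rel G bernoulli G.shift) (orbit_rel H bernoulli H.shift)"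
      unfolding rs fj by (rule orbit_rel_j)
  qed auto
qed

lemma ergodic_constant_zero:
  assumes fg: "finitely_generated_group \<Gamma>"
  shows "ergodic_isoperimetric_constant \<Gamma> = 0"
proof -
  have sepM: "separated M" and prM: "prob_space M"
    using standard_M standard_borel_separated unfolding standard_nonatomic_prob_def by auto
  interpret \<alpha>: pmp_action \<Gamma> M \<alpha>
    by (unfold pmp_action_def pmp_action_axioms_def, intro conjI allI impI \<alpha>_action prM sepM \<alpha>_measurable \<alpha>_distr
        finitely_generated_countable[OF \<Gamma>.is_group fg])
  have "uniform_isoperimetric_constant M (orbit_rel \<Gamma> M \<alpha>) = 0"
    by (rule product_uniform_isoperimetric_constant[OF standard_M \<alpha>.orbit_rel_measured
          \<alpha>.orbit_rel_finitely_generated[OF fg] \<alpha>_ergodic \<alpha>.orbit_rel_type_II1 \<alpha>_decomposes])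
  moreover have "ergodic_free_pmp_action \<Gamma> M \<alpha>"
    unfolding ergodic_free_pmp_action_def using \<alpha>_action \<alpha>_measurable \<alpha>_distr \<alpha>_free \<alpha>_ergodic by auto
  ultimately have "ergodic_isoperimetric_constant \<Gamma> \<le> 0"
    unfolding ergodic_isoperimetric_constant_def using standard_M
    by (intro INF_lower2[of "(M, \<alpha>)"]) auto
  then show ?thesis by simp
qed

end

theorem corollary21:
  fixes \<Gamma> :: "('g, 'r) monoid_scheme"
    and G :: "('h, 's) monoid_scheme" and H :: "('k, 't) monoid_scheme"
    and M :: "'a measure" and R :: "('a \<times> 'a) set"
    and M1 :: "'b measure" and R1 :: "('b \<times> 'b) set"
    and M2 :: "'c measure" and R2 :: "('c \<times> 'c) set"
  shows
    "(group \<Gamma> \<and> finitely_generated_group \<Gamma> \<and>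
      group G \<and> group H \<and> infinite (carrier G) \<and> infinite (carrier H) \<and> \<Gamma> \<cong> G \<times>\<times> H
      \<longrightarrow> ergodic_isoperimetric_constant \<Gamma> = 0) \<and>
     (standard_nonatomic_prob M \<and> measured_equiv_rel M R \<and>
      finitely_generated_rel M R \<and> ergodic_rel M R \<and> type_II1 M R \<and>
      decomposes_as_product M R M1 R1 M2 R2 \<and>
      infinite_classes M1 R1 \<and> infinite_classes M2 R2
      \<longrightarrow> uniform_isoperimetric_constant M R = 0)"
proof (intro conjI impI; elim conjE)
  assume \<Gamma>: "group \<Gamma>" "finitely_generated_group \<Gamma>" and GH: "group G" "group H"
    and inf: "infinite (carrier G)" "infinite (carrier H)" and "\<Gamma> \<cong> G \<times>\<times> H"
  then obtain \<theta> where \<theta>: "\<theta> \<in> iso \<Gamma> (G \<times>\<times> H)" unfolding is_iso_def by auto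
  have "\<theta> ` carrier \<Gamma> = carrier G \<times> carrier H"
    using \<theta> unfolding iso_def bij_betw_def by (simp add: DirProd_def)
  then have "countable (carrier G \<times> carrier H)"
    using finitely_generated_countable[OF \<Gamma>] by (metis countable_image)
  moreover have "fst ` (carrier G \<times> carrier H) = carrier G" "snd ` (carrier G \<times> carrier H) = carrier H"
    using inf by (auto simp: fst_image_times snd_image_times)
  ultimately have c: "countable (carrier G)" "countable (carrier H)" by (metis countable_image)+
  \<comment> \<open>An infinite countable carrier is enumerated by all naturals without repetition,
    which is the indexing that the shift is built on.\<close>
  obtain e where e: "bij_betw e (UNIV :: nat set) (carrier G)"
    using bij_betw_from_nat_into[OF c(1) inf(1)] by blast
  obtain e' where e': "bij_betw e' (UNIV :: nat set) (carrier H)"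
    using bij_betw_from_nat_into[OF c(2) inf(2)] by blast
  obtain j :: "(nat \<Rightarrow> real) \<times> (nat \<Rightarrow> real) \<Rightarrow> real" where j: "inj j"
    using inj_real_sequence_pairs by blast
  interpret product_bernoulli G e H e' \<Gamma> \<theta> j
    by (intro product_bernoulli.intro bernoulli_shift.intro bernoulli_shift_axioms.intro
        product_bernoulli_axioms.intro \<Gamma> GH e e' \<theta> j)
  show "ergodic_isoperimetric_constant \<Gamma> = 0" by (rule ergodic_constant_zero[OF \<Gamma>(2)])
next
  assume "standard_nonatomic_prob M" "measured_equiv_rel M R" "finitely_generated_rel M R"
    "ergodic_rel M R" "type_II1 M R" "decomposes_as_product M R M1 R1 M2 R2"
  then show "uniform_isoperimetric_constant M R = 0" by (rule product_uniform_isoperimetric_constant)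
qed

end
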